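(* Let $\Lambda$ be an Artin algebra and $\mathcal X$ a resolving and contravariantly finite subcategory of $\mathrm{mod}\text{-}\Lambda$. The class $\mathcal E^{\rm scw}_{\mathcal X}$ is an exact structure (in the sense of Quillen) on the additive category $\mathcal S_{\mathcal X}(\Lambda)$.
   Context: $\Lambda$ is an Artin algebra over a commutative artinian ring; $\mathrm{mod}\text{-}\Lambda$ is the category of finitely generated right $\Lambda$-modules and $\mathrm{prj}\text{-}\Lambda$ its subcategory of projectives. Subcategories are full and closed under isomorphism. $\mathcal X$ is resolving if it contains $\mathrm{prj}\text{-}\Lambda$ and is closed under finite direct sums, direct summands, extensions and kernels of epimorphisms; it is contravariantly finite if every module $M$ admits a morphism $f:X\to M$ with $X\in\mathcal X$ through which every morphism from an object of $\mathcal X$ to $M$ factors. $\mathrm H(\Lambda)$ is the (abelian) morphism category of $\mathrm{mod}\text{-}\Lambda$: objects are morphisms $(A\xrightarrow{f}B)$, morphisms are commutative squares. $\mathcal S_{\mathcal X}(\Lambda)$ is the full subcategory of $\mathrm H(\Lambda)$ of all monomorphisms $(A\xrightarrow{f}B)$ with $A,B,\mathrm{Cok}\,f\in\mathcal X$. $\mathcal E^{\rm scw}_{\mathcal X}$ is the class of all short exact sequences $0\to(X_1\xrightarrow{f}X_2)\to(Z_1\xrightarrow{h}Z_2)\to(Y_1\xrightarrow{g}Y_2)\to0$ of $\mathrm H(\Lambda)$ with terms in $\mathcal S_{\mathcal X}(\Lambda)$ such that $0\to X_i\to Z_i\to Y_i\to0$ ($i=1,2$) and the induced sequence $0\to\mathrm{Cok}\,f\to\mathrm{Cok}\,h\to\mathrm{Cok}\,g\to0$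 are all split. *)

theory Defs
  imports "HOL-Algebra.Module" "HOL-Algebra.Ideal"
begin

section \<open>Additive categories\<close>

text \<open>
  Category data together with the addition of parallel arrows. An arrow knows its source and
  its target, so composition and addition need no object arguments; \<open>g \<cdot>\<^bsub>C\<^esub> f\<close> is ``first \<open>f\<close>,
  then \<open>g\<close>''.
\<close>

record ('o, 'a) cat =
  obj :: "'o set"
  arr :: "'a set"
  src :: "'a \<Rightarrow> 'o"
  tgt :: "'a \<Rightarrow> 'o"
  ident :: "'o \<Rightarrow> 'a"
  comp :: "'a \<Rightarrow> 'a \<Rightarrow> 'a" (infixl \<open>\<cdot>\<index>\<close> 70)
  zero_arr :: "'o \<Rightarrow> 'o \<Rightarrow> 'a"
  add_arr :: "'a \<Rightarrow> 'a \<Rightarrow> 'a"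

definition Hom :: "('o, 'a, 'z) cat_scheme \<Rightarrow> 'o \<Rightarrow> 'o \<Rightarrow> 'a set" where
  "Hom C A B = {f \<in> arr C. src C f = A \<and> tgt C f = B}"

definition mono_arr :: "('o, 'a, 'z) cat_scheme \<Rightarrow> 'a \<Rightarrow> bool" where
  "mono_arr C f \<longleftrightarrow> f \<in> arr C \<and>
     (\<forall>A\<in>obj C. \<forall>u\<in>Hom C A (src C f). \<forall>v\<in>Hom C A (src C f).
        f \<cdot>\<^bsub>C\<^esub> u = f \<cdot>\<^bsub>C\<^esub> v \<longrightarrow> u = v)"

definition epi_arr :: "('o, 'a, 'z) cat_scheme \<Rightarrow> 'a \<Rightarrow> bool" where
  "epi_arr C f \<longleftrightarrow> f \<in> arr C \<and>
     (\<forall>B\<in>obj C. \<forall>u\<in>Hom C (tgt C f) B. \<forall>v\<in>Hom C (tgt C f) B.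
        u \<cdot>\<^bsub>C\<^esub> f = v \<cdot>\<^bsub>C\<^esub> f \<longrightarrow> u = v)"

definition iso_arr :: "('o, 'a, 'z) cat_scheme \<Rightarrow> 'a \<Rightarrow> bool" where
  "iso_arr C f \<longleftrightarrow> f \<in> arr C \<and>
     (\<exists>g\<in>Hom C (tgt C f) (src C f).
        g \<cdot>\<^bsub>C\<^esub> f = ident C (src C f) \<and> f \<cdot>\<^bsub>C\<^esub> g = ident C (tgt C f))"

definition is_kernel :: "('o, 'a, 'z) cat_scheme \<Rightarrow> 'a \<Rightarrow> 'a \<Rightarrow> bool" where
  "is_kernel C i p \<longleftrightarrow> i \<in> arr C \<and> p \<in> arr C \<and> tgt C i = src C p \<and>
     p \<cdot>\<^bsub>C\<^esub> i = zero_arr C (src C i) (tgt C p) \<and>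
     (\<forall>t\<in>arr C. tgt C t = src C p \<and> p \<cdot>\<^bsub>C\<^esub> t = zero_arr C (src C t) (tgt C p) \<longrightarrow>
        (\<exists>!u. u \<in> Hom C (src C t) (src C i) \<and> i \<cdot>\<^bsub>C\<^esub> u = t))"

definition is_cokernel :: "('o, 'a, 'z) cat_scheme \<Rightarrow> 'a \<Rightarrow> 'a \<Rightarrow> bool" where
  "is_cokernel C i p \<longleftrightarrow> i \<in> arr C \<and> p \<in> arr C \<and> tgt C i = src C p \<and>
     p \<cdot>\<^bsub>C\<^esub> i = zero_arr C (src C i) (tgt C p) \<and>
     (\<forall>t\<in>arr C. src C t = tgt C i \<and> t \<cdot>\<^bsub>C\<^esub> i = zero_arr C (src C i) (tgt C t) \<longrightarrow>
        (\<exists>!u. u \<in> Hom C (tgt C p) (tgt C t) \<and> u \<cdot>\<^bsub>C\<^esub> p = t))"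

text \<open>
  Kernel-cokernel pairs. In an abelian category these are exactly the short exact sequences
  \<open>0 \<rightarrow> A \<rightarrow> B \<rightarrow> D \<rightarrow> 0\<close>.
\<close>

definition short_exact :: "('o, 'a, 'z) cat_scheme \<Rightarrow> 'a \<Rightarrow> 'a \<Rightarrow> bool" where
  "short_exact C i p \<longleftrightarrow> is_kernel C i p \<and> is_cokernel C i p"

definition split_short_exact :: "('o, 'a, 'z) cat_scheme \<Rightarrow> 'a \<Rightarrow> 'a \<Rightarrow> bool" where
  "split_short_exact C i p \<longleftrightarrow> short_exact C i p \<and>
     (\<exists>s\<in>Hom C (tgt C p) (src C p). p \<cdot>\<^bsub>C\<^esub> s = ident C (tgt C p))"

definition is_zero_object :: "('o, 'a, 'z) cat_scheme \<Rightarrow> 'o \<Rightarrow> bool" where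
  "is_zero_object C Z \<longleftrightarrow> Z \<in> obj C \<and>
     (\<forall>A\<in>obj C. (\<exists>!f. f \<in> Hom C A Z) \<and> (\<exists>!f. f \<in> Hom C Z A))"

definition is_biproduct ::
  "('o, 'a, 'z) cat_scheme \<Rightarrow> 'o \<Rightarrow> 'o \<Rightarrow> 'o \<Rightarrow> bool" where
  "is_biproduct C A B S \<longleftrightarrow> A \<in> obj C \<and> B \<in> obj C \<and> S \<in> obj C \<and>
     (\<exists>i\<^sub>1\<in>Hom C A S. \<exists>i\<^sub>2\<in>Hom C B S. \<exists>p\<^sub>1\<in>Hom C S A. \<exists>p\<^sub>2\<in>Hom C S B.
        p\<^sub>1 \<cdot>\<^bsub>C\<^esub> i\<^sub>1 = ident C A \<and> p\<^sub>2 \<cdot>\<^bsub>C\<^esub> i\<^sub>2 = ident C B \<and>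
        p\<^sub>2 \<cdot>\<^bsub>C\<^esub> i\<^sub>1 = zero_arr C A B \<and> p\<^sub>1 \<cdot>\<^bsub>C\<^esub> i\<^sub>2 = zero_arr C B A \<and>
        add_arr C (i\<^sub>1 \<cdot>\<^bsub>C\<^esub> p\<^sub>1) (i\<^sub>2 \<cdot>\<^bsub>C\<^esub> p\<^sub>2) = ident C S)"

text \<open>
  The squares \<open>f' \<cdot> i = i' \<cdot> f\<close> (pushout of \<open>i : A \<rightarrow> B\<close> along \<open>f : A \<rightarrow> A'\<close>) and
  \<open>p \<cdot> f' = f \<cdot> p'\<close> (pullback of \<open>p : B \<rightarrow> D\<close> along \<open>f : D' \<rightarrow> D\<close>).
\<close>

definition is_pushout :: "('o, 'a, 'z) cat_scheme \<Rightarrow> 'a \<Rightarrow> 'a \<Rightarrow> 'a \<Rightarrow> 'a \<Rightarrow> bool" where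
  "is_pushout C i f i' f' \<longleftrightarrow> i \<in> arr C \<and> f \<in> arr C \<and> i' \<in> arr C \<and> f' \<in> arr C \<and>
     src C i = src C f \<and> src C f' = tgt C i \<and> src C i' = tgt C f \<and> tgt C f' = tgt C i' \<and>
     f' \<cdot>\<^bsub>C\<^esub> i = i' \<cdot>\<^bsub>C\<^esub> f \<and>
     (\<forall>s\<in>arr C. \<forall>t\<in>arr C. src C s = tgt C i \<and> src C t = tgt C f \<and> tgt C s = tgt C t \<and>
        s \<cdot>\<^bsub>C\<^esub> i = t \<cdot>\<^bsub>C\<^esub> f \<longrightarrow>
        (\<exists>!u. u \<in> Hom C (tgt C f') (tgt C s) \<and> u \<cdot>\<^bsub>C\<^esub> f' = s \<and> u \<cdot>\<^bsub>C\<^esub> i' = t))"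

definition is_pullback :: "('o, 'a, 'z) cat_scheme \<Rightarrow> 'a \<Rightarrow> 'a \<Rightarrow> 'a \<Rightarrow> 'a \<Rightarrow> bool" where
  "is_pullback C p f p' f' \<longleftrightarrow> p \<in> arr C \<and> f \<in> arr C \<and> p' \<in> arr C \<and> f' \<in> arr C \<and>
     tgt C p = tgt C f \<and> tgt C f' = src C p \<and> tgt C p' = src C f \<and> src C f' = src C p' \<and>
     p \<cdot>\<^bsub>C\<^esub> f' = f \<cdot>\<^bsub>C\<^esub> p' \<and>
     (\<forall>s\<in>arr C. \<forall>t\<in>arr C. tgt C s = src C p \<and> tgt C t = src C f \<and> src C s = src C t \<and>
        p \<cdot>\<^bsub>C\<^esub> s = f \<cdot>\<^bsub>C\<^esub> t \<longrightarrow>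
        (\<exists>!u. u \<in> Hom C (src C s) (src C f') \<and> f' \<cdot>\<^bsub>C\<^esub> u = s \<and> p' \<cdot>\<^bsub>C\<^esub> u = t))"

locale additive_category =
  fixes C :: "('o, 'a, 'z) cat_scheme" (structure)
  assumes src_obj: "f \<in> arr C \<Longrightarrow> src C f \<in> obj C"
    and tgt_obj: "f \<in> arr C \<Longrightarrow> tgt C f \<in> obj C"
    and ident_hom: "A \<in> obj C \<Longrightarrow> ident C A \<in> Hom C A A"
    and comp_hom: "\<lbrakk>f \<in> Hom C A B; g \<in> Hom C B D\<rbrakk> \<Longrightarrow> g \<cdot> f \<in> Hom C A D"
    and comp_assoc: "\<lbrakk>f \<in> Hom C A B; g \<in> Hom C B D; h \<in> Hom C D E\<rbrakk>
      \<Longrightarrow> (h \<cdot> g) \<cdot> f = h \<cdot> (g \<cdot> f)"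
    and comp_ident_right: "f \<in> Hom C A B \<Longrightarrow> f \<cdot> ident C A = f"
    and comp_ident_left: "f \<in> Hom C A B \<Longrightarrow> ident C B \<cdot> f = f"
    and hom_group: "\<lbrakk>A \<in> obj C; B \<in> obj C\<rbrakk>
      \<Longrightarrow> comm_group \<lparr>carrier = Hom C A B, monoid.mult = add_arr C, one = zero_arr C A B\<rparr>"
    and comp_add_left: "\<lbrakk>f \<in> Hom C A B; g \<in> Hom C B D; h \<in> Hom C B D\<rbrakk>
      \<Longrightarrow> add_arr C g h \<cdot> f = add_arr C (g \<cdot> f) (h \<cdot> f)"
    and comp_add_right: "\<lbrakk>f \<in> Hom C A B; g \<in> Hom C A B; h \<in> Hom C B D\<rbrakk>
      \<Longrightarrow> h \<cdot> add_arr C f g = add_arr C (h \<cdot> f) (h \<cdot> g)"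
    and zero_object: "\<exists>Z. is_zero_object C Z"
    and biproducts: "\<lbrakk>A \<in> obj C; B \<in> obj C\<rbrakk> \<Longrightarrow> \<exists>S. is_biproduct C A B S"

text \<open>
  Exact structures in the sense of Quillen, in the axiomatisation of Keller and Buehler.
  The admissible monics and admissible epics are the first and second components of the
  members of \<open>\<E>\<close>.
\<close>

locale exact_structure = additive_category C
  for C :: "('o, 'a, 'z) cat_scheme" (structure) +
  fixes \<E> :: "('a \<times> 'a) set"
  assumes kernel_cokernel_pairs: "(i, p) \<in> \<E> \<Longrightarrow> short_exact C i p"
    and iso_closed: "\<lbrakk>(i, p) \<in> \<E>; i' \<in> arr C; p' \<in> arr C; tgt C i' = src C p';
        iso_arr C a; iso_arr C b; iso_arr C c;
        a \<in> Hom C (src C i) (src C i'); b \<in> Hom C (tgt C i) (tgt C i');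
        c \<in> Hom C (tgt C p) (tgt C p');
        b \<cdot> i = i' \<cdot> a; c \<cdot> p = p' \<cdot> b\<rbrakk> \<Longrightarrow> (i', p') \<in> \<E>"
    and ident_monic: "A \<in> obj C \<Longrightarrow> ident C A \<in> fst ` \<E>"
    and ident_epic: "A \<in> obj C \<Longrightarrow> ident C A \<in> snd ` \<E>"
    and comp_monic: "\<lbrakk>i \<in> fst ` \<E>; j \<in> fst ` \<E>; tgt C i = src C j\<rbrakk> \<Longrightarrow> j \<cdot> i \<in> fst ` \<E>"
    and comp_epic: "\<lbrakk>p \<in> snd ` \<E>; q \<in> snd ` \<E>; tgt C p = src C q\<rbrakk> \<Longrightarrow> q \<cdot> p \<in> snd ` \<E>"
    and pushout_monic: "\<lbrakk>i \<in> fst ` \<E>; f \<in> arr C; src C f = src C i\<rbrakk>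
      \<Longrightarrow> \<exists>i' f'. is_pushout C i f i' f' \<and> i' \<in> fst ` \<E>"
    and pullback_epic: "\<lbrakk>p \<in> snd ` \<E>; f \<in> arr C; tgt C f = tgt C p\<rbrakk>
      \<Longrightarrow> \<exists>p' f'. is_pullback C p f p' f' \<and> p' \<in> snd ` \<E>"

definition full_subcategory :: "('o, 'a) cat \<Rightarrow> 'o set \<Rightarrow> ('o, 'a) cat" where
  "full_subcategory C P =
     C\<lparr>obj := obj C \<inter> P, arr := {f \<in> arr C. src C f \<in> P \<and> tgt C f \<in> P}\<rparr>"


section \<open>Resolving and contravariantly finite subcategories\<close>

text \<open>A full subcategory is given by its set of objects.\<close>

definition projective_objects :: "('o, 'a, 'z) cat_scheme \<Rightarrow> 'o set" where
  "projective_objects C = {P \<in> obj C. \<forall>e f. epi_arr C e \<and> f \<in> Hom C P (tgt C e) \<longrightarrow>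
     (\<exists>h\<in>Hom C P (src C e). e \<cdot>\<^bsub>C\<^esub> h = f)}"

locale resolving =
  fixes C :: "('o, 'a, 'z) cat_scheme" (structure) and X :: "'o set"
  assumes sub_obj: "X \<subseteq> obj C"
    and iso_closed: "\<lbrakk>iso_arr C f; src C f \<in> X\<rbrakk> \<Longrightarrow> tgt C f \<in> X"
    and projectives: "projective_objects C \<subseteq> X"
    and zero_closed: "is_zero_object C Z \<Longrightarrow> Z \<in> X"
    and sum_closed: "\<lbrakk>A \<in> X; B \<in> X; is_biproduct C A B S\<rbrakk> \<Longrightarrow> S \<in> X"
    and summand_closed: "\<lbrakk>S \<in> X; is_biproduct C A B S\<rbrakk> \<Longrightarrow> A \<in> X"
    and extension_closed: "\<lbrakk>short_exact C i p; src C i \<in> X; tgt C p \<in> X\<rbrakk> \<Longrightarrow> tgt C i \<in> X"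
    and epi_kernel_closed: "\<lbrakk>epi_arr C p; is_kernel C i p; src C p \<in> X; tgt C p \<in> X\<rbrakk>
      \<Longrightarrow> src C i \<in> X"

definition contravariantly_finite :: "('o, 'a, 'z) cat_scheme \<Rightarrow> 'o set \<Rightarrow> bool" where
  "contravariantly_finite C X \<longleftrightarrow> (\<forall>M\<in>obj C. \<exists>f\<in>arr C. src C f \<in> X \<and> tgt C f = M \<and>
     (\<forall>g\<in>arr C. src C g \<in> X \<and> tgt C g = M \<longrightarrow>
        (\<exists>h\<in>Hom C (src C g) (src C f). f \<cdot>\<^bsub>C\<^esub> h = g)))"


section \<open>The morphism category\<close>

text \<open>
  \<open>Square f a b g\<close> is the morphism from \<open>f : A \<rightarrow> B\<close> to \<open>g : A' \<rightarrow> B'\<close> with components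
  \<open>a : A \<rightarrow> A'\<close> and \<open>b : B \<rightarrow> B'\<close>.
\<close>

datatype 'a square = Square (sq_src: 'a) (sq_fst: 'a) (sq_snd: 'a) (sq_tgt: 'a)

definition morphism_category :: "('o, 'a) cat \<Rightarrow> ('a, 'a square) cat" where
  "morphism_category C =
    \<lparr>obj = arr C,
     arr = {Square f a b g | f a b g. f \<in> arr C \<and> g \<in> arr C \<and>
              a \<in> Hom C (src C f) (src C g) \<and> b \<in> Hom C (tgt C f) (tgt C g) \<and>
              g \<cdot>\<^bsub>C\<^esub> a = b \<cdot>\<^bsub>C\<^esub> f},
     src = sq_src,
     tgt = sq_tgt,
     ident = (\<lambda>f. Square f (ident C (src C f)) (ident C (tgt C f)) f),
     comp = (\<lambda>\<psi> \<phi>. Square (sq_src \<phi>) (sq_fst \<psi> \<cdot>\<^bsub>C\<^esub> sq_fst \<phi>) (sq_snd \<psi> \<cdot>\<^bsub>C\<^esub> sq_snd \<phi>) (sq_tgt \<psi>)),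
     zero_arr = (\<lambda>f g. Square f (zero_arr C (src C f) (src C g)) (zero_arr C (tgt C f) (tgt C g)) g),
     add_arr = (\<lambda>\<phi> \<psi>. Square (sq_src \<phi>) (add_arr C (sq_fst \<phi>) (sq_fst \<psi>))
                               (add_arr C (sq_snd \<phi>) (sq_snd \<psi>)) (sq_tgt \<phi>))\<rparr>"

text \<open>
  Cokernels are determined only up to isomorphism; as \<open>X\<close> is closed under isomorphism, it does
  not matter which cokernel of \<open>f\<close> is tested for membership in \<open>X\<close>.
\<close>

definition mono_objects :: "('o, 'a) cat \<Rightarrow> 'o set \<Rightarrow> 'a set" where
  "mono_objects C X = {f. mono_arr C f \<and> src C f \<in> X \<and> tgt C f \<in> X \<and>
     (\<exists>c. is_cokernel C f c \<and> tgt C c \<in> X)}"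

definition mono_category :: "('o, 'a) cat \<Rightarrow> 'o set \<Rightarrow> ('a, 'a square) cat" where
  "mono_category C X = full_subcategory (morphism_category C) (mono_objects C X)"

text \<open>
  In \<open>scw_class\<close>, \<open>u\<close> and \<open>v\<close> are the arrows that \<open>\<phi>\<close> and \<open>\<psi>\<close> induce on (any choice of) the
  cokernels of the three objects.
\<close>

definition scw_class :: "('o, 'a) cat \<Rightarrow> 'o set \<Rightarrow> ('a square \<times> 'a square) set" where
  "scw_class C X = {(\<phi>, \<psi>).
     short_exact (morphism_category C) \<phi> \<psi> \<and>
     sq_src \<phi> \<in> mono_objects C X \<and> sq_tgt \<phi> \<in> mono_objects C X \<and>
     sq_tgt \<psi> \<in> mono_objects C X \<and>
     split_short_exact C (sq_fst \<phi>) (sq_fst \<psi>) \<and>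
     split_short_exact C (sq_snd \<phi>) (sq_snd \<psi>) \<and>
     (\<exists>cf ch cg u v. is_cokernel C (sq_src \<phi>) cf \<and> is_cokernel C (sq_tgt \<phi>) ch \<and>
        is_cokernel C (sq_tgt \<psi>) cg \<and>
        u \<in> Hom C (tgt C cf) (tgt C ch) \<and> u \<cdot>\<^bsub>C\<^esub> cf = ch \<cdot>\<^bsub>C\<^esub> sq_snd \<phi> \<and>
        v \<in> Hom C (tgt C ch) (tgt C cg) \<and> v \<cdot>\<^bsub>C\<^esub> ch = cg \<cdot>\<^bsub>C\<^esub> sq_snd \<psi> \<and>
        split_short_exact C u v)}"


section \<open>Artin algebras and their finitely generated right modules\<close>

definition artinian_cring :: "('r, 'y) ring_scheme \<Rightarrow> bool" where
  "artinian_cring R \<longleftrightarrow> cring R \<and>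
     (\<forall>I. (\<forall>n::nat. ideal (I n) R \<and> I (Suc n) \<subseteq> I n) \<longrightarrow> (\<exists>n. \<forall>m\<ge>n. I m = I n))"

text \<open>
  The library's locale \<open>algebra\<close> asks for a commutative algebra, hence the separate
  definition. The last assumption says that \<open>\<Lambda>\<close> is finitely generated over \<open>R\<close>.
\<close>

locale artin_algebra = module R \<Lambda> + ring \<Lambda>
  for R :: "('r, 'y) ring_scheme" and \<Lambda> :: "('r, 'l, 'z) module_scheme" +
  assumes artinian: "artinian_cring R"
    and smult_mult_left: "\<lbrakk>r \<in> carrier R; x \<in> carrier \<Lambda>; y \<in> carrier \<Lambda>\<rbrakk>
      \<Longrightarrow> r \<odot>\<^bsub>\<Lambda>\<^esub> (x \<otimes>\<^bsub>\<Lambda>\<^esub> y) = (r \<odot>\<^bsub>\<Lambda>\<^esub> x) \<otimes>\<^bsub>\<Lambda>\<^esub> y"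
    and smult_mult_right: "\<lbrakk>r \<in> carrier R; x \<in> carrier \<Lambda>; y \<in> carrier \<Lambda>\<rbrakk>
      \<Longrightarrow> r \<odot>\<^bsub>\<Lambda>\<^esub> (x \<otimes>\<^bsub>\<Lambda>\<^esub> y) = x \<otimes>\<^bsub>\<Lambda>\<^esub> (r \<odot>\<^bsub>\<Lambda>\<^esub> y)"
    and module_finite: "\<exists>S. finite S \<and> S \<subseteq> carrier \<Lambda> \<and>
      (\<forall>x\<in>carrier \<Lambda>. \<exists>c\<in>S \<rightarrow> carrier R. x = (\<Oplus>\<^bsub>\<Lambda>\<^esub>s\<in>S. c s \<odot>\<^bsub>\<Lambda>\<^esub> s))"

text \<open>
  As in the library's record \<open>module\<close>, the fields \<open>mult\<close> and \<open>one\<close> inherited from \<open>ring\<close> are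
  not used.
\<close>

record ('l, 'm) rmodule = "'m ring" +
  ract :: "'m \<Rightarrow> 'l \<Rightarrow> 'm" (infixl \<open>\<triangleleft>\<index>\<close> 70)

locale right_module = ring \<Lambda> + M: abelian_group M
  for \<Lambda> :: "('l, 'z) ring_scheme" and M :: "('l, 'm, 'w) rmodule_scheme" +
  assumes ract_closed: "\<lbrakk>x \<in> carrier M; a \<in> carrier \<Lambda>\<rbrakk> \<Longrightarrow> x \<triangleleft>\<^bsub>M\<^esub> a \<in> carrier M"
    and ract_add_left: "\<lbrakk>x \<in> carrier M; y \<in> carrier M; a \<in> carrier \<Lambda>\<rbrakk>
      \<Longrightarrow> (x \<oplus>\<^bsub>M\<^esub> y) \<triangleleft>\<^bsub>M\<^esub> a = x \<triangleleft>\<^bsub>M\<^esub> a \<oplus>\<^bsub>M\<^esub> y \<triangleleft>\<^bsub>M\<^esub> a"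
    and ract_add_right: "\<lbrakk>x \<in> carrier M; a \<in> carrier \<Lambda>; b \<in> carrier \<Lambda>\<rbrakk>
      \<Longrightarrow> x \<triangleleft>\<^bsub>M\<^esub> (a \<oplus>\<^bsub>\<Lambda>\<^esub> b) = x \<triangleleft>\<^bsub>M\<^esub> a \<oplus>\<^bsub>M\<^esub> x \<triangleleft>\<^bsub>M\<^esub> b"
    and ract_assoc: "\<lbrakk>x \<in> carrier M; a \<in> carrier \<Lambda>; b \<in> carrier \<Lambda>\<rbrakk>
      \<Longrightarrow> x \<triangleleft>\<^bsub>M\<^esub> (a \<otimes>\<^bsub>\<Lambda>\<^esub> b) = (x \<triangleleft>\<^bsub>M\<^esub> a) \<triangleleft>\<^bsub>M\<^esub> b"
    and ract_one: "x \<in> carrier M \<Longrightarrow> x \<triangleleft>\<^bsub>M\<^esub> \<one>\<^bsub>\<Lambda>\<^esub> = x"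

definition fin_gen :: "('l, 'z) ring_scheme \<Rightarrow> ('l, 'm, 'w) rmodule_scheme \<Rightarrow> bool" where
  "fin_gen \<Lambda> M \<longleftrightarrow> (\<exists>S. finite S \<and> S \<subseteq> carrier M \<and>
     (\<forall>x\<in>carrier M. \<exists>c\<in>S \<rightarrow> carrier \<Lambda>. x = (\<Oplus>\<^bsub>M\<^esub>s\<in>S. s \<triangleleft>\<^bsub>M\<^esub> c s)))"

definition rmodule_hom ::
  "('l, 'z) ring_scheme \<Rightarrow> ('l, 'm, 'v) rmodule_scheme \<Rightarrow> ('l, 'n, 'w) rmodule_scheme
    \<Rightarrow> ('m \<Rightarrow> 'n) set" where
  "rmodule_hom \<Lambda> M N = {f \<in> carrier M \<rightarrow> carrier N.
     (\<forall>x\<in>carrier M. \<forall>y\<in>carrier M. f (x \<oplus>\<^bsub>M\<^esub> y) = f x \<oplus>\<^bsub>N\<^esub> f y) \<and>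
     (\<forall>x\<in>carrier M. \<forall>a\<in>carrier \<Lambda>. f (x \<triangleleft>\<^bsub>M\<^esub> a) = f x \<triangleleft>\<^bsub>N\<^esub> a)}"

text \<open>
  Arrows are homomorphisms tagged with source and target; the underlying functions are
  extensional, so that two arrows are equal iff they agree on the carrier of the source.
\<close>

datatype ('l, 'm) rmod_arrow =
  RArrow (rsrc: "('l, 'm) rmodule") (rfun: "'m \<Rightarrow> 'm") (rtgt: "('l, 'm) rmodule")

definition mod_category ::
  "('l, 'z) ring_scheme \<Rightarrow> (('l, 'm) rmodule, ('l, 'm) rmod_arrow) cat" where
  "mod_category \<Lambda> =
    \<lparr>obj = {M. right_module \<Lambda> M \<and> fin_gen \<Lambda> M},
     arr = {RArrow M f N | M f N. right_module \<Lambda> M \<and> fin_gen \<Lambda> M \<and>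
              right_module \<Lambda> N \<and> fin_gen \<Lambda> N \<and>
              f \<in> rmodule_hom \<Lambda> M N \<and> f \<in> extensional (carrier M)},
     src = rsrc,
     tgt = rtgt,
     ident = (\<lambda>M. RArrow M (\<lambda>x\<in>carrier M. x) M),
     comp = (\<lambda>g f. RArrow (rsrc f) (compose (carrier (rsrc f)) (rfun g) (rfun f)) (rtgt g)),
     zero_arr = (\<lambda>M N. RArrow M (\<lambda>x\<in>carrier M. \<zero>\<^bsub>N\<^esub>) N),
     add_arr = (\<lambda>f g. RArrow (rsrc f)
                  (\<lambda>x\<in>carrier (rsrc f). rfun f x \<oplus>\<^bsub>rtgt f\<^esub> rfun g x) (rtgt f))\<rparr>"

text \<open>
  The elements of the modules in \<open>mod_category \<Lambda>\<close> come from a fixed type \<open>'m\<close>. If finite lists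
  over \<open>\<Lambda>\<close> embed into \<open>'m\<close>, every finitely generated right \<open>\<Lambda>\<close>-module, on whatever type, is
  isomorphic to one on \<open>'m\<close>, so that \<open>mod_category \<Lambda>\<close> is equivalent to the category of all
  finitely generated right \<open>\<Lambda>\<close>-modules.
\<close>

lemma fin_gen_module_representable:
  fixes \<Lambda> :: "('l, 'z) ring_scheme" and M :: "('l, 'n) rmodule" and e :: "'l list \<Rightarrow> 'm"
  assumes M: "right_module \<Lambda> M" "fin_gen \<Lambda> M" and e: "inj_on e (lists (carrier \<Lambda>))"
  shows "\<exists>(N :: ('l, 'm) rmodule) h. right_module \<Lambda> N \<and> fin_gen \<Lambda> N \<and>
    h \<in> rmodule_hom \<Lambda> M N \<and> bij_betw h (carrier M) (carrier N)"
proof -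
  interpret M: right_module \<Lambda> M by (rule M(1))
  from M(2) obtain S where S: "finite S" "S \<subseteq> carrier M"
    and gen: "\<forall>x\<in>carrier M. \<exists>c\<in>S \<rightarrow> carrier \<Lambda>. x = (\<Oplus>\<^bsub>M\<^esub>s\<in>S. s \<triangleleft>\<^bsub>M\<^esub> c s)"
    unfolding fin_gen_def by blast
  obtain c where c: "\<And>x. x \<in> carrier M \<Longrightarrow> c x \<in> S \<rightarrow> carrier \<Lambda>"
    and xc: "\<And>x. x \<in> carrier M \<Longrightarrow> x = (\<Oplus>\<^bsub>M\<^esub>s\<in>S. s \<triangleleft>\<^bsub>M\<^esub> c x s)"
    using gen by metis
  obtain xs where xs: "set xs = S" using finite_list[OF S(1)] by blast
  define h where "h x = e (map (c x) xs)" for x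
  have inj: "inj_on h (carrier M)"
  proof (rule inj_onI)
    fix x y assume x: "x \<in> carrier M" and y: "y \<in> carrier M" and eq: "h x = h y"
    have "map (c x) xs \<in> lists (carrier \<Lambda>)" "map (c y) xs \<in> lists (carrier \<Lambda>)"
      using c[OF x] c[OF y] xs by auto
    with e eq have "map (c x) xs = map (c y) xs" unfolding h_def by (auto dest: inj_onD)
    hence cs: "\<And>s. s \<in> S \<Longrightarrow> c x s = c y s" using xs by auto
    have "(\<Oplus>\<^bsub>M\<^esub>s\<in>S. s \<triangleleft>\<^bsub>M\<^esub> c x s) = (\<Oplus>\<^bsub>M\<^esub>s\<in>S. s \<triangleleft>\<^bsub>M\<^esub> c y s)"
      using S c[OF x] c[OF y] cs by (intro M.M.finsum_cong') (auto intro!: M.ract_closed simp: Pi_iff subset_iff)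
    thus "x = y" using xc[OF x] xc[OF y] by simp
  qed
  define g where "g = the_inv_into (carrier M) h"
  have gh [simp]: "g (h x) = x" if "x \<in> carrier M" for x
    using the_inv_into_f_f[OF inj that] by (simp add: g_def)
  define N :: "('l, 'm) rmodule" where "N = \<lparr>carrier = h ` carrier M, monoid.mult = undefined,
    one = undefined, zero = h \<zero>\<^bsub>M\<^esub>, add = (\<lambda>u v. h (g u \<oplus>\<^bsub>M\<^esub> g v)),
    ract = (\<lambda>u a. h (g u \<triangleleft>\<^bsub>M\<^esub> a))\<rparr>"
  have N [simp]: "carrier N = h ` carrier M" "\<zero>\<^bsub>N\<^esub> = h \<zero>\<^bsub>M\<^esub>"
    "\<And>u v. u \<oplus>\<^bsub>N\<^esub> v = h (g u \<oplus>\<^bsub>M\<^esub> g v)" "\<And>u a. u \<triangleleft>\<^bsub>N\<^esub> a = h (g u \<triangleleft>\<^bsub>M\<^esub> a)"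
    by (simp_all add: N_def)
  note [simp] = M.ract_closed
  have "abelian_group N"
  proof (rule abelian_groupI)
    fix u assume "u \<in> carrier N"
    then obtain x where "x \<in> carrier M" "u = h x" by auto
    thus "\<exists>v\<in>carrier N. v \<oplus>\<^bsub>N\<^esub> u = \<zero>\<^bsub>N\<^esub>"
      by (auto intro!: bexI[of _ "\<ominus>\<^bsub>M\<^esub> x"] simp: M.M.l_neg)
  qed (auto simp: M.M.a_ac)
  hence rm: "right_module \<Lambda> N"
    by (intro right_module.intro right_module_axioms.intro M.ring_axioms)
      (auto simp: M.ract_add_left M.ract_add_right M.ract_assoc M.ract_one)
  then interpret N: right_module \<Lambda> N .
  have hom: "h (\<Oplus>\<^bsub>M\<^esub>s\<in>T. f s) = (\<Oplus>\<^bsub>N\<^esub>s\<in>T. h (f s))"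
    if "finite T" "f \<in> T \<rightarrow> carrier M" for T and f :: "'n \<Rightarrow> 'n"
    using that
  proof (induction T)
    case empty
    show ?case by simp
  next
    case (insert s T)
    have "(\<Oplus>\<^bsub>N\<^esub>t\<in>insert s T. h (f t)) = h (f s) \<oplus>\<^bsub>N\<^esub> (\<Oplus>\<^bsub>N\<^esub>t\<in>T. h (f t))"
      using insert by (intro N.M.finsum_insert) auto
    moreover have "(\<Oplus>\<^bsub>M\<^esub>t\<in>insert s T. f t) = f s \<oplus>\<^bsub>M\<^esub> (\<Oplus>\<^bsub>M\<^esub>t\<in>T. f t)"
      using insert by (intro M.M.finsum_insert) auto
    moreover have "(\<Oplus>\<^bsub>M\<^esub>t\<in>T. f t) \<in> carrier M"
      using insert by (intro M.M.finsum_closed) auto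
    ultimately show ?case using insert by (simp flip: insert.IH)
  qed
  have injS: "inj_on h S" using inj S(2) inj_on_subset by blast
  have "fin_gen \<Lambda> N"
    unfolding fin_gen_def
  proof (intro exI[of _ "h ` S"] conjI ballI)
    fix u assume "u \<in> carrier N"
    then obtain x where x: "x \<in> carrier M" "u = h x" by auto
    have "u = h (\<Oplus>\<^bsub>M\<^esub>s\<in>S. s \<triangleleft>\<^bsub>M\<^esub> c x s)" using x xc by metis
    also have "\<dots> = (\<Oplus>\<^bsub>N\<^esub>s\<in>S. h (s \<triangleleft>\<^bsub>M\<^esub> c x s))"
      using S c[OF x(1)] by (intro hom) (auto simp: Pi_iff subset_iff)
    also have "\<dots> = (\<Oplus>\<^bsub>N\<^esub>s\<in>S. h s \<triangleleft>\<^bsub>N\<^esub> c x (g (h s)))"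
      using S c[OF x(1)] by (intro N.M.finsum_cong') (auto simp: Pi_iff subset_iff)
    also have "\<dots> = (\<Oplus>\<^bsub>N\<^esub>t\<in>h ` S. t \<triangleleft>\<^bsub>N\<^esub> c x (g t))"
      using S(2) c[OF x(1)]
      by (intro N.M.finsum_reindex[symmetric] injS) (auto simp: subset_iff Pi_iff)
    finally have "u = (\<Oplus>\<^bsub>N\<^esub>t\<in>h ` S. t \<triangleleft>\<^bsub>N\<^esub> c x (g t))" .
    moreover have "(\<lambda>t. c x (g t)) \<in> h ` S \<rightarrow> carrier \<Lambda>"
      using S(2) c[OF x(1)] by (auto simp: subset_iff Pi_iff)
    ultimately show "\<exists>d\<in>h ` S \<rightarrow> carrier \<Lambda>. u = (\<Oplus>\<^bsub>N\<^esub>t\<in>h ` S. t \<triangleleft>\<^bsub>N\<^esub> d t)"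
      by (intro bexI[of _ "\<lambda>t. c x (g t)"])
  qed (use S in auto)
  moreover have "h \<in> rmodule_hom \<Lambda> M N" by (auto simp: rmodule_hom_def)
  moreover have "bij_betw h (carrier M) (carrier N)" using inj by (simp add: bij_betw_def)
  ultimately show ?thesis using rm by blast
qed

end

theory Submission
  imports Defs
begin

text \<open>
  The argument takes place in an additive category \<open>C\<close> with a class \<open>X\<close> of objects that is closed
  under finite direct sums. Let \<open>x : X1 \<rightarrow> X2\<close> and \<open>y : Y1 \<rightarrow> Y2\<close> be objects of the monomorphism
  category and \<open>c\<close> a cokernel of \<open>x\<close>.

  A sequence \<open>0 \<rightarrow> x \<rightarrow> z \<rightarrow> y \<rightarrow> 0\<close> whose components split is a triangular matrix: after choosing
  splittings, \<open>z : X1 \<oplus> Y1 \<rightarrow> X2 \<oplus> Y2\<close> has diagonal \<open>x\<close>, \<open>y\<close> and a corner \<open>\<delta> : Y1 \<rightarrow> X2\<close>. The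
  induced sequence of cokernels splits iff \<open>Cok x \<rightarrow> Cok z\<close> has a retraction, that is, iff there is
  an arrow \<open>r : X2 \<oplus> Y2 \<rightarrow> Cok x\<close> that restricts to \<open>c\<close> on \<open>X2\<close> and annihilates \<open>z\<close>. Such an \<open>r\<close>
  has a second entry \<open>h : Y2 \<rightarrow> Cok x\<close>, and \<open>r \<cdot> z = 0\<close> becomes the cocycle equation
  \<open>c \<cdot> \<delta> + h \<cdot> y = 0\<close> (\<open>scw_data_expand\<close>). Conversely, each solution \<open>(\<delta>, h)\<close> gives a sequence of the
  class (\<open>extension_of_cocycle\<close>); its middle object \<open>z\<close> is monic with cokernel \<open>Cok x \<oplus> Cok y\<close>
  (\<open>extension_mono\<close>, \<open>extension_cokernel\<close>), so it lies in the monomorphism category again.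

  In terms of cocycles the axioms of an exact structure become transparent. The pushout along
  \<open>(f1, f2) : x \<rightarrow> x'\<close> with induced arrow \<open>g : Cok x \<rightarrow> Cok x'\<close> has cocycle \<open>(f2 \<cdot> \<delta>, g \<cdot> h)\<close>, the
  pullback along \<open>(f1, f2) : y' \<rightarrow> y\<close> has cocycle \<open>(\<delta> \<cdot> f1, h \<cdot> f2)\<close>, and the cocycle equation is
  preserved (\<open>scw_pushout\<close>, \<open>scw_pullback\<close>). The cokernel of a composite of admissible monics
  \<open>x \<rightarrow> z \<rightarrow> w\<close> is the pushout of \<open>z \<rightarrow> w\<close> along the cokernel of \<open>x \<rightarrow> z\<close>; hence it is available in
  the subcategory, and the arrows \<open>r\<close> of the two sequences compose (\<open>scw_comp_monic\<close>). The case of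
  epics is dual. Kernels, cokernels, pushouts and pullbacks in the morphism category are computed
  componentwise, and the full subcategory inherits them.

  For modules it remains to see that \<open>mod_category \<Lambda>\<close> is additive (\<open>mod_category_additive\<close>).
  The point that needs care is the direct sum: for two modules on \<open>'m\<close> it is a module on
  \<open>'m \<times> 'm\<close>. As it is finitely generated, the embedding of lists over \<open>\<Lambda>\<close> into \<open>'m\<close> provides an
  isomorphic copy on \<open>'m\<close>.
\<close>

section \<open>Calculus in additive categories\<close>

lemma Hom_iff: "f \<in> Hom C A B \<longleftrightarrow> f \<in> arr C \<and> src C f = A \<and> tgt C f = B"
  by (simp add: Hom_def)

context additive_category
begin

abbreviation add (infixl \<open>\<boxplus>\<close> 65) where "f \<boxplus> g \<equiv> add_arr C f g"

lemma comp_arr [simp]: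
  assumes "f \<in> arr C" "g \<in> arr C" "tgt C f = src C g"
  shows "g \<cdot> f \<in> arr C" "src C (g \<cdot> f) = src C f" "tgt C (g \<cdot> f) = tgt C g"
  using comp_hom[of f "src C f" "tgt C f" g "tgt C g"] assms by (auto simp: Hom_iff)

lemma ident_arr [simp]:
  assumes "A \<in> obj C"
  shows "ident C A \<in> arr C" "src C (ident C A) = A" "tgt C (ident C A) = A"
  using ident_hom[OF assms] by (auto simp: Hom_iff)

lemma assoc:
  assumes "f \<in> arr C" "g \<in> arr C" "h \<in> arr C" "tgt C f = src C g" "tgt C g = src C h"
  shows "(h \<cdot> g) \<cdot> f = h \<cdot> (g \<cdot> f)"
  using comp_assoc[of f _ _ g _ h] assms by (auto simp: Hom_iff)

lemma comp_ident [simp]: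
  assumes "f \<in> arr C"
  shows "src C f = A \<Longrightarrow> f \<cdot> ident C A = f" "tgt C f = A \<Longrightarrow> ident C A \<cdot> f = f"
  using comp_ident_left[of f] comp_ident_right[of f] assms by (auto simp: Hom_iff)

lemma zero_hom:
  assumes "A \<in> obj C" "B \<in> obj C"
  shows "zero_arr C A B \<in> Hom C A B"
proof -
  interpret comm_group "\<lparr>carrier = Hom C A B, monoid.mult = add_arr C, one = zero_arr C A B\<rparr>"
    by (rule hom_group[OF assms])
  show ?thesis using one_closed by simp
qed

lemma zero_arr [simp]:
  assumes "A \<in> obj C" "B \<in> obj C"
  shows "zero_arr C A B \<in> arr C" "src C (zero_arr C A B) = A" "tgt C (zero_arr C A B) = B"
  using zero_hom[OF assms] by (auto simp: Hom_iff)

lemma Hom_obj: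
  assumes "f \<in> Hom C A B"
  shows "A \<in> obj C" "B \<in> obj C"
  using assms src_obj tgt_obj by (auto simp: Hom_iff)

lemma add_Hom:
  assumes "f \<in> Hom C A B" "g \<in> Hom C A B"
  shows "f \<boxplus> g \<in> Hom C A B" "f \<boxplus> g = g \<boxplus> f" "zero_arr C A B \<boxplus> f = f"
    "h \<in> Hom C A B \<Longrightarrow> (f \<boxplus> g) \<boxplus> h = f \<boxplus> (g \<boxplus> h)"
    "h \<in> Hom C A B \<Longrightarrow> f \<boxplus> g = f \<boxplus> h \<longleftrightarrow> g = h"
    "\<exists>n\<in>Hom C A B. f \<boxplus> n = g"
proof -
  interpret comm_group "\<lparr>carrier = Hom C A B, monoid.mult = add_arr C, one = zero_arr C A B\<rparr>"
    by (rule hom_group[OF Hom_obj[OF assms(1)]])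
  show "f \<boxplus> g \<in> Hom C A B" "f \<boxplus> g = g \<boxplus> f" "zero_arr C A B \<boxplus> f = f"
    using assms m_closed[of f g] m_comm[of f g] l_one[of f] by simp_all
  show "h \<in> Hom C A B \<Longrightarrow> (f \<boxplus> g) \<boxplus> h = f \<boxplus> (g \<boxplus> h)"
    using assms m_assoc[of f g h] by simp
  let ?G = "\<lparr>carrier = Hom C A B, monoid.mult = add_arr C, one = zero_arr C A B\<rparr>"
  let ?G = "\<lparr>carrier = Hom C A B, monoid.mult = add_arr C, one = zero_arr C A B\<rparr>"
  have inv: "inv\<^bsub>?G\<^esub> f \<in> Hom C A B" "f \<boxplus> (inv\<^bsub>?G\<^esub> f) = zero_arr C A B"
    using inv_closed[of f] r_inv[of f] assms by simp_all
  hence "f \<boxplus> ((inv\<^bsub>?G\<^esub> f) \<boxplus> g) = g" "(inv\<^bsub>?G\<^esub> f) \<boxplus> g \<in> Hom C A B"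
    using m_assoc[of f "inv\<^bsub>?G\<^esub> f" g] m_closed[of "inv\<^bsub>?G\<^esub> f" g] l_one[of g] assms by simp_all
  thus "\<exists>n\<in>Hom C A B. f \<boxplus> n = g" by blast
  have inv_sum: "(inv\<^bsub>?G\<^esub> f) \<boxplus> (f \<boxplus> k) = k" if "k \<in> Hom C A B" for k
    using m_assoc[of "inv\<^bsub>?G\<^esub> f" f k] l_inv[of f] l_one[of k] inv(1) that assms by simp
  show "f \<boxplus> g = f \<boxplus> h \<longleftrightarrow> g = h" if "h \<in> Hom C A B"
    using inv_sum[OF assms(2)] inv_sum[OF that] by metis
qed

lemma sum_arr [simp]:
  assumes "f \<in> arr C" "g \<in> arr C" "src C f = src C g" "tgt C f = tgt C g"
  shows "f \<boxplus> g \<in> arr C" "src C (f \<boxplus> g) = src C f" "tgt C (f \<boxplus> g) = tgt C f"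
  using add_Hom(1)[of f "src C f" "tgt C f" g] assms by (auto simp: Hom_iff)

lemma sum_comm:
  assumes "f \<in> arr C" "g \<in> arr C" "src C f = src C g" "tgt C f = tgt C g"
  shows "f \<boxplus> g = g \<boxplus> f"
  using add_Hom(2)[of f "src C f" "tgt C f" g] assms by (auto simp: Hom_iff)

lemma sum_assoc:
  assumes "f \<in> arr C" "g \<in> arr C" "src C f = src C g" "tgt C f = tgt C g"
    "h \<in> arr C" "src C g = src C h" "tgt C g = tgt C h"
  shows "(f \<boxplus> g) \<boxplus> h = f \<boxplus> (g \<boxplus> h)"
  using add_Hom(4)[of f "src C f" "tgt C f" g h] assms by (auto simp: Hom_iff)

lemma sum_left_comm:
  assumes "f \<in> arr C" "g \<in> arr C" "src C f = src C g" "tgt C f = tgt C g"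
    "h \<in> arr C" "src C g = src C h" "tgt C g = tgt C h"
  shows "f \<boxplus> (g \<boxplus> h) = g \<boxplus> (f \<boxplus> h)"
  using sum_assoc[of f g h] sum_assoc[of g f h] sum_comm[of f g] assms by simp

lemma sum_zero [simp]:
  assumes "f \<in> arr C" "src C f = A" "tgt C f = B"
  shows "zero_arr C A B \<boxplus> f = f" "f \<boxplus> zero_arr C A B = f"
proof -
  have f: "f \<in> Hom C A B" using assms by (simp add: Hom_iff)
  show "zero_arr C A B \<boxplus> f = f" by (rule add_Hom(3)[OF f f])
  thus "f \<boxplus> zero_arr C A B = f" using add_Hom(2)[OF f zero_hom[OF Hom_obj[OF f]]] by simp
qed

lemma sum_cancel:
  assumes "f \<in> Hom C A B" "g \<in> Hom C A B" "h \<in> Hom C A B" "f \<boxplus> g = f \<boxplus> h"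
  shows "g = h"
  using add_Hom(5)[OF assms(1,2,3)] assms(4) by simp

lemma sum_cancel_right:
  assumes "f \<in> Hom C A B" "g \<in> Hom C A B" "h \<in> Hom C A B" "g \<boxplus> f = h \<boxplus> f"
  shows "g = h"
  using sum_cancel[OF assms(1,2,3)] add_Hom(2)[OF assms(2,1)] add_Hom(2)[OF assms(3,1)] assms(4)
  by simp

lemma difference:
  assumes "f \<in> Hom C A B" "g \<in> Hom C A B"
  obtains n where "n \<in> Hom C A B" "f \<boxplus> n = g"
  using add_Hom(6)[OF assms] by blast

lemma distrib:
  assumes "f \<in> arr C" "g \<in> arr C" "h \<in> arr C" "src C f = src C g" "tgt C f = tgt C g"
  shows "src C h = tgt C f \<Longrightarrow> h \<cdot> (f \<boxplus> g) = (h \<cdot> f) \<boxplus> (h \<cdot> g)"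
    "tgt C h = src C f \<Longrightarrow> (f \<boxplus> g) \<cdot> h = (f \<cdot> h) \<boxplus> (g \<cdot> h)"
  using comp_add_right[of f _ _ g h] comp_add_left[of h _ _ f _ g] assms by (auto simp: Hom_iff)

lemma comp_zero [simp]:
  assumes "f \<in> arr C" "A \<in> obj C"
  shows "src C f = B \<Longrightarrow> f \<cdot> zero_arr C A B = zero_arr C A (tgt C f)"
    "tgt C f = B \<Longrightarrow> zero_arr C B A \<cdot> f = zero_arr C (src C f) A"
proof -
  have o: "src C f \<in> obj C" "tgt C f \<in> obj C" using assms src_obj tgt_obj by auto
  show "f \<cdot> zero_arr C A B = zero_arr C A (tgt C f)" if "src C f = B"
  proof -
    let ?z = "zero_arr C A B"
    have z: "f \<cdot> ?z \<in> Hom C A (tgt C f)" using o that assms by (auto simp: Hom_iff)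
    have "f \<cdot> ?z \<boxplus> f \<cdot> ?z = f \<cdot> ?z"
      using o that assms by (simp flip: distrib(1))
    also have "\<dots> = f \<cdot> ?z \<boxplus> zero_arr C A (tgt C f)" using z by (simp add: Hom_iff)
    finally show ?thesis by (rule sum_cancel[OF z z zero_hom[OF assms(2) o(2)]])
  qed
  show "zero_arr C B A \<cdot> f = zero_arr C (src C f) A" if "tgt C f = B"
  proof -
    let ?z = "zero_arr C B A"
    have z: "?z \<cdot> f \<in> Hom C (src C f) A" using o that assms by (auto simp: Hom_iff)
    have "?z \<cdot> f \<boxplus> ?z \<cdot> f = ?z \<cdot> f"
      using o that assms by (simp flip: distrib(2))
    also have "\<dots> = ?z \<cdot> f \<boxplus> zero_arr C (src C f) A" using z by (simp add: Hom_iff)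
    finally show ?thesis by (rule sum_cancel[OF z z zero_hom[OF o(1) assms(2)]])
  qed
qed

lemmas calc = Hom_iff assoc distrib sum_assoc sum_comm sum_left_comm

text \<open>
Composites are normalised to nest to the right. A rewrite rule for \<open>g \<cdot> f\<close> then no longer
applies inside \<open>g \<cdot> (f \<cdot> u)\<close>; this is the version of the rule that does. Sources and targets are
rewritten to named objects, so that the simplifier can discharge the typing conditions.
\<close>

lemma reduce:
  assumes "g \<cdot> f = h"
  shows "\<lbrakk>u \<in> arr C; f \<in> arr C; g \<in> arr C; tgt C u = src C f; tgt C f = src C g\<rbrakk>
    \<Longrightarrow> g \<cdot> (f \<cdot> u) = h \<cdot> u"
  using assoc[of u f g] assms by simp

end

section \<open>Split short exact sequences\<close>

text \<open>
A split short exact sequence \<open>i\<close>, \<open>p\<close> is the same thing as a biproduct diagram: its splittings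
are a retraction \<open>\<rho>\<close> of \<open>i\<close> and a section \<open>s\<close> of \<open>p\<close>. Carrying all four arrows turns the later
diagram chases into equations between composites, and makes the notion self-dual.
\<close>

definition biproduct_data where
  "biproduct_data C A S B i p \<rho> s \<longleftrightarrow> A \<in> obj C \<and> B \<in> obj C \<and> S \<in> obj C \<and>
     i \<in> Hom C A S \<and> p \<in> Hom C S B \<and> \<rho> \<in> Hom C S A \<and> s \<in> Hom C B S \<and>
     \<rho> \<cdot>\<^bsub>C\<^esub> i = ident C A \<and> p \<cdot>\<^bsub>C\<^esub> s = ident C B \<and>
     p \<cdot>\<^bsub>C\<^esub> i = zero_arr C A B \<and> \<rho> \<cdot>\<^bsub>C\<^esub> s = zero_arr C B A \<and>
     add_arr C (i \<cdot>\<^bsub>C\<^esub> \<rho>) (s \<cdot>\<^bsub>C\<^esub> p) = ident C S"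

lemma is_biproduct_iff_data:
  "is_biproduct C A B S \<longleftrightarrow> (\<exists>i p \<rho> s. biproduct_data C A S B i p \<rho> s)"
  unfolding is_biproduct_def biproduct_data_def by blast

context additive_category
begin

lemma biproduct_data_swap:
  "biproduct_data C A S B i p \<rho> s \<Longrightarrow> biproduct_data C B S A s \<rho> p i"
  unfolding biproduct_data_def by (simp add: calc)

lemma biproduct_dataD:
  assumes "biproduct_data C A S B i p \<rho> s"
  shows "A \<in> obj C" "B \<in> obj C" "S \<in> obj C"
    "i \<in> arr C" "src C i = A" "tgt C i = S" "p \<in> arr C" "src C p = S" "tgt C p = B"
    "\<rho> \<in> arr C" "src C \<rho> = S" "tgt C \<rho> = A" "s \<in> arr C" "src C s = B" "tgt C s = S"
    "\<rho> \<cdot> i = ident C A" "p \<cdot> s = ident C B" "p \<cdot> i = zero_arr C A B" "\<rho> \<cdot> s = zero_arr C B A"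
    "i \<cdot> \<rho> \<boxplus> s \<cdot> p = ident C S"
  using assms unfolding biproduct_data_def Hom_iff by auto

lemmas biproduct_calc = biproduct_dataD biproduct_dataD(16-19)[THEN reduce]

lemma biproduct_decomp:
  assumes "biproduct_data C A S B i p \<rho> s"
  shows "\<lbrakk>t \<in> arr C; tgt C t = S\<rbrakk> \<Longrightarrow> t = i \<cdot> (\<rho> \<cdot> t) \<boxplus> s \<cdot> (p \<cdot> t)"
    "\<lbrakk>t \<in> arr C; src C t = S\<rbrakk> \<Longrightarrow> t = (t \<cdot> i) \<cdot> \<rho> \<boxplus> (t \<cdot> s) \<cdot> p"
proof -
  note b = biproduct_calc[OF assms]
  show "t = i \<cdot> (\<rho> \<cdot> t) \<boxplus> s \<cdot> (p \<cdot> t)" if "t \<in> arr C" "tgt C t = S"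
  proof -
    have "t = (i \<cdot> \<rho> \<boxplus> s \<cdot> p) \<cdot> t" using b that by simp
    also have "\<dots> = i \<cdot> (\<rho> \<cdot> t) \<boxplus> s \<cdot> (p \<cdot> t)" using b(1-15) that by (simp add: assoc distrib)
    finally show ?thesis .
  qed
  show "t = (t \<cdot> i) \<cdot> \<rho> \<boxplus> (t \<cdot> s) \<cdot> p" if "t \<in> arr C" "src C t = S"
  proof -
    have "t = t \<cdot> (i \<cdot> \<rho> \<boxplus> s \<cdot> p)" using b that by simp
    also have "\<dots> = (t \<cdot> i) \<cdot> \<rho> \<boxplus> (t \<cdot> s) \<cdot> p" using b(1-15) that by (simp add: assoc distrib)
    finally show ?thesis .
  qed
qed

lemma biproduct_ext:
  assumes "biproduct_data C A S B i p \<rho> s"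
  shows "\<lbrakk>t \<in> Hom C S T; t' \<in> Hom C S T; t \<cdot> i = t' \<cdot> i; t \<cdot> s = t' \<cdot> s\<rbrakk> \<Longrightarrow> t = t'"
    "\<lbrakk>u \<in> Hom C T S; u' \<in> Hom C T S; \<rho> \<cdot> u = \<rho> \<cdot> u'; p \<cdot> u = p \<cdot> u'\<rbrakk> \<Longrightarrow> u = u'"
  using biproduct_decomp(2)[OF assms, of t] biproduct_decomp(2)[OF assms, of t']
    biproduct_decomp(1)[OF assms, of u] biproduct_decomp(1)[OF assms, of u']
  by (auto simp: Hom_iff)

text \<open>
If \<open>p \<cdot> t = 0\<close>, then \<open>t = (i \<cdot> \<rho> + s \<cdot> p) \<cdot> t = i \<cdot> (\<rho> \<cdot> t)\<close>. The next lemma is dual.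
\<close>

lemma biproduct_data_kernel:
  assumes "biproduct_data C A S B i p \<rho> s"
  shows "is_kernel C i p"
  unfolding is_kernel_def
proof (intro conjI ballI impI)
  note b = biproduct_calc[OF assms]
  show "i \<in> arr C" "p \<in> arr C" "tgt C i = src C p" "p \<cdot> i = zero_arr C (src C i) (tgt C p)"
    using b by auto
  fix t assume t: "t \<in> arr C" "tgt C t = src C p \<and> p \<cdot> t = zero_arr C (src C t) (tgt C p)"
  show "\<exists>!u. u \<in> Hom C (src C t) (src C i) \<and> i \<cdot> u = t"
  proof (rule ex1I)
    show "\<rho> \<cdot> t \<in> Hom C (src C t) (src C i) \<and> i \<cdot> (\<rho> \<cdot> t) = t"
      using biproduct_decomp(1)[OF assms t(1)] t b src_obj[OF t(1)] by (simp add: Hom_iff)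
    fix u assume "u \<in> Hom C (src C t) (src C i) \<and> i \<cdot> u = t"
    thus "u = \<rho> \<cdot> t" using b by (auto simp: Hom_iff)
  qed
qed

lemma biproduct_data_cokernel:
  assumes "biproduct_data C A S B i p \<rho> s"
  shows "is_cokernel C i p"
  unfolding is_cokernel_def
proof (intro conjI ballI impI)
  note b = biproduct_calc[OF assms]
  show "i \<in> arr C" "p \<in> arr C" "tgt C i = src C p" "p \<cdot> i = zero_arr C (src C i) (tgt C p)"
    using b by auto
  fix t assume t: "t \<in> arr C" "src C t = tgt C i \<and> t \<cdot> i = zero_arr C (src C i) (tgt C t)"
  show "\<exists>!u. u \<in> Hom C (tgt C p) (tgt C t) \<and> u \<cdot> p = t"
  proof (rule ex1I)
    show "t \<cdot> s \<in> Hom C (tgt C p) (tgt C t) \<and> (t \<cdot> s) \<cdot> p = t"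
      using biproduct_decomp(2)[OF assms t(1)] t b tgt_obj[OF t(1)] by (simp add: Hom_iff)
    fix u assume "u \<in> Hom C (tgt C p) (tgt C t) \<and> u \<cdot> p = t"
    thus "u = t \<cdot> s" using b by (auto simp: Hom_iff assoc)
  qed
qed

lemma cokernel_epi:
  assumes "is_cokernel C i p" "u \<in> Hom C (tgt C p) T" "v \<in> Hom C (tgt C p) T" "u \<cdot> p = v \<cdot> p"
  shows "u = v"
proof -
  have p: "p \<in> arr C" "i \<in> arr C" "src C p = tgt C i" "p \<cdot> i = zero_arr C (src C i) (tgt C p)"
    using assms(1) by (auto simp: is_cokernel_def)
  have "T \<in> obj C" using Hom_obj assms(2) by auto
  hence "u \<cdot> p \<in> arr C \<and> src C (u \<cdot> p) = tgt C i \<and> (u \<cdot> p) \<cdot> i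
    = zero_arr C (src C i) (tgt C (u \<cdot> p))"
    using p assms(2) src_obj[of i] by (simp add: Hom_iff assoc)
  hence "\<exists>!w. w \<in> Hom C (tgt C p) (tgt C (u \<cdot> p)) \<and> w \<cdot> p = u \<cdot> p"
    using assms(1) unfolding is_cokernel_def by blast
  moreover have "tgt C (u \<cdot> p) = T" using p assms(2) by (simp add: Hom_iff)
  ultimately show ?thesis using assms(2-4) by metis
qed

lemma kernel_mono:
  assumes "is_kernel C i p" "u \<in> Hom C T (src C i)" "v \<in> Hom C T (src C i)" "i \<cdot> u = i \<cdot> v"
  shows "u = v"
proof -
  have p: "p \<in> arr C" "i \<in> arr C" "src C p = tgt C i" "p \<cdot> i = zero_arr C (src C i) (tgt C p)"
    using assms(1) by (auto simp: is_kernel_def)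
  have "T \<in> obj C" using Hom_obj assms(2) by auto
  hence "i \<cdot> u \<in> arr C \<and> tgt C (i \<cdot> u) = src C p \<and> p \<cdot> (i \<cdot> u)
    = zero_arr C (src C (i \<cdot> u)) (tgt C p)"
    using p assms(2) tgt_obj[of p] reduce[OF p(4), of u] by (simp add: Hom_iff)
  hence "\<exists>!w. w \<in> Hom C (src C (i \<cdot> u)) (src C i) \<and> i \<cdot> w = i \<cdot> u"
    using assms(1) unfolding is_kernel_def by blast
  moreover have "src C (i \<cdot> u) = T" using p assms(2) by (simp add: Hom_iff)
  ultimately show ?thesis using assms(2-4) by metis
qed

text \<open>
A section \<open>s\<close> of \<open>p\<close> makes \<open>p\<close> annihilate the difference of the identity and \<open>s \<cdot> p\<close>; hence this
difference factors through the kernel \<open>i\<close>, which yields the retraction.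
\<close>

lemma split_short_exactE:
  assumes "split_short_exact C i p"
  obtains \<rho> s where "biproduct_data C (src C i) (src C p) (tgt C p) i p \<rho> s"
proof -
  have k: "is_kernel C i p"
    using assms by (auto simp: split_short_exact_def short_exact_def)
  obtain s where s: "s \<in> Hom C (tgt C p) (src C p)" "p \<cdot> s = ident C (tgt C p)"
    using assms by (auto simp: split_short_exact_def)
  have p: "p \<in> arr C" "i \<in> arr C" "tgt C i = src C p" "p \<cdot> i = zero_arr C (src C i) (tgt C p)"
    using k by (auto simp: is_kernel_def)
  note o = src_obj[OF p(1)] tgt_obj[OF p(1)] src_obj[OF p(2)]
  have sp: "s \<cdot> p \<in> Hom C (src C p) (src C p)" using s p by (simp add: Hom_iff)
  obtain n where n: "n \<in> Hom C (src C p) (src C p)" "s \<cdot> p \<boxplus> n = ident C (src C p)"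
    using difference[OF sp ident_hom[OF o(1)]] .
  have "p \<boxplus> p \<cdot> n = p \<cdot> (s \<cdot> p \<boxplus> n)"
    using s p n(1) o by (simp add: distrib Hom_iff reduce[OF s(2)])
  also have "\<dots> = p \<boxplus> zero_arr C (src C p) (tgt C p)" using n(2) p o by simp
  finally have "p \<cdot> n = zero_arr C (src C p) (tgt C p)"
    by (rule sum_cancel[rotated 3]) (use p n o in \<open>auto simp: Hom_iff\<close>)
  then obtain \<rho> where \<rho>: "\<rho> \<in> Hom C (src C p) (src C i)" "i \<cdot> \<rho> = n"
    using k n(1) unfolding is_kernel_def Hom_iff by metis
  have sum: "i \<cdot> \<rho> \<boxplus> s \<cdot> p = ident C (src C p)"
    using n \<rho> sum_comm[of n "s \<cdot> p"] sp by (simp add: Hom_iff)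
  have "i \<cdot> (\<rho> \<cdot> i) = (i \<cdot> \<rho> \<boxplus> s \<cdot> p) \<cdot> i"
    using \<rho>(1) p s o by (simp add: distrib assoc Hom_iff)
  also have "\<dots> = i \<cdot> ident C (src C i)" using sum p o by simp
  finally have \<rho>i: "\<rho> \<cdot> i = ident C (src C i)"
    by (rule kernel_mono[OF k, rotated 2]) (use \<rho>(1) p o in \<open>auto simp: Hom_iff\<close>)
  have "i \<cdot> (\<rho> \<cdot> s) \<boxplus> s = (i \<cdot> \<rho> \<boxplus> s \<cdot> p) \<cdot> s"
    using \<rho>(1) p s o by (simp add: distrib assoc Hom_iff)
  also have "\<dots> = i \<cdot> zero_arr C (tgt C p) (src C i) \<boxplus> s" using sum p o s by (simp add: Hom_iff)
  finally have "i \<cdot> (\<rho> \<cdot> s) = i \<cdot> zero_arr C (tgt C p) (src C i)"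
    by (rule sum_cancel_right[rotated 3]) (use \<rho>(1) p s o in \<open>auto simp: Hom_iff\<close>)
  hence \<rho>s: "\<rho> \<cdot> s = zero_arr C (tgt C p) (src C i)"
    by (rule kernel_mono[OF k, rotated 2]) (use \<rho>(1) p s o in \<open>auto simp: Hom_iff\<close>)
  show thesis
    using that[of \<rho> s] \<rho>(1) \<rho>i \<rho>s s p o sum by (simp add: biproduct_data_def Hom_iff)
qed

lemma biproduct_data_split:
  assumes "biproduct_data C A S B i p \<rho> s"
  shows "split_short_exact C i p"
  using assms biproduct_data_kernel[OF assms] biproduct_data_cokernel[OF assms]
  unfolding split_short_exact_def short_exact_def biproduct_data_def
  by (auto intro!: bexI[of _ s] simp: Hom_iff)

text \<open>
The dual construction: given a retraction of \<open>i\<close>, the section of \<open>p\<close> comes from the difference of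
the identity and \<open>i \<cdot> \<rho>\<close>, which factors through the cokernel.
\<close>

lemma split_monic_cokernel:
  assumes c: "is_cokernel C i p" and r: "\<rho> \<in> Hom C (tgt C i) (src C i)" "\<rho> \<cdot> i = ident C (src C i)"
  shows "split_short_exact C i p"
proof -
  have p: "p \<in> arr C" "i \<in> arr C" "src C p = tgt C i" "p \<cdot> i = zero_arr C (src C i) (tgt C p)"
    using c by (auto simp: is_cokernel_def)
  note o = tgt_obj[OF p(1)] tgt_obj[OF p(2)] src_obj[OF p(2)]
  have ir: "i \<cdot> \<rho> \<in> Hom C (tgt C i) (tgt C i)" using r p by (simp add: Hom_iff)
  obtain n where n: "n \<in> Hom C (tgt C i) (tgt C i)" "i \<cdot> \<rho> \<boxplus> n = ident C (tgt C i)"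
    using difference[OF ir ident_hom[OF o(2)]] .
  have "i \<boxplus> n \<cdot> i = (i \<cdot> \<rho> \<boxplus> n) \<cdot> i"
    using r p n(1) o by (simp add: distrib Hom_iff assoc)
  also have "\<dots> = i \<boxplus> zero_arr C (src C i) (tgt C i)" using n(2) p o by simp
  finally have "n \<cdot> i = zero_arr C (src C i) (tgt C i)"
    by (rule sum_cancel[rotated 3]) (use p n o in \<open>auto simp: Hom_iff\<close>)
  then obtain s where s: "s \<in> Hom C (tgt C p) (tgt C i)" "s \<cdot> p = n"
    using c n(1) unfolding is_cokernel_def Hom_iff by metis
  have sum: "i \<cdot> \<rho> \<boxplus> s \<cdot> p = ident C (tgt C i)" using n s by simp
  have "(p \<cdot> s) \<cdot> p = p \<cdot> (i \<cdot> \<rho> \<boxplus> s \<cdot> p)"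
    using r(1) s(1) p o by (simp add: distrib assoc Hom_iff reduce[OF p(4)])
  also have "\<dots> = ident C (tgt C p) \<cdot> p" using sum p o by simp
  finally have ps: "p \<cdot> s = ident C (tgt C p)"
    by (rule cokernel_epi[OF c, rotated 2]) (use s(1) p o in \<open>auto simp: Hom_iff\<close>)
  have "(\<rho> \<cdot> s) \<cdot> p \<boxplus> \<rho> = \<rho> \<cdot> (i \<cdot> \<rho> \<boxplus> s \<cdot> p)"
    using r s(1) p o by (simp add: distrib assoc Hom_iff reduce[OF r(2)] sum_comm)
  also have "\<dots> = zero_arr C (tgt C p) (src C i) \<cdot> p \<boxplus> \<rho>" using sum p o r by (simp add: Hom_iff)
  finally have "(\<rho> \<cdot> s) \<cdot> p = zero_arr C (tgt C p) (src C i) \<cdot> p"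
    by (rule sum_cancel_right[rotated 3]) (use r(1) p s o in \<open>auto simp: Hom_iff\<close>)
  hence "\<rho> \<cdot> s = zero_arr C (tgt C p) (src C i)"
    by (rule cokernel_epi[OF c, rotated 2]) (use s(1) r p o in \<open>auto simp: Hom_iff\<close>)
  hence "biproduct_data C (src C i) (tgt C i) (tgt C p) i p \<rho> s"
    using r s p o ps sum by (simp add: biproduct_data_def Hom_iff)
  thus ?thesis by (rule biproduct_data_split)
qed


text \<open>
With \<open>S = A \<oplus> B\<close> and \<open>S' = A' \<oplus> B\<close>, the arrow opposite to \<open>f\<close> is \<open>f \<oplus> 1\<close>, written through
the structure maps. In the dual lemma below it is \<open>1 \<oplus> f\<close>.
\<close>

lemma biproduct_pushout:
  assumes "biproduct_data C A S B i p \<rho> s" "biproduct_data C A' S' B i' p' \<rho>' s'" "f \<in> Hom C A A'"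
  shows "is_pushout C i f i' (i' \<cdot> (f \<cdot> \<rho>) \<boxplus> s' \<cdot> p)"
proof -
  note b = biproduct_calc[OF assms(1)] biproduct_calc[OF assms(2)]
  note d = biproduct_dataD(1-15)[OF assms(1)] biproduct_dataD(1-15)[OF assms(2)]
  define f' where "f' = i' \<cdot> (f \<cdot> \<rho>) \<boxplus> s' \<cdot> p"
  have f: "f \<in> arr C" "src C f = A" "tgt C f = A'" using assms(3) by (auto simp: Hom_iff)
  have f': "f' \<in> arr C" "src C f' = S" "tgt C f' = S'" "f' \<cdot> i = i' \<cdot> f" "f' \<cdot> s = s'"
    unfolding f'_def using b f by (auto simp: distrib assoc)
  show ?thesis
    unfolding f'_def[symmetric] is_pushout_def
  proof (intro conjI ballI impI)
  show "i \<in> arr C" "f \<in> arr C" "i' \<in> arr C" "src C i = src C f" "src C i' = tgt C f"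
    using b f by auto
  show "f' \<in> arr C" "src C f' = tgt C i" "tgt C f' = tgt C i'" "f' \<cdot> i = i' \<cdot> f" using b f f'
    by auto
  fix v w assume "v \<in> arr C" "w \<in> arr C"
    "src C v = tgt C i \<and> src C w = tgt C f \<and> tgt C v = tgt C w \<and> v \<cdot> i = w \<cdot> f"
  hence v: "v \<in> arr C" "src C v = S" "w \<in> arr C" "src C w = A'" "tgt C w = tgt C v"
    "v \<cdot> i = w \<cdot> f" "tgt C v \<in> obj C"
    using b f tgt_obj by auto
  define u where "u = w \<cdot> \<rho>' \<boxplus> v \<cdot> (s \<cdot> p')"
  have u: "u \<in> arr C" "src C u = S'" "tgt C u = tgt C v" "u \<cdot> i' = w" "u \<cdot> s' = v \<cdot> s"
    unfolding u_def using v f b by (auto simp: distrib assoc)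
  have uf: "u \<cdot> f' = v"
    by (rule biproduct_ext(1)[OF assms(1), where T = "tgt C v"])
      (use u v f f' d in \<open>simp_all add: Hom_iff assoc reduce[OF u(4)]\<close>)
  show "\<exists>!u. u \<in> Hom C (tgt C f') (tgt C v) \<and> u \<cdot> f' = v \<and> u \<cdot> i' = w"
  proof (rule ex1I)
    show "u \<in> Hom C (tgt C f') (tgt C v) \<and> u \<cdot> f' = v \<and> u \<cdot> i' = w"
      using u uf f' by (simp add: Hom_iff)
    fix u' assume "u' \<in> Hom C (tgt C f') (tgt C v) \<and> u' \<cdot> f' = v \<and> u' \<cdot> i' = w"
    hence u': "u' \<in> arr C" "src C u' = S'" "tgt C u' = tgt C v" "u' \<cdot> f' = v" "u' \<cdot> i' = w"
      using f' by (auto simp: Hom_iff)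
    have us: "u' \<cdot> s' = (u' \<cdot> f') \<cdot> s" using u'(1-3) f' d by (simp add: assoc)
    show "u' = u"
      by (rule biproduct_ext(1)[OF assms(2), where T = "tgt C v"]) (use us u u' in \<open>simp_all add:
        Hom_iff\<close>)
  qed
  qed
qed

lemma biproduct_pullback:
  assumes "biproduct_data C A S B i p \<rho> s" "biproduct_data C A S' B' i' p' \<rho>' s'" "f \<in> Hom C B' B"
  shows "is_pullback C p f p' (i \<cdot> \<rho>' \<boxplus> s \<cdot> (f \<cdot> p'))"
proof -
  note b = biproduct_calc[OF assms(1)] biproduct_calc[OF assms(2)]
  note d = biproduct_dataD(1-15)[OF assms(1)] biproduct_dataD(1-15)[OF assms(2)]
  define f' where "f' = i \<cdot> \<rho>' \<boxplus> s \<cdot> (f \<cdot> p')"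
  have f: "f \<in> arr C" "src C f = B'" "tgt C f = B" using assms(3) by (auto simp: Hom_iff)
  have f': "f' \<in> arr C" "src C f' = S'" "tgt C f' = S" "p \<cdot> f' = f \<cdot> p'" "\<rho> \<cdot> f' = \<rho>'"
    unfolding f'_def using b f by (auto simp: distrib assoc)
  note r = f'(4,5)[THEN reduce]
  show ?thesis
    unfolding f'_def[symmetric] is_pullback_def
  proof (intro conjI ballI impI)
  show "p \<in> arr C" "f \<in> arr C" "p' \<in> arr C" "tgt C p = tgt C f" "tgt C p' = src C f"
    using b f by auto
  show "f' \<in> arr C" "tgt C f' = src C p" "src C f' = src C p'" "p \<cdot> f' = f \<cdot> p'" using b f f'
    by auto
  fix v w assume "v \<in> arr C" "w \<in> arr C"
    "tgt C v = src C p \<and> tgt C w = src C f \<and> src C v = src C w \<and> p \<cdot> v = f \<cdot> w"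
  hence v: "v \<in> arr C" "tgt C v = S" "w \<in> arr C" "tgt C w = B'" "src C w = src C v"
    "p \<cdot> v = f \<cdot> w" "src C v \<in> obj C"
    using b f src_obj by auto
  define u where "u = s' \<cdot> w \<boxplus> i' \<cdot> (\<rho> \<cdot> v)"
  have u: "u \<in> arr C" "tgt C u = S'" "src C u = src C v" "p' \<cdot> u = w" "\<rho>' \<cdot> u = \<rho> \<cdot> v"
    unfolding u_def using v f b by (auto simp: distrib)
  have uf: "f' \<cdot> u = v"
    by (rule biproduct_ext(2)[OF assms(1), where T = "src C v"])
      (use u v f f' d r in \<open>simp_all add: Hom_iff assoc\<close>)
  show "\<exists>!u. u \<in> Hom C (src C v) (src C f') \<and> f' \<cdot> u = v \<and> p' \<cdot> u = w"
  proof (rule ex1I)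
    show "u \<in> Hom C (src C v) (src C f') \<and> f' \<cdot> u = v \<and> p' \<cdot> u = w"
      using u uf f' by (simp add: Hom_iff)
    fix u' assume "u' \<in> Hom C (src C v) (src C f') \<and> f' \<cdot> u' = v \<and> p' \<cdot> u' = w"
    hence u': "u' \<in> arr C" "tgt C u' = S'" "src C u' = src C v" "f' \<cdot> u' = v" "p' \<cdot> u' = w"
      using f' by (auto simp: Hom_iff)
    have us: "\<rho>' \<cdot> u' = \<rho> \<cdot> (f' \<cdot> u')" using u'(1-3) f'(1-3) r(2) d by simp
    show "u' = u"
      by (rule biproduct_ext(2)[OF assms(2), where T = "src C v"]) (use us u u' in \<open>simp_all add:
        Hom_iff\<close>)
  qed
  qed
qed

end

section \<open>Morphism categories\<close>

lemma morphism_category_sel [simp]: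
  "obj (morphism_category C) = arr C"
  "src (morphism_category C) = sq_src"
  "tgt (morphism_category C) = sq_tgt"
  "ident (morphism_category C) f = Square f (ident C (src C f)) (ident C (tgt C f)) f"
  "\<psi> \<cdot>\<^bsub>morphism_category C\<^esub> \<phi> =
    Square (sq_src \<phi>) (sq_fst \<psi> \<cdot>\<^bsub>C\<^esub> sq_fst \<phi>) (sq_snd \<psi> \<cdot>\<^bsub>C\<^esub> sq_snd \<phi>) (sq_tgt \<psi>)"
  "zero_arr (morphism_category C) f g =
    Square f (zero_arr C (src C f) (src C g)) (zero_arr C (tgt C f) (tgt C g)) g"
  "add_arr (morphism_category C) \<phi> \<psi> = Square (sq_src \<phi>) (add_arr C (sq_fst \<phi>) (sq_fst \<psi>))
    (add_arr C (sq_snd \<phi>) (sq_snd \<psi>)) (sq_tgt \<phi>)"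
  by (simp_all add: morphism_category_def)

lemma Square_arr [simp]:
  "Square f a b g \<in> arr (morphism_category C) \<longleftrightarrow> f \<in> arr C \<and> g \<in> arr C \<and>
     a \<in> Hom C (src C f) (src C g) \<and> b \<in> Hom C (tgt C f) (tgt C g) \<and> g \<cdot>\<^bsub>C\<^esub> a = b \<cdot>\<^bsub>C\<^esub> f"
  by (simp add: morphism_category_def)

lemma morphism_Hom_iff:
  "\<phi> \<in> Hom (morphism_category C) f g \<longleftrightarrow> (\<exists>a b. \<phi> = Square f a b g \<and> f \<in> arr C \<and> g \<in> arr C \<and>
     a \<in> Hom C (src C f) (src C g) \<and> b \<in> Hom C (tgt C f) (tgt C g) \<and> g \<cdot>\<^bsub>C\<^esub> a = b \<cdot>\<^bsub>C\<^esub> f)"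
  by (cases \<phi>) (auto simp: Hom_iff)

lemma kernel_lift:
  assumes "is_kernel C i p" "t \<in> arr C" "tgt C t = src C p"
    "p \<cdot>\<^bsub>C\<^esub> t = zero_arr C (src C t) (tgt C p)"
  obtains u where "u \<in> Hom C (src C t) (src C i)" "i \<cdot>\<^bsub>C\<^esub> u = t"
  using assms unfolding is_kernel_def by blast

lemma cokernel_lift:
  assumes "is_cokernel C i p" "t \<in> arr C" "src C t = tgt C i"
    "t \<cdot>\<^bsub>C\<^esub> i = zero_arr C (src C i) (tgt C t)"
  obtains u where "u \<in> Hom C (tgt C p) (tgt C t)" "u \<cdot>\<^bsub>C\<^esub> p = t"
  using assms unfolding is_cokernel_def by blast

text \<open>
Morphism categories are defined for category records without extension fields, which is what this
locale fixes.
\<close>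

locale additive_base = additive_category C for C :: "('o, 'a) cat" (structure)
begin

lemmas Hom_C = Hom_iff[of _ C]

abbreviation H :: "('a, 'a square) cat" where "H \<equiv> morphism_category C"

lemma paste_squares:
  assumes "f \<in> arr C" "g \<in> arr C" "h \<in> arr C"
    and a: "a \<in> Hom C (src C f) (src C g)" "b \<in> Hom C (tgt C f) (tgt C g)" "g \<cdot> a = b \<cdot> f"
    and a': "a' \<in> Hom C (src C g) (src C h)" "b' \<in> Hom C (tgt C g) (tgt C h)" "h \<cdot> a' = b' \<cdot> g"
  shows "h \<cdot> (a' \<cdot> a) = (b' \<cdot> b) \<cdot> f"
proof -
  have "h \<cdot> (a' \<cdot> a) = b' \<cdot> (g \<cdot> a)"
    using reduce[OF a'(3), of a] assms(1-3) a(1) a'(1,2) by (simp add: Hom_C assoc)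
  thus ?thesis using a assms(1-3) a'(1,2) by (simp add: Hom_C assoc)
qed

text \<open>
All axioms hold componentwise, except that the componentwise inverse has to be a commutative
square again; this follows by cancelling in \<open>g \<cdot> a + g \<cdot> a' = 0 = b \<cdot> f + b' \<cdot> f\<close>.
\<close>

lemma morphism_hom_group:
  assumes f: "f \<in> arr C" and g: "g \<in> arr C"
  shows "comm_group \<lparr>carrier = Hom H f g, monoid.mult = add_arr H, one = zero_arr H f g\<rparr>"
proof (rule comm_groupI, goal_cases)
  note o = f g src_obj[OF f] tgt_obj[OF f] src_obj[OF g] tgt_obj[OF g]
  {
    case (1 \<phi> \<psi>)
    thus ?case using o by (auto simp: morphism_Hom_iff Hom_C distrib)
  next
    case 2
    show ?case using o by (auto simp: morphism_Hom_iff Hom_C)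
  next
    case (3 \<phi> \<psi> \<chi>)
    thus ?case using o by (auto simp: morphism_Hom_iff Hom_C sum_assoc)
  next
    case (4 \<phi> \<psi>)
    thus ?case using o by (auto simp: morphism_Hom_iff Hom_C sum_comm)
  next
    case (5 \<phi>)
    thus ?case using o by (auto simp: morphism_Hom_iff Hom_C)
  next
    case (6 \<phi>)
    then obtain a b where \<phi>: "\<phi> = Square f a b g"
      and ab: "a \<in> Hom C (src C f) (src C g)" "b \<in> Hom C (tgt C f) (tgt C g)" "g \<cdot> a = b \<cdot> f"
      by (auto simp: morphism_Hom_iff)
    obtain a' where a': "a' \<in> Hom C (src C f) (src C g)" "a \<boxplus> a' = zero_arr C (src C f) (src C g)"
      using difference[OF ab(1) zero_hom] o by metis
    obtain b' where b': "b' \<in> Hom C (tgt C f) (tgt C g)" "b \<boxplus> b' = zero_arr C (tgt C f) (tgt C g)"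
      using difference[OF ab(2) zero_hom] o by metis
    have "g \<cdot> a \<boxplus> g \<cdot> a' = g \<cdot> (a \<boxplus> a')" using ab(1) a'(1) o by (simp add: distrib Hom_C)
    also have "\<dots> = (b \<boxplus> b') \<cdot> f" using a'(2) b'(2) o by simp
    also have "\<dots> = g \<cdot> a \<boxplus> b' \<cdot> f" using ab b'(1) o by (simp add: distrib Hom_C)
    finally have "g \<cdot> a' = b' \<cdot> f"
      by (rule sum_cancel[rotated 3]) (use ab(1) a'(1) b'(1) o in \<open>auto simp: Hom_C\<close>)
    hence "Square f a' b' g \<in> Hom H f g" using a' b' o by (auto simp: morphism_Hom_iff)
    moreover have "a' \<boxplus> a = zero_arr C (src C f) (src C g)" "b' \<boxplus> b
      = zero_arr C (tgt C f) (tgt C g)"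
      using add_Hom(2)[OF a'(1) ab(1)] add_Hom(2)[OF b'(1) ab(2)] a' b' by auto
    ultimately show ?case using \<phi> by (auto intro!: bexI[of _ "Square f a' b' g"])
  }
qed

lemma morphism_zero_object:
  assumes "is_zero_object C Z"
  shows "is_zero_object H (ident C Z)"
proof -
  have Z: "Z \<in> obj C" using assms by (simp add: is_zero_object_def)
  have u: "\<lbrakk>f \<in> Hom C A Z; g \<in> Hom C A Z\<rbrakk> \<Longrightarrow> f = g" "\<lbrakk>f \<in> Hom C Z A; g \<in> Hom C Z A\<rbrakk> \<Longrightarrow> f = g"
    for A f g
    using assms Hom_obj[of f A Z] Hom_obj[of f Z A] unfolding is_zero_object_def by blast+
  show ?thesis
    unfolding is_zero_object_def
  proof (intro conjI ballI)
    show "ident C Z \<in> obj H" using Z by simp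
    fix f assume "f \<in> obj H"
    hence f: "f \<in> arr C" "src C f \<in> obj C" "tgt C f \<in> obj C" using src_obj tgt_obj by auto
    show "\<exists>!\<phi>. \<phi> \<in> Hom H f (ident C Z)"
    proof (rule ex1I)
      show "zero_arr H f (ident C Z) \<in> Hom H f (ident C Z)"
        using f Z by (simp add: morphism_Hom_iff Hom_C)
    qed (use Z f zero_hom u in \<open>auto simp: morphism_Hom_iff\<close>)
    show "\<exists>!\<phi>. \<phi> \<in> Hom H (ident C Z) f"
    proof (rule ex1I)
      show "zero_arr H (ident C Z) f \<in> Hom H (ident C Z) f"
        using f Z by (simp add: morphism_Hom_iff Hom_C)
    qed (use Z f zero_hom u in \<open>auto simp: morphism_Hom_iff\<close>)
  qed
qed

lemma biproduct_data_morphism: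
  assumes b1: "biproduct_data C (src C x) (src C z) (src C y) a1 b1 \<rho>1 s1"
    and b2: "biproduct_data C (tgt C x) (tgt C z) (tgt C y) a2 b2 \<rho>2 s2"
    and arr: "x \<in> arr C" "y \<in> arr C" "z \<in> arr C"
    and sq: "z \<cdot> a1 = a2 \<cdot> x" "y \<cdot> b1 = b2 \<cdot> z" "x \<cdot> \<rho>1 = \<rho>2 \<cdot> z" "z \<cdot> s1 = s2 \<cdot> y"
  shows "biproduct_data H x z y (Square x a1 a2 z) (Square z b1 b2 y) (Square z \<rho>1 \<rho>2 x)
    (Square y s1 s2 z)"
  using b1 b2 arr sq by (auto simp: biproduct_data_def morphism_Hom_iff)

lemma biproduct_data_morphismD:
  assumes "biproduct_data H x z y \<phi> \<psi> \<rho> s"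
  shows "biproduct_data C (src C x) (src C z) (src C y) (sq_fst \<phi>) (sq_fst \<psi>) (sq_fst \<rho>) (sq_fst s)"
    "biproduct_data C (tgt C x) (tgt C z) (tgt C y) (sq_snd \<phi>) (sq_snd \<psi>) (sq_snd \<rho>) (sq_snd s)"
  using assms src_obj tgt_obj by (auto simp: biproduct_data_def morphism_Hom_iff)

lemma direct_sum_of_arrows:
  assumes f: "f \<in> arr C" and g: "g \<in> arr C"
  shows "\<exists>h. is_biproduct H f g h"
proof -
  note o = src_obj[OF f] tgt_obj[OF f] src_obj[OF g] tgt_obj[OF g]
  obtain S i p \<rho> s where 1: "biproduct_data C (src C f) S (src C g) i p \<rho> s"
    using biproducts[OF o(1,3)] unfolding is_biproduct_iff_data by blast
  obtain T j q \<sigma> t where 2: "biproduct_data C (tgt C f) T (tgt C g) j q \<sigma> t"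
    using biproducts[OF o(2,4)] unfolding is_biproduct_iff_data by blast
  note b = biproduct_calc[OF 1] biproduct_calc[OF 2]
  let ?h = "j \<cdot> (f \<cdot> \<rho>) \<boxplus> t \<cdot> (g \<cdot> p)"
  have h: "?h \<in> arr C" "src C ?h = S" "tgt C ?h = T" using b f g by auto
  have "biproduct_data H f ?h g (Square f i j ?h) (Square ?h p q g) (Square ?h \<rho> \<sigma> f)
      (Square g s t ?h)"
  proof (rule biproduct_data_morphism)
    show "biproduct_data C (src C f) (src C ?h) (src C g) i p \<rho> s" using 1 h by simp
    show "biproduct_data C (tgt C f) (tgt C ?h) (tgt C g) j q \<sigma> t" using 2 h by simp
  qed (use h b f g in \<open>auto simp: distrib assoc\<close>)
  thus ?thesis unfolding is_biproduct_iff_data by blast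
qed

lemma morphism_category_additive: "additive_category H"
proof (rule additive_category.intro)
  fix f assume "f \<in> arr H"
  thus "src H f \<in> obj H" "tgt H f \<in> obj H" by (cases f; simp)+
next
  fix A assume "A \<in> obj H"
  thus "ident H A \<in> Hom H A A" using src_obj tgt_obj by (auto simp: morphism_Hom_iff Hom_C)
next
  fix f g A B D assume "f \<in> Hom H A B" "g \<in> Hom H B D"
  thus "g \<cdot>\<^bsub>H\<^esub> f \<in> Hom H A D"
    by (auto simp: morphism_Hom_iff Hom_C intro: paste_squares[simplified Hom_C])
next
  fix f g h A B D E assume "f \<in> Hom H A B" "g \<in> Hom H B D" "h \<in> Hom H D E"
  thus "h \<cdot>\<^bsub>H\<^esub> g \<cdot>\<^bsub>H\<^esub> f = h \<cdot>\<^bsub>H\<^esub> (g \<cdot>\<^bsub>H\<^esub> f)"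
    by (auto simp: morphism_Hom_iff Hom_C assoc)
next
  fix f A B assume "f \<in> Hom H A B"
  thus "f \<cdot>\<^bsub>H\<^esub> ident H A = f" "ident H B \<cdot>\<^bsub>H\<^esub> f = f"
    by (auto simp: morphism_Hom_iff Hom_C)
next
  fix f g h A B D assume "f \<in> Hom H A B" "g \<in> Hom H B D" "h \<in> Hom H B D"
  thus "add_arr H g h \<cdot>\<^bsub>H\<^esub> f = add_arr H (g \<cdot>\<^bsub>H\<^esub> f) (h \<cdot>\<^bsub>H\<^esub> f)"
    by (auto simp: morphism_Hom_iff Hom_C distrib)
next
  fix f g h A B D assume "f \<in> Hom H A B" "g \<in> Hom H A B" "h \<in> Hom H B D"
  thus "h \<cdot>\<^bsub>H\<^esub> add_arr H f g = add_arr H (h \<cdot>\<^bsub>H\<^esub> f) (h \<cdot>\<^bsub>H\<^esub> g)"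
    by (auto simp: morphism_Hom_iff Hom_C distrib)
next
  show "\<exists>Z. is_zero_object H Z" using zero_object morphism_zero_object by blast
next
  fix A B assume "A \<in> obj H" "B \<in> obj H"
  hence o: "A \<in> arr C" "B \<in> arr C" by simp_all
  show "comm_group \<lparr>carrier = Hom H A B, monoid.mult = add_arr H, one = zero_arr H A B\<rparr>"
    by (rule morphism_hom_group[OF o])
  show "\<exists>S. is_biproduct H A B S" by (rule direct_sum_of_arrows[OF o])
qed

text \<open>
Kernels in the morphism category are componentwise: the two induced arrows form a square because
they do so after composition with \<open>b\<close>, which can be cancelled. In the dual lemma the cokernel
\<open>a'\<close> is cancelled instead.
\<close>

lemma morphism_kernel:
  assumes k: "is_kernel C a a'" "is_kernel C b b'"
    and arr: "Square f a b g \<in> arr H" "Square g a' b' h \<in> arr H"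
  shows "is_kernel H (Square f a b g) (Square g a' b' h)"
  unfolding is_kernel_def
proof (intro conjI ballI impI)
  show "Square f a b g \<in> arr H" "Square g a' b' h \<in> arr H" by fact+
  show "tgt H (Square f a b g) = src H (Square g a' b' h)" by simp
  show "Square g a' b' h \<cdot>\<^bsub>H\<^esub> Square f a b g = zero_arr H (src H (Square f a b g)) (tgt H (Square
    g a' b' h))"
    using k arr by (auto simp: is_kernel_def Hom_C)
  fix t assume "t \<in> arr H"
    "tgt H t = src H (Square g a' b' h) \<and> Square g a' b' h \<cdot>\<^bsub>H\<^esub> t
      = zero_arr H (src H t) (tgt H (Square g a' b' h))"
  then obtain e t1 t2 where t: "t = Square e t1 t2 g" and e: "e \<in> arr C"
    and t1: "t1 \<in> Hom C (src C e) (src C g)" "a' \<cdot> t1 = zero_arr C (src C e) (src C h)"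
    and t2: "t2 \<in> Hom C (tgt C e) (tgt C g)" "b' \<cdot> t2 = zero_arr C (tgt C e) (tgt C h)"
    and sq: "g \<cdot> t1 = t2 \<cdot> e"
    by (cases t) (auto simp: Hom_C)
  have d: "a \<in> arr C" "a' \<in> arr C" "tgt C a = src C a'" "b \<in> arr C" "b' \<in> arr C" "tgt C b
    = src C b'"
    using k by (auto simp: is_kernel_def)
  obtain u1 where u1: "u1 \<in> Hom C (src C e) (src C f)" "a \<cdot> u1 = t1"
    by (rule kernel_lift[OF k(1), of t1]) (use t1 arr d in \<open>auto simp: Hom_C\<close>)
  obtain u2 where u2: "u2 \<in> Hom C (tgt C e) (tgt C f)" "b \<cdot> u2 = t2"
    by (rule kernel_lift[OF k(2), of t2]) (use t2 arr d in \<open>auto simp: Hom_C\<close>)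
  have ga: "g \<cdot> a = b \<cdot> f" using arr by simp
  have "b \<cdot> (f \<cdot> u1) = (g \<cdot> a) \<cdot> u1" using arr u1(1) unfolding ga by (simp add: Hom_C assoc)
  also have "\<dots> = t2 \<cdot> e" using d arr(1) u1(1) sq assoc[of u1 a g] by (simp add: Hom_C u1(2))
  also have "\<dots> = b \<cdot> (u2 \<cdot> e)" using arr u2(1) e by (simp add: Hom_C assoc flip: u2(2))
  finally have "f \<cdot> u1 = u2 \<cdot> e"
    by (rule kernel_mono[OF k(2), rotated 2]) (use arr e u1 u2 in \<open>auto simp: Hom_C\<close>)
  hence u: "Square e u1 u2 f \<in> Hom H e f" using u1 u2 e arr by (auto simp: morphism_Hom_iff)
  show "\<exists>!u. u \<in> Hom H (src H t) (src H (Square f a b g)) \<and> Square f a b g \<cdot>\<^bsub>H\<^esub> u = t"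
  proof (rule ex1I)
    show "Square e u1 u2 f \<in> Hom H (src H t) (src H (Square f a b g))
      \<and> Square f a b g \<cdot>\<^bsub>H\<^esub> Square e u1 u2 f = t"
      using u u1 u2 t by simp
    fix v assume "v \<in> Hom H (src H t) (src H (Square f a b g)) \<and> Square f a b g \<cdot>\<^bsub>H\<^esub> v = t"
    then obtain v1 v2 where v: "v = Square e v1 v2 f" "v1 \<in> Hom C (src C e) (src C f)" "a \<cdot> v1 = t1"
      "v2 \<in> Hom C (tgt C e) (tgt C f)" "b \<cdot> v2 = t2"
      using t by (cases v) (auto simp: morphism_Hom_iff)
    have "v1 = u1" by (rule kernel_mono[OF k(1)]) (use v u1 arr in \<open>auto simp: Hom_C\<close>)
    moreover have "v2 = u2" by (rule kernel_mono[OF k(2)]) (use v u2 arr in \<open>auto simp: Hom_C\<close>)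
    ultimately show "v = Square e u1 u2 f" using v by simp
  qed
qed

lemma morphism_cokernel:
  assumes k: "is_cokernel C a a'" "is_cokernel C b b'"
    and arr: "Square f a b g \<in> arr H" "Square g a' b' h \<in> arr H"
  shows "is_cokernel H (Square f a b g) (Square g a' b' h)"
  unfolding is_cokernel_def
proof (intro conjI ballI impI)
  show "Square f a b g \<in> arr H" "Square g a' b' h \<in> arr H" by fact+
  show "tgt H (Square f a b g) = src H (Square g a' b' h)" by simp
  show "Square g a' b' h \<cdot>\<^bsub>H\<^esub> Square f a b g = zero_arr H (src H (Square f a b g)) (tgt H (Square
    g a' b' h))"
    using k arr by (auto simp: is_cokernel_def Hom_C)
  fix t assume "t \<in> arr H"
    "src H t = tgt H (Square f a b g) \<and> t \<cdot>\<^bsub>H\<^esub> Square f a b g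
      = zero_arr H (src H (Square f a b g)) (tgt H t)"
  then obtain e t1 t2 where t: "t = Square g t1 t2 e" and e: "e \<in> arr C"
    and t1: "t1 \<in> Hom C (src C g) (src C e)" "t1 \<cdot> a = zero_arr C (src C f) (src C e)"
    and t2: "t2 \<in> Hom C (tgt C g) (tgt C e)" "t2 \<cdot> b = zero_arr C (tgt C f) (tgt C e)"
    and sq: "e \<cdot> t1 = t2 \<cdot> g"
    by (cases t) (auto simp: Hom_C)
  have d: "a \<in> arr C" "a' \<in> arr C" "tgt C a = src C a'" "b \<in> arr C" "b' \<in> arr C" "tgt C b
    = src C b'"
    using k by (auto simp: is_cokernel_def)
  obtain u1 where u1: "u1 \<in> Hom C (src C h) (src C e)" "u1 \<cdot> a' = t1"
    by (rule cokernel_lift[OF k(1), of t1]) (use t1 arr d in \<open>auto simp: Hom_C\<close>)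
  obtain u2 where u2: "u2 \<in> Hom C (tgt C h) (tgt C e)" "u2 \<cdot> b' = t2"
    by (rule cokernel_lift[OF k(2), of t2]) (use t2 arr d in \<open>auto simp: Hom_C\<close>)
  have ga: "h \<cdot> a' = b' \<cdot> g" using arr by simp
  have "(e \<cdot> u1) \<cdot> a' = t2 \<cdot> g" using arr u1 e sq by (simp add: Hom_C assoc)
  also have "\<dots> = u2 \<cdot> (b' \<cdot> g)" using arr u2(1) by (simp add: Hom_C assoc flip: u2(2))
  also have "\<dots> = (u2 \<cdot> h) \<cdot> a'" using arr u2(1) by (simp add: Hom_C assoc ga)
  finally have "e \<cdot> u1 = u2 \<cdot> h"
    by (rule cokernel_epi[OF k(1), rotated 2]) (use arr e u1 u2 in \<open>auto simp: Hom_C\<close>)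
  hence u: "Square h u1 u2 e \<in> Hom H h e" using u1 u2 e arr by (auto simp: morphism_Hom_iff)
  show "\<exists>!u. u \<in> Hom H (tgt H (Square g a' b' h)) (tgt H t) \<and> u \<cdot>\<^bsub>H\<^esub> Square g a' b' h = t"
  proof (rule ex1I)
    show "Square h u1 u2 e \<in> Hom H (tgt H (Square g a' b' h)) (tgt H t)
      \<and> Square h u1 u2 e \<cdot>\<^bsub>H\<^esub> Square g a' b' h = t"
      using u u1 u2 t by simp
    fix v assume "v \<in> Hom H (tgt H (Square g a' b' h)) (tgt H t) \<and> v \<cdot>\<^bsub>H\<^esub> Square g a' b' h = t"
    then obtain v1 v2 where v: "v = Square h v1 v2 e" "v1 \<in> Hom C (src C h) (src C e)" "v1 \<cdot> a'
      = t1"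
      "v2 \<in> Hom C (tgt C h) (tgt C e)" "v2 \<cdot> b' = t2"
      using t by (cases v) (auto simp: morphism_Hom_iff)
    have "v1 = u1" by (rule cokernel_epi[OF k(1)]) (use v u1 arr in \<open>auto simp: Hom_C\<close>)
    moreover have "v2 = u2" by (rule cokernel_epi[OF k(2)]) (use v u2 arr in \<open>auto simp: Hom_C\<close>)
    ultimately show "v = Square h u1 u2 e" using v by simp
  qed
qed


lemma pushout_ext:
  assumes po: "is_pushout C i f i' f'" and u: "u \<in> Hom C (tgt C f') T" "v \<in> Hom C (tgt C f') T"
    and eq: "u \<cdot> f' = v \<cdot> f'" "u \<cdot> i' = v \<cdot> i'"
  shows "u = v"
proof -
  have sq: "i \<in> arr C" "f \<in> arr C" "i' \<in> arr C" "f' \<in> arr C" "src C i = src C f" "src C f'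
    = tgt C i"
    "src C i' = tgt C f" "tgt C f' = tgt C i'" "f' \<cdot> i = i' \<cdot> f"
    using po by (auto simp: is_pushout_def)
  have "u \<cdot> f' \<in> arr C" "u \<cdot> i' \<in> arr C" "src C (u \<cdot> f') = tgt C i" "src C (u \<cdot> i') = tgt C f"
    "tgt C (u \<cdot> f') = T" "tgt C (u \<cdot> i') = T" "(u \<cdot> f') \<cdot> i = (u \<cdot> i') \<cdot> f"
    using sq u by (auto simp: Hom_C assoc)
  hence "\<exists>!w. w \<in> Hom C (tgt C f') T \<and> w \<cdot> f' = u \<cdot> f' \<and> w \<cdot> i' = u \<cdot> i'"
    using po unfolding is_pushout_def by metis
  thus ?thesis using u eq by metis
qed

lemma pullback_ext:
  assumes po: "is_pullback C p f p' f'" and u: "u \<in> Hom C T (src C f')" "v \<in> Hom C T (src C f')"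
    and eq: "f' \<cdot> u = f' \<cdot> v" "p' \<cdot> u = p' \<cdot> v"
  shows "u = v"
proof -
  have sq: "p \<in> arr C" "f \<in> arr C" "p' \<in> arr C" "f' \<in> arr C" "tgt C p = tgt C f" "tgt C f'
    = src C p"
    "tgt C p' = src C f" "src C f' = src C p'" "p \<cdot> f' = f \<cdot> p'"
    using po by (auto simp: is_pullback_def)
  have "f' \<cdot> u \<in> arr C" "p' \<cdot> u \<in> arr C" "tgt C (f' \<cdot> u) = src C p" "tgt C (p' \<cdot> u) = src C f"
    "src C (f' \<cdot> u) = T" "src C (p' \<cdot> u) = T" "p \<cdot> (f' \<cdot> u) = f \<cdot> (p' \<cdot> u)"
    using sq u reduce[OF sq(9), of u] by (auto simp: Hom_C assoc)
  hence "\<exists>!w. w \<in> Hom C T (src C f') \<and> f' \<cdot> w = f' \<cdot> u \<and> p' \<cdot> w = p' \<cdot> u"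
    using po unfolding is_pullback_def by metis
  thus ?thesis using u eq by metis
qed

text \<open>
Again componentwise; the two induced arrows form a square because both composites agree on the two
legs of the pushout of the sources.
\<close>

lemma morphism_pushout:
  assumes po: "is_pushout C i1 f1 i1' f1'" "is_pushout C i2 f2 i2' f2'"
    and arr: "Square x i1 i2 z \<in> arr H" "Square x f1 f2 x' \<in> arr H" "Square x' i1' i2' z' \<in> arr H"
      "Square z f1' f2' z' \<in> arr H"
  shows "is_pushout H (Square x i1 i2 z) (Square x f1 f2 x') (Square x' i1' i2' z') (Square z f1'
    f2' z')"
  unfolding is_pushout_def
proof (intro conjI ballI impI, goal_cases)
  note sq = arr[unfolded Square_arr Hom_C]
  case 9
  show ?case using po by (simp add: is_pushout_def)
next
  note sq = arr[unfolded Square_arr Hom_C]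
  case (10 s t)
  obtain e s1 s2 where s: "s = Square z s1 s2 e"
    using 10 by (cases s) auto
  obtain t1 t2 where t: "t = Square x' t1 t2 e"
    using 10 s by (cases t) auto
  have st: "e \<in> arr C" "s1 \<in> arr C" "src C s1 = src C z" "tgt C s1 = src C e"
    "s2 \<in> arr C" "src C s2 = tgt C z" "tgt C s2 = tgt C e" "e \<cdot> s1 = s2 \<cdot> z"
    "t1 \<in> arr C" "src C t1 = src C x'" "tgt C t1 = src C e"
    "t2 \<in> arr C" "src C t2 = tgt C x'" "tgt C t2 = tgt C e" "e \<cdot> t1 = t2 \<cdot> x'"
    "s1 \<cdot> i1 = t1 \<cdot> f1" "s2 \<cdot> i2 = t2 \<cdot> f2"
    using 10 s t by (auto simp: Hom_C)
  have "\<exists>!u. u \<in> Hom C (tgt C f1') (tgt C s1) \<and> u \<cdot> f1' = s1 \<and> u \<cdot> i1' = t1"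
    using po(1) st sq unfolding is_pushout_def by metis
  then obtain u1 where u1: "u1 \<in> Hom C (src C z') (src C e)" "u1 \<cdot> f1' = s1" "u1 \<cdot> i1' = t1"
    using st sq by auto
  have "\<exists>!u. u \<in> Hom C (tgt C f2') (tgt C s2) \<and> u \<cdot> f2' = s2 \<and> u \<cdot> i2' = t2"
    using po(2) st sq unfolding is_pushout_def by metis
  then obtain u2 where u2: "u2 \<in> Hom C (tgt C z') (tgt C e)" "u2 \<cdot> f2' = s2" "u2 \<cdot> i2' = t2"
    using st sq by auto
  have "e \<cdot> u1 = u2 \<cdot> z'"
  proof (rule pushout_ext[OF po(1)])
    show "e \<cdot> u1 \<in> Hom C (tgt C f1') (tgt C e)" "u2 \<cdot> z' \<in> Hom C (tgt C f1') (tgt C e)"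
      using u1 u2 st sq by (auto simp: Hom_C)
    have "(u2 \<cdot> z') \<cdot> f1' = (u2 \<cdot> f2') \<cdot> z" using u2(1) sq by (simp add: Hom_C assoc)
    thus "(e \<cdot> u1) \<cdot> f1' = (u2 \<cdot> z') \<cdot> f1'" using u1 u2(2) st sq by (simp add: Hom_C assoc)
    have "(u2 \<cdot> z') \<cdot> i1' = (u2 \<cdot> i2') \<cdot> x'" using u2(1) sq by (simp add: Hom_C assoc)
    thus "(e \<cdot> u1) \<cdot> i1' = (u2 \<cdot> z') \<cdot> i1'" using u1 u2(3) st sq by (simp add: Hom_C assoc)
  qed
  hence u: "Square z' u1 u2 e \<in> Hom H z' e" using u1 u2 st sq by (auto simp: morphism_Hom_iff)
  show ?case
  proof (rule ex1I)
    show "Square z' u1 u2 e \<in> Hom H (tgt H (Square z f1' f2' z')) (tgt H s) \<and>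
        Square z' u1 u2 e \<cdot>\<^bsub>H\<^esub> Square z f1' f2' z' = s \<and> Square z' u1 u2 e \<cdot>\<^bsub>H\<^esub> Square x' i1' i2'
          z' = t"
      using u u1 u2 s t by simp
    fix v assume "v \<in> Hom H (tgt H (Square z f1' f2' z')) (tgt H s) \<and>
        v \<cdot>\<^bsub>H\<^esub> Square z f1' f2' z' = s \<and> v \<cdot>\<^bsub>H\<^esub> Square x' i1' i2' z' = t"
    then obtain v1 v2 where v: "v = Square z' v1 v2 e" "v1 \<in> Hom C (src C z') (src C e)"
      "v1 \<cdot> f1' = s1" "v1 \<cdot> i1' = t1" "v2 \<in> Hom C (tgt C z') (tgt C e)" "v2 \<cdot> f2' = s2" "v2 \<cdot> i2'
        = t2"
      using s t by (cases v) (auto simp: morphism_Hom_iff)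
    have "v1 = u1" by (rule pushout_ext[OF po(1)]) (use v u1 sq in auto)
    moreover have "v2 = u2" by (rule pushout_ext[OF po(2)]) (use v u2 sq in auto)
    ultimately show "v = Square z' u1 u2 e" using v by simp
  qed
qed (use arr in simp_all)

lemma morphism_pullback:
  assumes po: "is_pullback C p1 f1 p1' f1'" "is_pullback C p2 f2 p2' f2'"
    and arr: "Square z p1 p2 y \<in> arr H" "Square y' f1 f2 y \<in> arr H" "Square z' p1' p2' y' \<in> arr H"
      "Square z' f1' f2' z \<in> arr H"
  shows "is_pullback H (Square z p1 p2 y) (Square y' f1 f2 y) (Square z' p1' p2' y') (Square z'
    f1' f2' z)"
  unfolding is_pullback_def
proof (intro conjI ballI impI, goal_cases)
  note sq = arr[unfolded Square_arr Hom_C]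
  case 9
  show ?case using po by (simp add: is_pullback_def)
next
  note sq = arr[unfolded Square_arr Hom_C]
  case (10 s t)
  obtain e s1 s2 where s: "s = Square e s1 s2 z"
    using 10 by (cases s) auto
  obtain t1 t2 where t: "t = Square e t1 t2 y'"
    using 10 s by (cases t) auto
  have st: "e \<in> arr C" "s1 \<in> arr C" "tgt C s1 = src C z" "src C s1 = src C e"
    "s2 \<in> arr C" "tgt C s2 = tgt C z" "src C s2 = tgt C e" "z \<cdot> s1 = s2 \<cdot> e"
    "t1 \<in> arr C" "tgt C t1 = src C y'" "src C t1 = src C e"
    "t2 \<in> arr C" "tgt C t2 = tgt C y'" "src C t2 = tgt C e" "y' \<cdot> t1 = t2 \<cdot> e"
    "p1 \<cdot> s1 = f1 \<cdot> t1" "p2 \<cdot> s2 = f2 \<cdot> t2"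
    using 10 s t by (auto simp: Hom_C)
  have "\<exists>!u. u \<in> Hom C (src C s1) (src C f1') \<and> f1' \<cdot> u = s1 \<and> p1' \<cdot> u = t1"
    using po(1) st sq unfolding is_pullback_def by metis
  then obtain u1 where u1: "u1 \<in> Hom C (src C e) (src C z')" "f1' \<cdot> u1 = s1" "p1' \<cdot> u1 = t1"
    using st sq by auto
  have "\<exists>!u. u \<in> Hom C (src C s2) (src C f2') \<and> f2' \<cdot> u = s2 \<and> p2' \<cdot> u = t2"
    using po(2) st sq unfolding is_pullback_def by metis
  then obtain u2 where u2: "u2 \<in> Hom C (tgt C e) (tgt C z')" "f2' \<cdot> u2 = s2" "p2' \<cdot> u2 = t2"
    using st sq by auto
  have "z' \<cdot> u1 = u2 \<cdot> e"
  proof (rule pullback_ext[OF po(2)])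
    show "z' \<cdot> u1 \<in> Hom C (src C e) (src C f2')" "u2 \<cdot> e \<in> Hom C (src C e) (src C f2')"
      using u1 u2 st sq by (auto simp: Hom_C)
    have "f2' \<cdot> (z' \<cdot> u1) = (z \<cdot> f1') \<cdot> u1" using u1(1) sq by (simp add: Hom_C assoc)
    also have "\<dots> = z \<cdot> s1" using u1 sq assoc[of u1 f1' z] by (simp add: Hom_C)
    also have "\<dots> = f2' \<cdot> (u2 \<cdot> e)" using st u2(1) sq by (simp add: Hom_C assoc flip: u2(2))
    finally show "f2' \<cdot> (z' \<cdot> u1) = f2' \<cdot> (u2 \<cdot> e)" .
    have "p2' \<cdot> (z' \<cdot> u1) = (y' \<cdot> p1') \<cdot> u1" using u1(1) sq by (simp add: Hom_C assoc)
    also have "\<dots> = y' \<cdot> t1" using u1 sq assoc[of u1 p1' y'] by (simp add: Hom_C)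
    also have "\<dots> = p2' \<cdot> (u2 \<cdot> e)" using st u2(1) sq by (simp add: Hom_C assoc flip: u2(3))
    finally show "p2' \<cdot> (z' \<cdot> u1) = p2' \<cdot> (u2 \<cdot> e)" .
  qed
  hence u: "Square e u1 u2 z' \<in> Hom H e z'" using u1 u2 st sq by (auto simp: morphism_Hom_iff)
  show ?case
  proof (rule ex1I)
    show "Square e u1 u2 z' \<in> Hom H (src H s) (src H (Square z' f1' f2' z)) \<and>
        Square z' f1' f2' z \<cdot>\<^bsub>H\<^esub> Square e u1 u2 z' = s \<and> Square z' p1' p2' y' \<cdot>\<^bsub>H\<^esub> Square e u1 u2
          z' = t"
      using u u1 u2 s t by simp
    fix v assume "v \<in> Hom H (src H s) (src H (Square z' f1' f2' z)) \<and>
        Square z' f1' f2' z \<cdot>\<^bsub>H\<^esub> v = s \<and> Square z' p1' p2' y' \<cdot>\<^bsub>H\<^esub> v = t"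
    then obtain v1 v2 where v: "v = Square e v1 v2 z'" "v1 \<in> Hom C (src C e) (src C z')"
      "f1' \<cdot> v1 = s1" "p1' \<cdot> v1 = t1" "v2 \<in> Hom C (tgt C e) (tgt C z')" "f2' \<cdot> v2 = s2" "p2' \<cdot> v2
        = t2"
      using s t by (cases v) (auto simp: morphism_Hom_iff)
    have "v1 = u1" by (rule pullback_ext[OF po(1)]) (use v u1 sq in auto)
    moreover have "v2 = u2" by (rule pullback_ext[OF po(2)]) (use v u2 sq in auto)
    ultimately show "v = Square e u1 u2 z'" using v by simp
  qed
qed (use arr in simp_all)

end

section \<open>Full subcategories\<close>

lemma full_subcategory_sel [simp]:
  "obj (full_subcategory C P) = obj C \<inter> P"
  "arr (full_subcategory C P) = {f \<in> arr C. src C f \<in> P \<and> tgt C f \<in> P}"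
  "src (full_subcategory C P) = src C"
  "tgt (full_subcategory C P) = tgt C"
  "ident (full_subcategory C P) = ident C"
  "comp (full_subcategory C P) = comp C"
  "zero_arr (full_subcategory C P) = zero_arr C"
  "add_arr (full_subcategory C P) = add_arr C"
  by (simp_all add: full_subcategory_def)

lemma full_Hom [simp]:
  "\<lbrakk>A \<in> P; B \<in> P\<rbrakk> \<Longrightarrow> Hom (full_subcategory C P) A B = Hom C A B"
  by (auto simp: Hom_def)

lemma full_HomD: "f \<in> Hom (full_subcategory C P) A B \<Longrightarrow> f \<in> Hom C A B \<and> A \<in> P \<and> B \<in> P"
  by (auto simp: Hom_def)

lemma full_biproduct [simp]:
  assumes "A \<in> P" "B \<in> P" "S \<in> P"
  shows "is_biproduct (full_subcategory C P) A B S \<longleftrightarrow> is_biproduct C A B S"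
  using assms by (simp add: is_biproduct_def)

lemma full_kernel:
  assumes "is_kernel C i p" "src C i \<in> P" "tgt C i \<in> P" "tgt C p \<in> P"
  shows "is_kernel (full_subcategory C P) i p"
  using assms unfolding is_kernel_def by (simp cong: conj_cong)

lemma full_cokernel:
  assumes "is_cokernel C i p" "src C i \<in> P" "tgt C i \<in> P" "tgt C p \<in> P"
  shows "is_cokernel (full_subcategory C P) i p"
  using assms unfolding is_cokernel_def by (simp cong: conj_cong)

lemma full_pushout:
  assumes po: "is_pushout C i f i' f'"
    and P: "src C i \<in> P" "tgt C i \<in> P" "tgt C f \<in> P" "tgt C i' \<in> P"
  shows "is_pushout (full_subcategory C P) i f i' f'"
proof -
  have univ: "\<exists>!u. u \<in> Hom C (tgt C f') (tgt C s) \<and> u \<cdot>\<^bsub>C\<^esub> f' = s \<and> u \<cdot>\<^bsub>C\<^esub> i' = t"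
    if "s \<in> arr C" "t \<in> arr C" "src C s = tgt C i" "src C t = tgt C f" "tgt C s = tgt C t"
      "s \<cdot>\<^bsub>C\<^esub> i = t \<cdot>\<^bsub>C\<^esub> f" for s t
    using po that unfolding is_pushout_def by blast
  have "Hom (full_subcategory C P) (tgt C f') (tgt C s) = Hom C (tgt C f') (tgt C s)"
    if "tgt C s \<in> P" for s
    using po P that by (intro full_Hom) (auto simp: is_pushout_def)
  thus ?thesis
    using po P univ by (simp add: is_pushout_def[of "full_subcategory C P"]) (simp add:
      is_pushout_def)
qed

lemma full_pullback:
  assumes po: "is_pullback C p f p' f'"
    and P: "tgt C p \<in> P" "src C p \<in> P" "src C f \<in> P" "src C p' \<in> P"
  shows "is_pullback (full_subcategory C P) p f p' f'"
proof -
  have univ: "\<exists>!u. u \<in> Hom C (src C s) (src C f') \<and> f' \<cdot>\<^bsub>C\<^esub> u = s \<and> p' \<cdot>\<^bsub>C\<^esub> u = t"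
    if "s \<in> arr C" "t \<in> arr C" "tgt C s = src C p" "tgt C t = src C f" "src C s = src C t"
      "p \<cdot>\<^bsub>C\<^esub> s = f \<cdot>\<^bsub>C\<^esub> t" for s t
    using po that unfolding is_pullback_def by blast
  have "Hom (full_subcategory C P) (src C s) (src C f') = Hom C (src C s) (src C f')"
    if "src C s \<in> P" for s
    using po P that by (intro full_Hom) (auto simp: is_pullback_def)
  thus ?thesis
    using po P univ by (simp add: is_pullback_def[of "full_subcategory C P"]) (simp add:
      is_pullback_def)
qed

lemma full_subcategory_additive:
  fixes C :: "('o, 'a) cat"
  assumes "additive_category C"
    and zero: "is_zero_object C Z" "Z \<in> P"
    and sum: "\<And>A B. \<lbrakk>A \<in> obj C; B \<in> obj C; A \<in> P; B \<in> P\<rbrakk> \<Longrightarrow> \<exists>S\<in>P. is_biproduct C A B S"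
  shows "additive_category (full_subcategory C P)"
proof -
  interpret additive_category C by fact
  let ?D = "full_subcategory C P"
  show ?thesis
  proof (rule additive_category.intro)
    fix f assume "f \<in> arr ?D"
    thus "src ?D f \<in> obj ?D" "tgt ?D f \<in> obj ?D" using src_obj tgt_obj by auto
  next
    fix A assume "A \<in> obj ?D"
    thus "ident ?D A \<in> Hom ?D A A" using ident_hom by simp
  next
    fix f g A B D assume "f \<in> Hom ?D A B" "g \<in> Hom ?D B D"
    thus "g \<cdot>\<^bsub>?D\<^esub> f \<in> Hom ?D A D" by (auto dest!: full_HomD intro: comp_hom)
  next
    fix f g h A B D E assume "f \<in> Hom ?D A B" "g \<in> Hom ?D B D" "h \<in> Hom ?D D E"
    thus "h \<cdot>\<^bsub>?D\<^esub> g \<cdot>\<^bsub>?D\<^esub> f = h \<cdot>\<^bsub>?D\<^esub> (g \<cdot>\<^bsub>?D\<^esub> f)" by (auto dest!: full_HomD intro: comp_assoc)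
  next
    fix f A B assume "f \<in> Hom ?D A B"
    thus "f \<cdot>\<^bsub>?D\<^esub> ident ?D A = f" "ident ?D B \<cdot>\<^bsub>?D\<^esub> f = f"
      by (auto dest!: full_HomD intro: comp_ident_right comp_ident_left)
  next
    fix A B assume "A \<in> obj ?D" "B \<in> obj ?D"
    thus "comm_group \<lparr>carrier = Hom ?D A B, monoid.mult = add_arr ?D, one = zero_arr ?D A B\<rparr>"
      using hom_group[of A B] by simp
    show "\<exists>S. is_biproduct ?D A B S"
      using sum[of A B] \<open>A \<in> obj ?D\<close> \<open>B \<in> obj ?D\<close> full_biproduct[of A P B _ C] by fastforce
  next
    fix f g h A B D assume "f \<in> Hom ?D A B" "g \<in> Hom ?D B D" "h \<in> Hom ?D B D"
    thus "add_arr ?D g h \<cdot>\<^bsub>?D\<^esub> f = add_arr ?D (g \<cdot>\<^bsub>?D\<^esub> f) (h \<cdot>\<^bsub>?D\<^esub> f)"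
      by (auto dest!: full_HomD intro: comp_add_left)
  next
    fix f g h A B D assume "f \<in> Hom ?D A B" "g \<in> Hom ?D A B" "h \<in> Hom ?D B D"
    thus "h \<cdot>\<^bsub>?D\<^esub> add_arr ?D f g = add_arr ?D (h \<cdot>\<^bsub>?D\<^esub> f) (h \<cdot>\<^bsub>?D\<^esub> g)"
      by (auto dest!: full_HomD intro: comp_add_right)
  next
    show "\<exists>Z. is_zero_object ?D Z"
      using zero by (intro exI[of _ Z]) (simp add: is_zero_object_def)
  qed
qed

section \<open>Extensions with split components\<close>

context additive_base
begin

text \<open>
The data behind a member of \<open>scw_class\<close>, with a middle object \<open>z\<close> whose components are split
extensions. Instead of a splitting of the sequence of cokernels, it records the arrow \<open>r\<close>: as
\<open>r \<cdot> z = 0\<close>, it factors through a cokernel of \<open>z\<close>, and \<open>r \<cdot> a2 = c\<close> says that the factor is a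
retraction of the arrow induced by \<open>a2\<close>. In this form no cokernel of \<open>z\<close> or \<open>y\<close> occurs, so the
data can be written down before such cokernels are known to exist.
\<close>

definition scw_data where
  "scw_data x z y a1 a2 b1 b2 \<rho>1 \<rho>2 s1 s2 c r \<longleftrightarrow>
     x \<in> arr C \<and> z \<in> arr C \<and> y \<in> arr C \<and>
     biproduct_data C (src C x) (src C z) (src C y) a1 b1 \<rho>1 s1 \<and>
     biproduct_data C (tgt C x) (tgt C z) (tgt C y) a2 b2 \<rho>2 s2 \<and>
     z \<cdot> a1 = a2 \<cdot> x \<and> y \<cdot> b1 = b2 \<cdot> z \<and>
     is_cokernel C x c \<and> r \<in> Hom C (tgt C z) (tgt C c) \<and>
     r \<cdot> z = zero_arr C (src C z) (tgt C c) \<and> r \<cdot> a2 = c"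

lemma cokernelD:
  assumes "is_cokernel C i p"
  shows "i \<in> arr C" "p \<in> arr C" "src C p = tgt C i" "p \<cdot> i = zero_arr C (src C i) (tgt C p)"
    "src C i \<in> obj C" "tgt C i \<in> obj C" "tgt C p \<in> obj C"
  using assms src_obj tgt_obj by (auto simp: is_cokernel_def)

lemma scw_dataD:
  assumes "scw_data x z y a1 a2 b1 b2 \<rho>1 \<rho>2 s1 s2 c r"
  shows "x \<in> arr C" "z \<in> arr C" "y \<in> arr C"
    "biproduct_data C (src C x) (src C z) (src C y) a1 b1 \<rho>1 s1"
    "biproduct_data C (tgt C x) (tgt C z) (tgt C y) a2 b2 \<rho>2 s2"
    "z \<cdot> a1 = a2 \<cdot> x" "y \<cdot> b1 = b2 \<cdot> z"
    "is_cokernel C x c" "r \<in> arr C" "src C r = tgt C z" "tgt C r = tgt C c"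
    "r \<cdot> z = zero_arr C (src C z) (tgt C c)" "r \<cdot> a2 = c"
  using assms unfolding scw_data_def Hom_C by auto

text \<open>
Relative to the splittings, \<open>z\<close> is the upper triangular matrix with diagonal \<open>x\<close>, \<open>y\<close> and corner
\<open>\<delta> = \<rho>2 \<cdot> (z \<cdot> s1)\<close>, and \<open>r\<close> is the row with entries \<open>c\<close> and \<open>h = r \<cdot> s2\<close>. The condition \<open>r \<cdot> z = 0\<close>
amounts to the cocycle equation \<open>c \<cdot> \<delta> + h \<cdot> y = 0\<close>.
\<close>

lemma scw_data_expand:
  assumes "scw_data x z y a1 a2 b1 b2 \<rho>1 \<rho>2 s1 s2 c r"
  shows "\<rho>2 \<cdot> z = x \<cdot> \<rho>1 \<boxplus> (\<rho>2 \<cdot> (z \<cdot> s1)) \<cdot> b1"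
    "z \<cdot> s1 = a2 \<cdot> (\<rho>2 \<cdot> (z \<cdot> s1)) \<boxplus> s2 \<cdot> y"
    "c \<cdot> (\<rho>2 \<cdot> (z \<cdot> s1)) \<boxplus> (r \<cdot> s2) \<cdot> y = zero_arr C (src C y) (tgt C c)"
proof -
  note e = scw_dataD[OF assms]
  note b = biproduct_calc[OF e(4)] biproduct_calc[OF e(5)]
  note d = biproduct_dataD(1-15)[OF e(4)] biproduct_dataD(1-15)[OF e(5)]
  note k = cokernelD[OF e(8)]
  have za: "\<rho>2 \<cdot> (z \<cdot> a1) = x" using b e(1-3,6) by simp
  have bz: "b2 \<cdot> (z \<cdot> s1) = y" using b e(1-3) reduce[OF e(7)[symmetric], of s1] by (simp add: assoc)
  show "\<rho>2 \<cdot> z = x \<cdot> \<rho>1 \<boxplus> (\<rho>2 \<cdot> (z \<cdot> s1)) \<cdot> b1"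
    using biproduct_decomp(2)[OF e(4), of "\<rho>2 \<cdot> z"] d e(1-3) za by (simp add: assoc)
  show zs: "z \<cdot> s1 = a2 \<cdot> (\<rho>2 \<cdot> (z \<cdot> s1)) \<boxplus> s2 \<cdot> y"
    using biproduct_decomp(1)[OF e(5), of "z \<cdot> s1"] d e(1-3) bz by simp
  have "zero_arr C (src C y) (tgt C c) = (r \<cdot> z) \<cdot> s1" using d e(1-3,12) k by simp
  also have "\<dots> = r \<cdot> (z \<cdot> s1)" using d e(1-3,9-11) by (simp add: assoc)
  also have "\<dots> = r \<cdot> (a2 \<cdot> (\<rho>2 \<cdot> (z \<cdot> s1)) \<boxplus> s2 \<cdot> y)" using zs by simp
  also have "\<dots> = c \<cdot> (\<rho>2 \<cdot> (z \<cdot> s1)) \<boxplus> (r \<cdot> s2) \<cdot> y"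
    using d e(1-3,9-11) by (simp add: distrib assoc reduce[OF e(13)])
  finally show "c \<cdot> (\<rho>2 \<cdot> (z \<cdot> s1)) \<boxplus> (r \<cdot> s2) \<cdot> y = zero_arr C (src C y) (tgt C c)" by simp
qed

text \<open>
A triangular matrix with monic diagonal is monic: if \<open>z \<cdot> u = z \<cdot> v\<close>, then \<open>u\<close> and \<open>v\<close> have the same
second coordinate because \<open>y\<close> is monic, and after subtracting its contribution also the same first
coordinate because \<open>x\<close> is monic.
\<close>

lemma extension_mono:
  assumes e: "scw_data x z y a1 a2 b1 b2 \<rho>1 \<rho>2 s1 s2 c r" and "mono_arr C x" "mono_arr C y"
  shows "mono_arr C z"
  unfolding mono_arr_def
proof (intro conjI ballI impI)
  note e = scw_dataD[OF e]
  note d = biproduct_dataD(1-15)[OF e(4)] biproduct_dataD(1-15)[OF e(5)]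
  show "z \<in> arr C" by (rule e)
  fix T u v assume T: "T \<in> obj C" and u: "u \<in> Hom C T (src C z)" and v: "v \<in> Hom C T (src C z)"
    and eq: "z \<cdot> u = z \<cdot> v"
  have y: "y \<cdot> (b1 \<cdot> w) = b2 \<cdot> (z \<cdot> w)" if "w \<in> Hom C T (src C z)" for w
    using reduce[OF e(7), of w] that d e(1-3) by (simp add: Hom_C assoc)
  have b: "b1 \<cdot> u = b1 \<cdot> v"
    using \<open>mono_arr C y\<close> T y[OF u] y[OF v] eq u v d e(1-3) unfolding mono_arr_def
    by (auto simp: Hom_C)
  have w: "\<rho>2 \<cdot> (z \<cdot> w) = (\<rho>2 \<cdot> (z \<cdot> s1)) \<cdot> (b1 \<cdot> w) \<boxplus> x \<cdot> (\<rho>1 \<cdot> w)"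
    if "w \<in> Hom C T (src C z)" for w
  proof -
    have "\<rho>2 \<cdot> (z \<cdot> w) = (x \<cdot> \<rho>1 \<boxplus> (\<rho>2 \<cdot> (z \<cdot> s1)) \<cdot> b1) \<cdot> w"
      using reduce[OF refl, of w z \<rho>2] that d e(1-3) scw_data_expand(1)[OF assms(1)]
        by (simp add: Hom_C)
    thus ?thesis using that d e(1-3) by (simp add: Hom_C distrib assoc sum_comm)
  qed
  have "(\<rho>2 \<cdot> (z \<cdot> s1)) \<cdot> (b1 \<cdot> v) \<boxplus> x \<cdot> (\<rho>1 \<cdot> u) = (\<rho>2 \<cdot> (z \<cdot> s1)) \<cdot> (b1 \<cdot> v) \<boxplus> x \<cdot> (\<rho>1 \<cdot> v)"
    using w[OF u] w[OF v] eq b by simp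
  hence "x \<cdot> (\<rho>1 \<cdot> u) = x \<cdot> (\<rho>1 \<cdot> v)"
    by (rule sum_cancel[rotated 3]) (use u v d e(1-3) in \<open>auto simp: Hom_C\<close>)
  hence "\<rho>1 \<cdot> u = \<rho>1 \<cdot> v"
    using \<open>mono_arr C x\<close> T u v d e(1-3) unfolding mono_arr_def by (auto simp: Hom_C)
  thus "u = v" using b by (intro biproduct_ext(2)[OF e(4) u v])
qed

text \<open>
The cokernel of \<open>z\<close> is the direct sum of those of \<open>x\<close> and \<open>y\<close>, with \<open>r\<close> as first coordinate. An
arrow \<open>t\<close> with \<open>t \<cdot> z = 0\<close> restricts along \<open>a2\<close> to some \<open>t1 \<cdot> c\<close>; the rest \<open>t - t1 \<cdot> r\<close> vanishes on
\<open>a2\<close> and on \<open>z\<close>, so it comes from an arrow out of the target of \<open>y\<close> that annihilates \<open>y\<close>.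
\<close>

lemma extension_cokernel:
  assumes e: "scw_data x z y a1 a2 b1 b2 \<rho>1 \<rho>2 s1 s2 c r" and cy: "is_cokernel C y cy"
    and S: "biproduct_data C (tgt C c) S (tgt C cy) i p \<rho> s"
  shows "is_cokernel C z (i \<cdot> r \<boxplus> s \<cdot> (cy \<cdot> b2))"
proof -
  note e = scw_dataD[OF e]
  note b = biproduct_calc[OF e(4)] biproduct_calc[OF e(5)] biproduct_calc[OF S]
  note d = biproduct_dataD(1-15)[OF e(4)] biproduct_dataD(1-15)[OF e(5)] biproduct_dataD(1-15)[OF S]
  note k = cokernelD[OF e(8)] cokernelD[OF cy]
  define q where "q = i \<cdot> r \<boxplus> s \<cdot> (cy \<cdot> b2)"
  have q: "q \<in> arr C" "src C q = tgt C z" "tgt C q = S" using d e(1-3,9-11) k by (auto simp: q_def)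
  have qz: "q \<cdot> z = zero_arr C (src C z) S"
    unfolding q_def using d e(1-3,9-12) k by (simp add: distrib assoc flip: e(7)) (simp add:
      reduce[OF k(11)])
  have qa: "q \<cdot> a2 = i \<cdot> c"
    unfolding q_def using b e(1-3,9-11,13) k by (simp add: distrib assoc)
  have \<rho>q: "\<rho> \<cdot> q = r" and pq: "p \<cdot> q = cy \<cdot> b2"
    unfolding q_def using b e(1-3,9-11) k by (simp_all add: distrib)
  show ?thesis
    unfolding q_def[symmetric] is_cokernel_def
  proof (intro conjI ballI impI)
    show "z \<in> arr C" "q \<in> arr C" "tgt C z = src C q" "q \<cdot> z = zero_arr C (src C z) (tgt C q)"
      using e q qz by auto
    fix t assume "t \<in> arr C" "src C t = tgt C z \<and> t \<cdot> z = zero_arr C (src C z) (tgt C t)"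
    hence t: "t \<in> arr C" "src C t = tgt C z" "t \<cdot> z = zero_arr C (src C z) (tgt C t)"
      "tgt C t \<in> obj C"
      using tgt_obj by auto
    have "(t \<cdot> a2) \<cdot> x = (t \<cdot> z) \<cdot> a1" using t(1,2) d e(1-3,6) by (simp add: assoc)
    hence "(t \<cdot> a2) \<cdot> x = zero_arr C (src C x) (tgt C (t \<cdot> a2))" using t d e(1-3) by simp
    then obtain t1 where t1: "t1 \<in> Hom C (tgt C c) (tgt C (t \<cdot> a2))" "t1 \<cdot> c = t \<cdot> a2"
      by (rule cokernel_lift[OF e(8), rotated 2]) (use t d in auto)
    hence t1': "t1 \<in> arr C" "src C t1 = tgt C c" "tgt C t1 = tgt C t" using t d
      by (auto simp: Hom_C)
    \<comment> \<open>the rest \<open>n = t - t1 \<cdot> r\<close>\<close>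
    obtain n where "n \<in> Hom C (tgt C z) (tgt C t)" and n: "t1 \<cdot> r \<boxplus> n = t"
      by (rule difference[of "t1 \<cdot> r" "tgt C z" "tgt C t" t]) (use t t1' e in \<open>auto simp: Hom_C\<close>)
    hence n': "n \<in> arr C" "src C n = tgt C z" "tgt C n = tgt C t" by (auto simp: Hom_C)
    have "t1 \<cdot> c \<boxplus> n \<cdot> a2 = (t1 \<cdot> r \<boxplus> n) \<cdot> a2" using t1' n' d e(1-3,9-11,13)
      by (simp add: distrib assoc)
    also have "\<dots> = t1 \<cdot> c \<boxplus> zero_arr C (tgt C x) (tgt C t)" using n t1 t d by simp
    finally have na: "n \<cdot> a2 = zero_arr C (tgt C x) (tgt C t)"
      by (rule sum_cancel[rotated 3]) (use t t1' k n' d in \<open>auto simp: Hom_C\<close>)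
    have nn: "(n \<cdot> s2) \<cdot> b2 = n"
      using biproduct_decomp(2)[OF e(5), of n] n' d na t by simp
    have "n \<cdot> z = (t1 \<cdot> r) \<cdot> z \<boxplus> n \<cdot> z"
      using t1' n' e(1-3,9-12) k t d by (simp add: assoc)
    also have "\<dots> = (t1 \<cdot> r \<boxplus> n) \<cdot> z" using t1' n' e(1-3,9-11) by (simp add: distrib)
    finally have nz: "n \<cdot> z = zero_arr C (src C z) (tgt C t)" using n t by simp
    have "(n \<cdot> s2) \<cdot> y = (n \<cdot> s2) \<cdot> (y \<cdot> b1) \<cdot> s1" using n' d e(1-3) b by (simp add: assoc)
    also have "\<dots> = ((n \<cdot> s2) \<cdot> b2) \<cdot> z \<cdot> s1" using n' d e(1-3) by (simp add: assoc e(7))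
    also have "\<dots> = zero_arr C (src C y) (tgt C t)" using nn nz t d by simp
    finally have "(n \<cdot> s2) \<cdot> y = zero_arr C (src C y) (tgt C (n \<cdot> s2))" using n' d by simp
    then obtain t2 where t2: "t2 \<in> Hom C (tgt C cy) (tgt C (n \<cdot> s2))" "t2 \<cdot> cy = n \<cdot> s2"
      by (rule cokernel_lift[OF cy, rotated 2]) (use n' d in auto)
    hence t2': "t2 \<in> arr C" "src C t2 = tgt C cy" "tgt C t2 = tgt C t" using n' d
      by (auto simp: Hom_C)
    define u where "u = t1 \<cdot> \<rho> \<boxplus> t2 \<cdot> p"
    have u: "u \<in> Hom C (tgt C q) (tgt C t)" unfolding u_def using t1' t2' d q by (simp add: Hom_C)
    have "u \<cdot> q = t1 \<cdot> r \<boxplus> t2 \<cdot> (cy \<cdot> b2)"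
      unfolding u_def using t1' t2' d q \<rho>q pq by (simp add: distrib assoc)
    also have "t2 \<cdot> (cy \<cdot> b2) = n" using nn assoc[of b2 cy t2] t2' t2(2) k d by simp
    finally have uq: "u \<cdot> q = t" using n by simp
    show "\<exists>!u. u \<in> Hom C (tgt C q) (tgt C t) \<and> u \<cdot> q = t"
    proof (rule ex1I)
      show "u \<in> Hom C (tgt C q) (tgt C t) \<and> u \<cdot> q = t" using u uq by simp
      fix v assume "v \<in> Hom C (tgt C q) (tgt C t) \<and> v \<cdot> q = t"
      hence v: "v \<in> Hom C S (tgt C t)" and vq: "v \<cdot> q = t" using q by auto
      have ex: "w \<cdot> i = t1 \<and> (w \<cdot> s) \<cdot> cy = n \<cdot> s2" if w: "w \<in> Hom C S (tgt C t)" "w \<cdot> q = t" for w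
      proof
        have w': "w \<in> arr C" "src C w = S" "tgt C w = tgt C t" using w(1) by (auto simp: Hom_C)
        have "(w \<cdot> i) \<cdot> c = (w \<cdot> q) \<cdot> a2" using w' q d k qa by (simp add: assoc)
        also have "\<dots> = t1 \<cdot> c" using w(2) t1 by simp
        finally show wi: "w \<cdot> i = t1"
          by (rule cokernel_epi[OF e(8), rotated 2]) (use w' d t1' in \<open>auto simp: Hom_C\<close>)
        have "t1 \<cdot> r \<boxplus> ((w \<cdot> s) \<cdot> cy) \<cdot> b2 = w \<cdot> q"
          unfolding q_def using w' d k e(1-3,9-11) wi assoc[of r i w] by (simp add: distrib assoc)
        also have "\<dots> = t1 \<cdot> r \<boxplus> n" using w(2) n by simp
        finally have wn: "((w \<cdot> s) \<cdot> cy) \<cdot> b2 = n"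
          by (rule sum_cancel[rotated 3]) (use w' d k t1' e(9-11) n' in \<open>auto simp: Hom_C\<close>)
        show "(w \<cdot> s) \<cdot> cy = n \<cdot> s2"
          unfolding wn[symmetric] using w' d k b by (simp add: assoc)
      qed
      show "v = u"
      proof (rule biproduct_ext(1)[OF S v])
        show u': "u \<in> Hom C S (tgt C t)" using u q by simp
        show "v \<cdot> i = u \<cdot> i" using ex[OF v vq] ex[OF u' uq] by simp
        have "(v \<cdot> s) \<cdot> cy = (u \<cdot> s) \<cdot> cy" using ex[OF v vq] ex[OF u' uq] by simp
        thus "v \<cdot> s = u \<cdot> s"
          by (rule cokernel_epi[OF cy, rotated 2]) (use v u' d in \<open>auto simp: Hom_C\<close>)
      qed
    qed
  qed
qed

text \<open>
The arrow that \<open>r\<close> induces on the cokernel of \<open>z\<close> is a retraction of \<open>u\<close>. So it is enough that \<open>v\<close>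
is a cokernel of \<open>u\<close>, which follows by chasing the universal properties of \<open>c\<close>, \<open>cz\<close> and \<open>cy\<close>.
\<close>

lemma cokernels_split:
  assumes e: "scw_data x z y a1 a2 b1 b2 \<rho>1 \<rho>2 s1 s2 c r"
    and cz: "is_cokernel C z cz" and cy: "is_cokernel C y cy"
    and u: "u \<in> Hom C (tgt C c) (tgt C cz)" "u \<cdot> c = cz \<cdot> a2"
    and v: "v \<in> Hom C (tgt C cz) (tgt C cy)" "v \<cdot> cz = cy \<cdot> b2"
  shows "split_short_exact C u v"
proof -
  note e = scw_dataD[OF e]
  note b = biproduct_calc[OF e(4)] biproduct_calc[OF e(5)]
  note d = biproduct_dataD(1-15)[OF e(4)] biproduct_dataD(1-15)[OF e(5)]
  note k = cokernelD[OF e(8)] cokernelD[OF cz] cokernelD[OF cy]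
  have u': "u \<in> arr C" "src C u = tgt C c" "tgt C u = tgt C cz" using u by (auto simp: Hom_C)
  have v': "v \<in> arr C" "src C v = tgt C cz" "tgt C v = tgt C cy" using v by (auto simp: Hom_C)
  obtain r' where "r' \<in> Hom C (tgt C cz) (tgt C r)" and r'r: "r' \<cdot> cz = r"
    by (rule cokernel_lift[OF cz, of r]) (use e in auto)
  hence r': "r' \<in> arr C" "src C r' = tgt C cz" "tgt C r' = tgt C c" using e by (auto simp: Hom_C)
  have vu: "v \<cdot> u = zero_arr C (tgt C c) (tgt C cy)"
  proof (rule cokernel_epi[OF e(8)])
    have "(v \<cdot> u) \<cdot> c = (v \<cdot> cz) \<cdot> a2" using u' v' u(2) k d by (simp add: assoc)
    thus "(v \<cdot> u) \<cdot> c = zero_arr C (tgt C c) (tgt C cy) \<cdot> c" using b e(1-3) k v(2)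
      by (simp add: assoc)
  qed (use u' v' k in \<open>auto simp: Hom_C\<close>)
  have "is_cokernel C u v"
    unfolding is_cokernel_def
  proof (intro conjI ballI impI)
    show "u \<in> arr C" "v \<in> arr C" "tgt C u = src C v" "v \<cdot> u = zero_arr C (src C u) (tgt C v)"
      using u' v' vu by auto
    fix t assume "t \<in> arr C" "src C t = tgt C u \<and> t \<cdot> u = zero_arr C (src C u) (tgt C t)"
    hence t: "t \<in> arr C" "src C t = tgt C cz" "t \<cdot> u = zero_arr C (tgt C c) (tgt C t)"
      "tgt C t \<in> obj C"
      using u' tgt_obj by auto
    have "(t \<cdot> cz) \<cdot> a2 = (t \<cdot> u) \<cdot> c" using u' t(1,2) u(2) d k by (simp add: assoc)
    hence ta: "(t \<cdot> cz) \<cdot> a2 = zero_arr C (tgt C x) (tgt C t)" using t k by simp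
    define w where "w = (t \<cdot> cz) \<cdot> s2"
    have w: "w \<in> arr C" "src C w = tgt C y" "tgt C w = tgt C t" unfolding w_def using t k d by auto
    have wb: "w \<cdot> b2 = t \<cdot> cz"
      using biproduct_decomp(2)[OF e(5), of "t \<cdot> cz"] ta t k d by (simp add: w_def)
    have "w \<cdot> y = w \<cdot> (y \<cdot> b1) \<cdot> s1" using w d e(1-3) b by (simp add: assoc)
    also have "\<dots> = (t \<cdot> cz) \<cdot> z \<cdot> s1" using w d e(1-3) by (simp add: assoc e(7) flip: wb)
    also have "\<dots> = zero_arr C (src C y) (tgt C t)" using t k d e(1-3)
      by (simp add: assoc reduce[OF k(11)])
    finally have "w \<cdot> y = zero_arr C (src C y) (tgt C w)" using w by simp
    then obtain t2 where "t2 \<in> Hom C (tgt C cy) (tgt C w)" and t2c: "t2 \<cdot> cy = w"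
      by (rule cokernel_lift[OF cy, rotated 2]) (use w in auto)
    hence t2: "t2 \<in> arr C" "src C t2 = tgt C cy" "tgt C t2 = tgt C t" using w by (auto simp: Hom_C)
    have "(t2 \<cdot> v) \<cdot> cz = (t2 \<cdot> cy) \<cdot> b2" using t2 v' v(2) k d by (simp add: assoc)
    also have "\<dots> = t \<cdot> cz" using t2c wb by simp
    finally have tv: "t2 \<cdot> v = t"
      by (rule cokernel_epi[OF cz, rotated 2]) (use t2 t v' in \<open>auto simp: Hom_C\<close>)
    show "\<exists>!w. w \<in> Hom C (tgt C v) (tgt C t) \<and> w \<cdot> v = t"
    proof (rule ex1I)
      show "t2 \<in> Hom C (tgt C v) (tgt C t) \<and> t2 \<cdot> v = t" using t2 v' tv by (simp add: Hom_C)
      fix t3 assume "t3 \<in> Hom C (tgt C v) (tgt C t) \<and> t3 \<cdot> v = t"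
      hence t3: "t3 \<in> arr C" "src C t3 = tgt C cy" "tgt C t3 = tgt C t" "t3 \<cdot> v = t"
        using v' by (auto simp: Hom_C)
      have uniq: "t4 \<cdot> cy = (t \<cdot> cz) \<cdot> s2"
        if "t4 \<in> arr C" "src C t4 = tgt C cy" "tgt C t4 = tgt C t" "t4 \<cdot> v = t" for t4
      proof -
        have "t4 \<cdot> cy = t4 \<cdot> (cy \<cdot> b2) \<cdot> s2" using that k b by (simp add: assoc)
        also have "\<dots> = (t4 \<cdot> v) \<cdot> cz \<cdot> s2" using that(1-3) v' k d by (simp add: assoc flip: v(2))
        finally show ?thesis using that k t d by (simp add: assoc)
      qed
      have "t3 \<cdot> cy = t2 \<cdot> cy" using uniq[OF t3] uniq[OF t2 tv] by simp
      thus "t3 = t2" by (rule cokernel_epi[OF cy, rotated 2]) (use t3 t2 in \<open>auto simp: Hom_C\<close>)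
    qed
  qed
  moreover have "r' \<cdot> u = ident C (src C u)"
  proof (rule cokernel_epi[OF e(8)])
    have "(r' \<cdot> u) \<cdot> c = (r' \<cdot> cz) \<cdot> a2" using r' u' u(2) k d by (simp add: assoc)
    thus "(r' \<cdot> u) \<cdot> c = ident C (src C u) \<cdot> c" using r'r e(13) u' k by simp
  qed (use r' u' k in \<open>auto simp: Hom_C\<close>)
  moreover have "r' \<in> Hom C (tgt C u) (src C u)" using r' u' by (simp add: Hom_C)
  ultimately show ?thesis by (intro split_monic_cokernel)
qed

end

context additive_base
begin

text \<open>
Converse of \<open>scw_data_expand\<close>: a solution \<open>\<delta>\<close>, \<open>h\<close> of the cocycle equation determines a triangular
matrix \<open>z\<close> and a row \<open>r\<close> with \<open>r \<cdot> z = 0\<close>.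
\<close>

lemma extension_of_cocycle:
  assumes xy: "x \<in> arr C" "y \<in> arr C" and c: "is_cokernel C x c"
    and \<delta>: "\<delta> \<in> Hom C (src C y) (tgt C x)" and h: "h \<in> Hom C (tgt C y) (tgt C c)"
    and cocycle: "c \<cdot> \<delta> \<boxplus> h \<cdot> y = zero_arr C (src C y) (tgt C c)"
  obtains z a1 a2 b1 b2 \<rho>1 \<rho>2 s1 s2 r where "scw_data x z y a1 a2 b1 b2 \<rho>1 \<rho>2 s1 s2 c r"
    "\<rho>2 \<cdot> z = x \<cdot> \<rho>1 \<boxplus> \<delta> \<cdot> b1" "z \<cdot> s1 = a2 \<cdot> \<delta> \<boxplus> s2 \<cdot> y" "r \<cdot> s2 = h"
proof -
  note o = src_obj[OF xy(1)] tgt_obj[OF xy(1)] src_obj[OF xy(2)] tgt_obj[OF xy(2)]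
  note k = cokernelD[OF c]
  obtain Z1 a1 b1 \<rho>1 s1 where 1: "biproduct_data C (src C x) Z1 (src C y) a1 b1 \<rho>1 s1"
    using biproducts[OF o(1,3)] unfolding is_biproduct_iff_data by blast
  obtain Z2 a2 b2 \<rho>2 s2 where 2: "biproduct_data C (tgt C x) Z2 (tgt C y) a2 b2 \<rho>2 s2"
    using biproducts[OF o(2,4)] unfolding is_biproduct_iff_data by blast
  note b = biproduct_calc[OF 1] biproduct_calc[OF 2]
  have \<delta>': "\<delta> \<in> arr C" "src C \<delta> = src C y" "tgt C \<delta> = tgt C x" using \<delta> by (auto simp: Hom_C)
  have h': "h \<in> arr C" "src C h = tgt C y" "tgt C h = tgt C c" using h by (auto simp: Hom_C)
  define z where "z = a2 \<cdot> (x \<cdot> \<rho>1 \<boxplus> \<delta> \<cdot> b1) \<boxplus> s2 \<cdot> (y \<cdot> b1)"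
  define r where "r = c \<cdot> \<rho>2 \<boxplus> h \<cdot> b2"
  have z: "z \<in> arr C" "src C z = Z1" "tgt C z = Z2" unfolding z_def using b xy \<delta>' by auto
  have r: "r \<in> arr C" "src C r = Z2" "tgt C r = tgt C c" unfolding r_def using b k h' by auto
  have za: "z \<cdot> a1 = a2 \<cdot> x" unfolding z_def using b xy \<delta>' by (simp add: distrib assoc)
  have bz: "y \<cdot> b1 = b2 \<cdot> z" unfolding z_def using b xy \<delta>' by (simp add: distrib)
  have \<rho>z: "\<rho>2 \<cdot> z = x \<cdot> \<rho>1 \<boxplus> \<delta> \<cdot> b1" unfolding z_def using b xy \<delta>' by (simp add: distrib)
  have zs: "z \<cdot> s1 = a2 \<cdot> \<delta> \<boxplus> s2 \<cdot> y" unfolding z_def using b xy \<delta>' by (simp add: distrib assoc)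
  have ra: "r \<cdot> a2 = c" unfolding r_def using b k h' by (simp add: distrib assoc)
  have rs: "r \<cdot> s2 = h" unfolding r_def using b k h' by (simp add: distrib assoc)
  have "r \<cdot> z = (c \<cdot> x) \<cdot> \<rho>1 \<boxplus> (c \<cdot> \<delta> \<boxplus> h \<cdot> y) \<cdot> b1"
  proof -
    have "r \<cdot> z = (r \<cdot> a2) \<cdot> (x \<cdot> \<rho>1 \<boxplus> \<delta> \<cdot> b1) \<boxplus> (r \<cdot> s2) \<cdot> (y \<cdot> b1)"
      unfolding z_def using r b xy \<delta>' by (simp add: distrib assoc)
    thus ?thesis unfolding ra rs using k h' b xy \<delta>' by (simp add: distrib assoc sum_assoc
      reduce[OF k(4)])
  qed
  hence rz: "r \<cdot> z = zero_arr C Z1 (tgt C c)" using k b xy cocycle by simp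
  have "scw_data x z y a1 a2 b1 b2 \<rho>1 \<rho>2 s1 s2 c r"
    unfolding scw_data_def using 1 2 xy z r za bz ra rz c by (simp add: Hom_C)
  thus thesis using \<rho>z zs rs by (rule that)
qed

lemma scw_short_exact:
  assumes e: "scw_data x z y a1 a2 b1 b2 \<rho>1 \<rho>2 s1 s2 c r"
  shows "Square x a1 a2 z \<in> arr H" "Square z b1 b2 y \<in> arr H"
    "short_exact H (Square x a1 a2 z) (Square z b1 b2 y)"
proof -
  note e = scw_dataD[OF e]
  note d = biproduct_dataD(1-15)[OF e(4)] biproduct_dataD(1-15)[OF e(5)]
  show A: "Square x a1 a2 z \<in> arr H" "Square z b1 b2 y \<in> arr H"
    using d e(1-3,6,7) by (auto simp: Hom_C)
  show "short_exact H (Square x a1 a2 z) (Square z b1 b2 y)"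
    unfolding short_exact_def using A e(4,5)
    by (auto intro!: morphism_kernel morphism_cokernel biproduct_data_kernel biproduct_data_cokernel
        simp del: Square_arr)
qed

end

text \<open>
The setting of the main construction: a class of objects that is closed under finite direct sums,
including the empty one.
\<close>

locale sum_closed_subcategory = additive_base C for C :: "('o, 'a) cat" (structure) +
  fixes X :: "'o set"
  assumes zero_closed: "is_zero_object C Z \<Longrightarrow> Z \<in> X"
    and sum_closed: "\<lbrakk>A \<in> X; B \<in> X; is_biproduct C A B S\<rbrakk> \<Longrightarrow> S \<in> X"
begin

abbreviation M where "M \<equiv> mono_objects C X"
abbreviation S\<^sub>X where "S\<^sub>X \<equiv> mono_category C X"
abbreviation scw where "scw \<equiv> scw_class C X"

lemma mono_objectsE:
  assumes "f \<in> M"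
  obtains c where "f \<in> arr C" "mono_arr C f" "src C f \<in> X" "tgt C f \<in> X" "is_cokernel C f c"
    "tgt C c \<in> X"
  using assms by (auto simp: mono_objects_def mono_arr_def)

lemma mono_objects_arr: "f \<in> M \<Longrightarrow> f \<in> arr C"
  by (rule mono_objectsE)

lemma extension_mono_objects:
  assumes e: "scw_data x z y a1 a2 b1 b2 \<rho>1 \<rho>2 s1 s2 c r" and x: "x \<in> M" and y: "y \<in> M"
    and c: "tgt C c \<in> X"
  shows "z \<in> M"
proof -
  note d = scw_dataD[OF e]
  obtain cy where cy: "is_cokernel C y cy" "tgt C cy \<in> X" using y by (rule mono_objectsE)
  obtain S i p \<rho> s where S: "biproduct_data C (tgt C c) S (tgt C cy) i p \<rho> s"
    using biproducts cokernelD(7)[OF d(8)] cokernelD(7)[OF cy(1)] unfolding is_biproduct_iff_data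
      by blast
  note cz = extension_cokernel[OF e cy(1) S]
  note b = biproduct_dataD(1-15)[OF S] biproduct_dataD(1-15)[OF d(5)]
  have "tgt C (i \<cdot> r \<boxplus> s \<cdot> (cy \<cdot> b2)) = S"
    using b d(9-11) cokernelD[OF cy(1)] by simp
  moreover have "S \<in> X" using sum_closed[OF c cy(2)] S unfolding is_biproduct_iff_data by blast
  moreover have "src C z \<in> X" "tgt C z \<in> X"
    using x y d(4,5) sum_closed[of "src C x" "src C y" "src C z"] sum_closed[of "tgt C x"
      "tgt C y" "tgt C z"]
    unfolding mono_objects_def is_biproduct_iff_data by blast+
  moreover have "mono_arr C z"
    using extension_mono[OF e] x y by (simp add: mono_objects_def)
  ultimately show ?thesis using cz unfolding mono_objects_def by auto
qed

text \<open>
The arrows induced on cokernels are recovered from universal properties, and \<open>cokernels_split\<close>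
splits the resulting sequence.
\<close>

lemma scw_classI:
  assumes e: "scw_data x z y a1 a2 b1 b2 \<rho>1 \<rho>2 s1 s2 c r" and M: "x \<in> M" "y \<in> M" "z \<in> M"
  shows "(Square x a1 a2 z, Square z b1 b2 y) \<in> scw"
proof -
  note d = scw_dataD[OF e]
  note b = biproduct_dataD(1-15)[OF d(4)] biproduct_dataD(1-15)[OF d(5)]
    biproduct_dataD(18)[OF d(5), THEN reduce]
  obtain cy where cy: "is_cokernel C y cy" using M(2) by (rule mono_objectsE)
  obtain cz where cz: "is_cokernel C z cz" using M(3) by (rule mono_objectsE)
  note k = cokernelD[OF d(8)] cokernelD[OF cz] cokernelD[OF cy]
  have "(cz \<cdot> a2) \<cdot> x = (cz \<cdot> z) \<cdot> a1" using k(1-3,8-10) b d(1-3,6) by (simp add: assoc)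
  hence "(cz \<cdot> a2) \<cdot> x = zero_arr C (src C x) (tgt C (cz \<cdot> a2))" using k b by simp
  then obtain u where "u \<in> Hom C (tgt C c) (tgt C (cz \<cdot> a2))" and uc: "u \<cdot> c = cz \<cdot> a2"
    by (rule cokernel_lift[OF d(8), rotated 2]) (use k b in auto)
  hence u: "u \<in> Hom C (tgt C c) (tgt C cz)" using k b by simp
  have "(cy \<cdot> b2) \<cdot> z = (cy \<cdot> y) \<cdot> b1" using k(1-3,15-17) b d(1-3,7) by (simp add: assoc)
  hence "(cy \<cdot> b2) \<cdot> z = zero_arr C (src C z) (tgt C (cy \<cdot> b2))" using k b by simp
  then obtain v where "v \<in> Hom C (tgt C cz) (tgt C (cy \<cdot> b2))" and vc: "v \<cdot> cz = cy \<cdot> b2"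
    by (rule cokernel_lift[OF cz, rotated 2]) (use k b in auto)
  hence v: "v \<in> Hom C (tgt C cz) (tgt C cy)" using k b by simp
  have "split_short_exact C u v" by (rule cokernels_split[OF e cz cy u uc v vc])
  thus ?thesis
    unfolding scw_class_def
    using scw_short_exact(3)[OF e] M biproduct_data_split[OF d(4)] biproduct_data_split[OF d(5)]
      d(8) cy cz u uc v vc by simp blast
qed

text \<open>
If the sequence of cokernels splits, compose the cokernel of \<open>z\<close> with a retraction to obtain \<open>r\<close>.
The cokernel \<open>c\<close> of \<open>x\<close> is left free, since any two choices differ by an induced arrow; a caller
can therefore choose one with target in \<open>X\<close>.
\<close>

lemma scw_classE:
  assumes "(\<phi>, \<psi>) \<in> scw"
  obtains x z y a1 a2 b1 b2 where "\<phi> = Square x a1 a2 z" "\<psi> = Square z b1 b2 y"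
    "x \<in> M" "y \<in> M" "z \<in> M"
    "\<And>c. is_cokernel C x c \<Longrightarrow> \<exists>\<rho>1 \<rho>2 s1 s2 r. scw_data x z y a1 a2 b1 b2 \<rho>1 \<rho>2 s1 s2 c r"
proof -
  have se: "\<phi> \<in> arr H" "\<psi> \<in> arr H" "sq_tgt \<phi> = sq_src \<psi>"
    using assms by (auto simp: scw_class_def short_exact_def is_kernel_def)
  obtain x a1 a2 z where \<phi>: "\<phi> = Square x a1 a2 z" by (cases \<phi>)
  obtain b1 b2 y where \<psi>: "\<psi> = Square z b1 b2 y" using se(3) \<phi> by (cases \<psi>) auto
  note sq = se(1,2)[unfolded \<phi> \<psi> Square_arr Hom_C]
  have M: "x \<in> M" "y \<in> M" "z \<in> M" and sp: "split_short_exact C a1 b1" "split_short_exact C a2 b2"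
    using assms \<phi> \<psi> by (auto simp: scw_class_def)
  obtain \<rho>1 s1 where 1: "biproduct_data C (src C x) (src C z) (src C y) a1 b1 \<rho>1 s1"
    using split_short_exactE[OF sp(1)] sq by metis
  obtain \<rho>2 s2 where 2: "biproduct_data C (tgt C x) (tgt C z) (tgt C y) a2 b2 \<rho>2 s2"
    using split_short_exactE[OF sp(2)] sq by metis
  obtain cx cz u v where cx: "is_cokernel C x cx" and cz: "is_cokernel C z cz"
    and u: "u \<in> Hom C (tgt C cx) (tgt C cz)" "u \<cdot> cx = cz \<cdot> a2" and uv: "split_short_exact C u v"
    using assms \<phi> \<psi> by (auto simp: scw_class_def)
  obtain \<rho>u su where "biproduct_data C (src C u) (src C v) (tgt C v) u v \<rho>u su"
    by (rule split_short_exactE[OF uv])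
  note bu = biproduct_calc[OF this]
  note k = cokernelD[OF cx] cokernelD[OF cz]
  note b = biproduct_dataD(1-15)[OF 1] biproduct_dataD(1-15)[OF 2]
  have u': "src C u = tgt C cx" "src C v = tgt C cz" using u bu by (auto simp: Hom_C)
  have "\<exists>\<rho>1 \<rho>2 s1 s2 r. scw_data x z y a1 a2 b1 b2 \<rho>1 \<rho>2 s1 s2 c r" if c: "is_cokernel C x c" for c
  proof -
    note kc = cokernelD[OF c]
    obtain t where "t \<in> Hom C (tgt C cx) (tgt C c)" and tc: "t \<cdot> cx = c"
      by (rule cokernel_lift[OF cx, of c]) (use kc in auto)
    hence t: "t \<in> arr C" "src C t = tgt C cx" "tgt C t = tgt C c" by (auto simp: Hom_C)
    let ?r = "t \<cdot> (\<rho>u \<cdot> cz)"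
    have "?r \<in> Hom C (tgt C z) (tgt C c)" using t bu u' k by (simp add: Hom_C)
    moreover have "?r \<cdot> z = zero_arr C (src C z) (tgt C c)" using t bu u' k by (simp add: assoc)
    moreover have "?r \<cdot> a2 = c"
    proof -
      have "?r \<cdot> a2 = t \<cdot> (\<rho>u \<cdot> (u \<cdot> cx))" using t bu u' k b u(2) by (simp add: assoc)
      thus ?thesis using bu u' k t tc by simp
    qed
    ultimately have "scw_data x z y a1 a2 b1 b2 \<rho>1 \<rho>2 s1 s2 c ?r"
      unfolding scw_data_def using 1 2 sq c by simp
    thus ?thesis by blast
  qed
  thus thesis using that \<phi> \<psi> M by blast
qed

lemma zero_mono_object:
  assumes Z: "is_zero_object C Z"
  shows "ident C Z \<in> M" "is_cokernel C (ident C Z) (ident C Z)"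
proof -
  have o: "Z \<in> obj C" using Z by (simp add: is_zero_object_def)
  have u: "\<lbrakk>f \<in> Hom C Z A; g \<in> Hom C Z A\<rbrakk> \<Longrightarrow> f = g" for f g A
    using Z Hom_obj[of f Z A] unfolding is_zero_object_def by blast
  have zz: "zero_arr C Z Z = ident C Z" using u[OF zero_hom ident_hom] o by blast
  show c: "is_cokernel C (ident C Z) (ident C Z)"
    unfolding is_cokernel_def
  proof (intro conjI ballI impI)
    fix t assume t: "t \<in> arr C" "src C t = tgt C (ident C Z) \<and>
      t \<cdot> ident C Z = zero_arr C (src C (ident C Z)) (tgt C t)"
    show "\<exists>!u. u \<in> Hom C (tgt C (ident C Z)) (tgt C t) \<and> u \<cdot> ident C Z = t"
      using t o by (intro ex1I[of _ t]) (auto simp: Hom_C)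
  qed (use o zz in auto)
  show "ident C Z \<in> M"
    unfolding mono_objects_def mono_arr_def using c o zero_closed[OF Z] by (auto simp: Hom_C)
qed

text \<open>
A direct sum of arrows is the extension with corner \<open>\<delta> = 0\<close>, so \<open>extension_mono_objects\<close> applies.
\<close>

lemma mono_objects_sum:
  assumes f: "f \<in> M" and g: "g \<in> M" and h: "is_biproduct H f g h"
  shows "h \<in> M"
proof -
  obtain \<phi> \<psi> \<rho> s where b: "biproduct_data H f h g \<phi> \<psi> \<rho> s"
    using h unfolding is_biproduct_iff_data by blast
  obtain c where c: "is_cokernel C f c" "tgt C c \<in> X" using f by (rule mono_objectsE)
  note k = cokernelD[OF c(1)]
  have arr: "f \<in> arr C" "h \<in> arr C" "g \<in> arr C" using b by (auto simp: biproduct_data_def)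
  note 1 = biproduct_data_morphismD[OF b]
  note d = biproduct_calc[OF 1(1)] biproduct_calc[OF 1(2)]
  have sq: "h \<cdot> sq_fst \<phi> = sq_snd \<phi> \<cdot> f" "g \<cdot> sq_fst \<psi> = sq_snd \<psi> \<cdot> h" "f \<cdot> sq_fst \<rho> = sq_snd \<rho> \<cdot> h"
    using b by (auto simp: biproduct_data_def morphism_Hom_iff)
  have "(c \<cdot> sq_snd \<rho>) \<cdot> h = zero_arr C (src C h) (tgt C c)"
    using k d arr reduce[OF k(4)] by (simp add: assoc flip: sq(3))
  hence "scw_data f h g (sq_fst \<phi>) (sq_snd \<phi>) (sq_fst \<psi>) (sq_snd \<psi>) (sq_fst \<rho>) (sq_snd \<rho>) (sq_fst
    s) (sq_snd s)
      c (c \<cdot> sq_snd \<rho>)"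
    unfolding scw_data_def using 1 arr sq c k d by (simp add: Hom_C assoc)
  thus ?thesis by (rule extension_mono_objects[OF _ f g c(2)])
qed

lemma mono_category_additive: "additive_category S\<^sub>X"
  unfolding mono_category_def
proof -
  obtain Z where Z: "is_zero_object C Z" using zero_object by blast
  show "additive_category (full_subcategory H M)"
  proof (rule full_subcategory_additive[OF morphism_category_additive morphism_zero_object[OF Z]
        zero_mono_object(1)[OF Z]])
    fix f g assume "f \<in> obj H" "g \<in> obj H" and fg: "f \<in> M" "g \<in> M"
    then obtain h where "is_biproduct H f g h" using direct_sum_of_arrows[of f g] by auto
    thus "\<exists>S\<in>M. is_biproduct H f g S" using mono_objects_sum[OF fg] by blast
  qed
qed

lemma mono_category_arr_iff:
  "\<phi> \<in> arr S\<^sub>X \<longleftrightarrow> \<phi> \<in> arr H \<and> sq_src \<phi> \<in> M \<and> sq_tgt \<phi> \<in> M"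
  by (simp add: mono_category_def)

lemma mono_category_sel [simp]:
  "obj S\<^sub>X = M" "src S\<^sub>X = sq_src" "tgt S\<^sub>X = sq_tgt" "ident S\<^sub>X = ident H" "comp S\<^sub>X = comp H"
  using mono_objects_arr by (auto simp: mono_category_def)

lemma induced_on_cokernels:
  assumes f: "Square x f1 f2 x' \<in> arr H" and c: "is_cokernel C x c" and c': "is_cokernel C x' c'"
  obtains g where "g \<in> arr C" "src C g = tgt C c" "tgt C g = tgt C c'" "g \<cdot> c = c' \<cdot> f2"
proof -
  note k = cokernelD[OF c] cokernelD[OF c']
  note sq = f[unfolded Square_arr Hom_C]
  have "(c' \<cdot> f2) \<cdot> x = (c' \<cdot> x') \<cdot> f1" using k(1-3,8-10) sq by (simp add: assoc)
  hence "(c' \<cdot> f2) \<cdot> x = zero_arr C (src C x) (tgt C (c' \<cdot> f2))" using k sq by simp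
  then obtain g where "g \<in> Hom C (tgt C c) (tgt C (c' \<cdot> f2))" "g \<cdot> c = c' \<cdot> f2"
    by (rule cokernel_lift[OF c, rotated 2]) (use k sq in auto)
  thus thesis using that k sq by (auto simp: Hom_C)
qed

text \<open>
Pushing out along a square with components \<open>f1\<close>, \<open>f2\<close> that induces \<open>g\<close> on cokernels replaces the
cocycle \<open>(\<delta>, h)\<close> by \<open>(f2 \<cdot> \<delta>, g \<cdot> h)\<close>.
\<close>

lemma scw_pushout:
  assumes e: "scw_data x z y a1 a2 b1 b2 \<rho>1 \<rho>2 s1 s2 c r" and y: "y \<in> M"
    and x': "x' \<in> M" and f: "Square x f1 f2 x' \<in> arr H"
  obtains z' a1' a2' b1' b2' \<rho>1' \<rho>2' s1' s2' c' r'
  where "scw_data x' z' y a1' a2' b1' b2' \<rho>1' \<rho>2' s1' s2' c' r'" "z' \<in> M"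
    "Square z (a1' \<cdot> (f1 \<cdot> \<rho>1) \<boxplus> s1' \<cdot> b1) (a2' \<cdot> (f2 \<cdot> \<rho>2) \<boxplus> s2' \<cdot> b2) z' \<in> arr H"
    "is_pushout H (Square x a1 a2 z) (Square x f1 f2 x') (Square x' a1' a2' z')
      (Square z (a1' \<cdot> (f1 \<cdot> \<rho>1) \<boxplus> s1' \<cdot> b1) (a2' \<cdot> (f2 \<cdot> \<rho>2) \<boxplus> s2' \<cdot> b2) z')"
proof -
  note ee = scw_dataD[OF e]
  note d = biproduct_dataD(1-15)[OF ee(4)] biproduct_dataD(1-15)[OF ee(5)]
  note sq = f[unfolded Square_arr Hom_C]
  have sqe: "x' \<cdot> f1 = f2 \<cdot> x" using sq by simp
  obtain c' where c': "is_cokernel C x' c'" "tgt C c' \<in> X" using x' by (rule mono_objectsE)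
  obtain g where g: "g \<in> arr C" "src C g = tgt C c" "tgt C g = tgt C c'" "g \<cdot> c = c' \<cdot> f2"
    by (rule induced_on_cokernels[OF f ee(8) c'(1)])
  note k = cokernelD[OF c'(1)] cokernelD[OF ee(8)]
  define \<delta> where "\<delta> = \<rho>2 \<cdot> (z \<cdot> s1)"
  have \<delta>: "\<delta> \<in> arr C" "src C \<delta> = src C y" "tgt C \<delta> = tgt C x" unfolding \<delta>_def using d ee(1-3)
    by auto
  note ex = scw_data_expand[OF e, folded \<delta>_def]
  have "c' \<cdot> (f2 \<cdot> \<delta>) \<boxplus> (g \<cdot> (r \<cdot> s2)) \<cdot> y = g \<cdot> (c \<cdot> \<delta> \<boxplus> (r \<cdot> s2) \<cdot> y)"
    using g(1-3) \<delta> d ee(1-3,9-11) k sq reduce[OF g(4), of \<delta>] by (simp add: distrib assoc)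
  hence co: "c' \<cdot> (f2 \<cdot> \<delta>) \<boxplus> (g \<cdot> (r \<cdot> s2)) \<cdot> y = zero_arr C (src C y) (tgt C c')"
    using ex(3) g(1-3) d by simp
  obtain z' a1' a2' b1' b2' \<rho>1' \<rho>2' s1' s2' r'
    where e': "scw_data x' z' y a1' a2' b1' b2' \<rho>1' \<rho>2' s1' s2' c' r'"
    and zs': "z' \<cdot> s1' = a2' \<cdot> (f2 \<cdot> \<delta>) \<boxplus> s2' \<cdot> y"
    by (rule extension_of_cocycle[OF _ ee(3) c'(1) _ _ co])
      (use g(1-3) \<delta> d ee(9-11) sq in \<open>auto simp: Hom_C\<close>)
  note ee' = scw_dataD[OF e']
  note d' = biproduct_dataD(1-15)[OF ee'(4)] biproduct_dataD(1-15)[OF ee'(5)]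
  let ?f1 = "a1' \<cdot> (f1 \<cdot> \<rho>1) \<boxplus> s1' \<cdot> b1" and ?f2 = "a2' \<cdot> (f2 \<cdot> \<rho>2) \<boxplus> s2' \<cdot> b2"
  have "z' \<cdot> ?f1 = (z' \<cdot> a1') \<cdot> (f1 \<cdot> \<rho>1) \<boxplus> (z' \<cdot> s1') \<cdot> b1"
    using d d' ee(1-3) ee'(1-3) sq by (simp add: distrib assoc)
  also have "\<dots> = (a2' \<cdot> x') \<cdot> (f1 \<cdot> \<rho>1) \<boxplus> (a2' \<cdot> (f2 \<cdot> \<delta>) \<boxplus> s2' \<cdot> y) \<cdot> b1"
    by (simp only: zs' ee'(6))
  also have "\<dots> = a2' \<cdot> ((x' \<cdot> f1) \<cdot> \<rho>1) \<boxplus> (a2' \<cdot> (f2 \<cdot> (\<delta> \<cdot> b1)) \<boxplus> s2' \<cdot> (y \<cdot> b1))"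
    using d d' ee(1-3) ee'(1-3) sq \<delta> by (simp add: distrib assoc reduce[OF sqe])
  also have "\<dots> = a2' \<cdot> (f2 \<cdot> (x \<cdot> \<rho>1 \<boxplus> \<delta> \<cdot> b1)) \<boxplus> s2' \<cdot> (b2 \<cdot> z)"
    using d d' ee(1-3,7) ee'(1-3) sq \<delta> by (simp add: distrib assoc sum_assoc reduce[OF sqe])
  also have "\<dots> = ?f2 \<cdot> z"
    using d d' ee(1-3) ee'(1-3) sq by (simp add: distrib assoc flip: ex(1))
  finally have F: "Square z ?f1 ?f2 z' \<in> arr H"
    using d d' ee(1-3) ee'(1-3) sq by (simp add: Hom_C)
  have "is_pushout H (Square x a1 a2 z) (Square x f1 f2 x') (Square x' a1' a2' z') (Square z ?f1
    ?f2 z')"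
    using sq by (intro morphism_pushout biproduct_pushout[OF ee(4) ee'(4)] biproduct_pushout[OF
      ee(5) ee'(5)]
        scw_short_exact(1)[OF e] scw_short_exact(1)[OF e'] f F) (auto simp: Hom_C)
  thus thesis
    by (rule that[OF e' extension_mono_objects[OF e' x' y c'(2)] F])
qed

text \<open>
Dually, pulling back replaces \<open>(\<delta>, h)\<close> by \<open>(\<delta> \<cdot> f1, h \<cdot> f2)\<close>. The last conclusion, that \<open>r\<close> restricts
to the row \<open>r'\<close> of the new extension, serves to compose two admissible epics.
\<close>

lemma scw_pullback:
  assumes e: "scw_data x z y a1 a2 b1 b2 \<rho>1 \<rho>2 s1 s2 c r" and x: "x \<in> M" and c: "tgt C c \<in> X"
    and y': "y' \<in> M" and f: "Square y' f1 f2 y \<in> arr H"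
  obtains z' a1' a2' b1' b2' \<rho>1' \<rho>2' s1' s2' r'
  where "scw_data x z' y' a1' a2' b1' b2' \<rho>1' \<rho>2' s1' s2' c r'" "z' \<in> M"
    "Square z' (a1 \<cdot> \<rho>1' \<boxplus> s1 \<cdot> (f1 \<cdot> b1')) (a2 \<cdot> \<rho>2' \<boxplus> s2 \<cdot> (f2 \<cdot> b2')) z \<in> arr H"
    "is_pullback H (Square z b1 b2 y) (Square y' f1 f2 y) (Square z' b1' b2' y')
      (Square z' (a1 \<cdot> \<rho>1' \<boxplus> s1 \<cdot> (f1 \<cdot> b1')) (a2 \<cdot> \<rho>2' \<boxplus> s2 \<cdot> (f2 \<cdot> b2')) z)"
    "r \<cdot> (a2 \<cdot> \<rho>2' \<boxplus> s2 \<cdot> (f2 \<cdot> b2')) = r'"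
proof -
  note ee = scw_dataD[OF e]
  note d = biproduct_dataD(1-15)[OF ee(4)] biproduct_dataD(1-15)[OF ee(5)]
  note sq = f[unfolded Square_arr Hom_C]
  have sqe: "y \<cdot> f1 = f2 \<cdot> y'" using sq by simp
  note k = cokernelD[OF ee(8)]
  define \<delta> where "\<delta> = \<rho>2 \<cdot> (z \<cdot> s1)"
  have \<delta>: "\<delta> \<in> arr C" "src C \<delta> = src C y" "tgt C \<delta> = tgt C x" unfolding \<delta>_def using d ee(1-3)
    by auto
  note ex = scw_data_expand[OF e, folded \<delta>_def]
  have "c \<cdot> (\<delta> \<cdot> f1) \<boxplus> (r \<cdot> (s2 \<cdot> f2)) \<cdot> y' = (c \<cdot> \<delta> \<boxplus> (r \<cdot> s2) \<cdot> y) \<cdot> f1"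
    using \<delta> d ee(1-3,9-11) k sq by (simp add: distrib assoc)
  hence co: "c \<cdot> (\<delta> \<cdot> f1) \<boxplus> (r \<cdot> (s2 \<cdot> f2)) \<cdot> y' = zero_arr C (src C y') (tgt C c)"
    using ex(3) d sq k by simp
  obtain z' a1' a2' b1' b2' \<rho>1' \<rho>2' s1' s2' r'
    where e': "scw_data x z' y' a1' a2' b1' b2' \<rho>1' \<rho>2' s1' s2' c r'"
    and \<rho>z': "\<rho>2' \<cdot> z' = x \<cdot> \<rho>1' \<boxplus> (\<delta> \<cdot> f1) \<cdot> b1'"
    and rs': "r' \<cdot> s2' = r \<cdot> (s2 \<cdot> f2)"
    by (rule extension_of_cocycle[OF ee(1) _ ee(8) _ _ co])
      (use \<delta> d ee(9-11) sq in \<open>auto simp: Hom_C\<close>)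
  note ee' = scw_dataD[OF e']
  note d' = biproduct_dataD(1-15)[OF ee'(4)] biproduct_dataD(1-15)[OF ee'(5)]
  let ?f1 = "a1 \<cdot> \<rho>1' \<boxplus> s1 \<cdot> (f1 \<cdot> b1')" and ?f2 = "a2 \<cdot> \<rho>2' \<boxplus> s2 \<cdot> (f2 \<cdot> b2')"
  have "z \<cdot> ?f1 = (z \<cdot> a1) \<cdot> \<rho>1' \<boxplus> (z \<cdot> s1) \<cdot> (f1 \<cdot> b1')"
    using d d' ee(1-3) ee'(1-3) sq by (simp add: distrib assoc)
  also have "\<dots> = (a2 \<cdot> x) \<cdot> \<rho>1' \<boxplus> (a2 \<cdot> \<delta> \<boxplus> s2 \<cdot> y) \<cdot> (f1 \<cdot> b1')"
    by (simp only: ex(2)[symmetric] ee(6))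
  also have "\<dots> = a2 \<cdot> (x \<cdot> \<rho>1' \<boxplus> (\<delta> \<cdot> f1) \<cdot> b1') \<boxplus> s2 \<cdot> ((y \<cdot> f1) \<cdot> b1')"
    using d d' ee(1-3) ee'(1-3) sq \<delta> by (simp add: distrib assoc sum_assoc reduce[OF sqe])
  also have "\<dots> = a2 \<cdot> (\<rho>2' \<cdot> z') \<boxplus> s2 \<cdot> (f2 \<cdot> (y' \<cdot> b1'))"
    using d d' ee(1-3) ee'(1-3) sq \<delta> by (simp add: assoc \<rho>z')
  also have "\<dots> = ?f2 \<cdot> z'"
    using d d' ee(1-3) ee'(1-3,7) sq by (simp add: distrib assoc)
  finally have F: "Square z' ?f1 ?f2 z \<in> arr H"
    using d d' ee(1-3) ee'(1-3) sq by (simp add: Hom_C)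
  have P: "is_pullback H (Square z b1 b2 y) (Square y' f1 f2 y) (Square z' b1' b2' y') (Square z'
    ?f1 ?f2 z)"
    using sq by (intro morphism_pullback biproduct_pullback[OF ee(4) ee'(4)] biproduct_pullback[OF
      ee(5) ee'(5)]
        scw_short_exact(2)[OF e] scw_short_exact(2)[OF e'] f F) (auto simp: Hom_C)
  have "r \<cdot> ?f2 = c \<cdot> \<rho>2' \<boxplus> (r \<cdot> (s2 \<cdot> f2)) \<cdot> b2'"
    using d d' ee(9-11) sq by (simp add: distrib assoc reduce[OF ee(13)])
  also have "\<dots> = r'"
    using biproduct_decomp(2)[OF ee'(5), of r'] ee'(9-11,13) rs' by simp
  finally have R: "r \<cdot> ?f2 = r'" .
  show thesis
    by (rule that[OF e' extension_mono_objects[OF e' x y' c] F P R])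
qed

end

section \<open>The exact structure\<close>

context additive_category
begin

text \<open>
The components of a composite of admissible monics: as \<open>S = A \<oplus> B\<close> and \<open>W = S \<oplus> V\<close>, the cokernel
of \<open>j \<cdot> i\<close> is \<open>K = B \<oplus> V\<close>, and the projection \<open>W \<rightarrow> K\<close> is the one that \<open>biproduct_pushout\<close> gives
for \<open>j\<close> and \<open>p\<close>.
\<close>

lemma biproduct_data_compose:
  assumes 1: "biproduct_data C A S B i p \<rho> s" and 2: "biproduct_data C S W V j q \<sigma> t"
    and 3: "biproduct_data C B K V j' q' \<sigma>' t'"
  shows "biproduct_data C A W K (j \<cdot> i) (j' \<cdot> (p \<cdot> \<sigma>) \<boxplus> t' \<cdot> q) (\<rho> \<cdot> \<sigma>) (j \<cdot> (s \<cdot> \<sigma>') \<boxplus> t \<cdot> q')"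
proof -
  note b = biproduct_calc(1-19,21-)[OF 1] biproduct_calc(1-19,21-)[OF 2]
    biproduct_calc(1-19,21-)[OF 3]
  have "(j \<cdot> i) \<cdot> (\<rho> \<cdot> \<sigma>) \<boxplus> (j \<cdot> (s \<cdot> \<sigma>') \<boxplus> t \<cdot> q') \<cdot> (j' \<cdot> (p \<cdot> \<sigma>) \<boxplus> t' \<cdot> q)
      = j \<cdot> ((i \<cdot> \<rho> \<boxplus> s \<cdot> p) \<cdot> \<sigma>) \<boxplus> t \<cdot> q"
    using b by (simp add: distrib assoc sum_assoc)
  also have "\<dots> = ident C W"
    using b(1-15,24-38) biproduct_dataD(20)[OF 1] biproduct_dataD(20)[OF 2] by simp
  finally show ?thesis
    unfolding biproduct_data_def using b biproduct_dataD(20)[OF 3]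
      by (simp add: Hom_iff distrib assoc)
qed

lemma biproduct_data_transport:
  assumes b: "biproduct_data C A S B i p \<rho> s"
    and \<alpha>: "\<alpha> \<in> Hom C A A'" "\<alpha>' \<in> Hom C A' A" "\<alpha>' \<cdot> \<alpha> = ident C A" "\<alpha> \<cdot> \<alpha>' = ident C A'"
    and \<beta>: "\<beta> \<in> Hom C S S'" "\<beta>' \<in> Hom C S' S" "\<beta>' \<cdot> \<beta> = ident C S" "\<beta> \<cdot> \<beta>' = ident C S'"
    and \<gamma>: "\<gamma> \<in> Hom C B B'" "\<gamma>' \<in> Hom C B' B" "\<gamma>' \<cdot> \<gamma> = ident C B" "\<gamma> \<cdot> \<gamma>' = ident C B'"
    and i: "i' \<in> Hom C A' S'" "\<beta> \<cdot> i = i' \<cdot> \<alpha>" and p: "p' \<in> Hom C S' B'" "\<gamma> \<cdot> p = p' \<cdot> \<beta>"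
  shows "biproduct_data C A' S' B' i' p' (\<alpha> \<cdot> (\<rho> \<cdot> \<beta>')) (\<beta> \<cdot> (s \<cdot> \<gamma>'))"
proof -
  note o = Hom_obj[OF \<alpha>(1)] Hom_obj[OF \<beta>(1)] Hom_obj[OF \<gamma>(1)]
  note c = biproduct_calc(1-19,21-)[OF b]
  note t = \<alpha>(1,2)[unfolded Hom_iff] \<beta>(1,2)[unfolded Hom_iff] \<gamma>(1,2)[unfolded Hom_iff]
    i(1)[unfolded Hom_iff] p(1)[unfolded Hom_iff]
  note r = \<alpha>(3,4)[THEN reduce] \<beta>(3,4)[THEN reduce] \<gamma>(3,4)[THEN reduce]
  have "i' = (i' \<cdot> \<alpha>) \<cdot> \<alpha>'" using \<alpha> i(1) t o by (simp add: assoc)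
  hence i': "i' = \<beta> \<cdot> (i \<cdot> \<alpha>')" using t c by (simp add: assoc flip: i(2))
  have "p' = (p' \<cdot> \<beta>) \<cdot> \<beta>'" using \<beta> p(1) t o by (simp add: assoc)
  hence p': "p' = \<gamma> \<cdot> (p \<cdot> \<beta>')" using t c by (simp add: assoc flip: p(2))
  have "(i' \<cdot> (\<alpha> \<cdot> (\<rho> \<cdot> \<beta>'))) \<boxplus> (\<beta> \<cdot> (s \<cdot> \<gamma>')) \<cdot> p' = \<beta> \<cdot> ((i \<cdot> \<rho> \<boxplus> s \<cdot> p) \<cdot> \<beta>')"
    unfolding i' p' using t o c r by (simp add: distrib assoc)
  also have "\<dots> = ident C S'" using biproduct_dataD(20)[OF b] t o c \<beta>(4) by simp
  finally have sum: "(i' \<cdot> (\<alpha> \<cdot> (\<rho> \<cdot> \<beta>'))) \<boxplus> (\<beta> \<cdot> (s \<cdot> \<gamma>')) \<cdot> p' = ident C S'" .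
  have "(\<alpha> \<cdot> (\<rho> \<cdot> \<beta>')) \<cdot> i' = ident C A'" "p' \<cdot> (\<beta> \<cdot> (s \<cdot> \<gamma>')) = ident C B'"
    "p' \<cdot> i' = zero_arr C A' B'" "(\<alpha> \<cdot> (\<rho> \<cdot> \<beta>')) \<cdot> (\<beta> \<cdot> (s \<cdot> \<gamma>')) = zero_arr C B' A'"
    unfolding i' p' using t o c r \<alpha>(4) \<gamma>(4) by (simp_all add: assoc)
  thus ?thesis unfolding biproduct_data_def using t o c sum by (simp add: Hom_iff)
qed

end

context sum_closed_subcategory
begin

lemma scw_class_data:
  assumes "(\<phi>, \<psi>) \<in> scw"
  obtains x z y a1 a2 b1 b2 \<rho>1 \<rho>2 s1 s2 c r where "\<phi> = Square x a1 a2 z" "\<psi> = Square z b1 b2 y"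
    "x \<in> M" "y \<in> M" "z \<in> M" "scw_data x z y a1 a2 b1 b2 \<rho>1 \<rho>2 s1 s2 c r" "tgt C c \<in> X"
  using assms
  by (rule scw_classE) (metis mono_objectsE that)

lemma scw_kernel_cokernel:
  assumes "(\<phi>, \<psi>) \<in> scw"
  shows "short_exact S\<^sub>X \<phi> \<psi>"
proof -
  obtain x z y a1 a2 b1 b2 \<rho>1 \<rho>2 s1 s2 c r where e: "\<phi> = Square x a1 a2 z" "\<psi> = Square z b1 b2 y"
    "x \<in> M" "y \<in> M" "z \<in> M" "scw_data x z y a1 a2 b1 b2 \<rho>1 \<rho>2 s1 s2 c r"
    by (rule scw_class_data[OF assms])
  show ?thesis
    using scw_short_exact(3)[OF e(6)] e(1-5) unfolding short_exact_def mono_category_def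
    by (auto intro!: full_kernel full_cokernel)
qed

text \<open>
Splittings and the arrow \<open>r\<close> are transported along the components of the isomorphisms; \<open>r\<close> is in
addition followed by the arrow \<open>g\<close> that \<open>\<alpha>\<close> induces on cokernels.
\<close>

lemma scw_iso_closed:
  assumes E: "(i, p) \<in> scw" and arr: "i' \<in> arr S\<^sub>X" "p' \<in> arr S\<^sub>X" "tgt S\<^sub>X i' = src S\<^sub>X p'"
    and iso: "iso_arr S\<^sub>X \<alpha>" "iso_arr S\<^sub>X \<beta>" "iso_arr S\<^sub>X \<gamma>"
    and hom: "\<alpha> \<in> Hom S\<^sub>X (src S\<^sub>X i) (src S\<^sub>X i')" "\<beta> \<in> Hom S\<^sub>X (tgt S\<^sub>X i) (tgt S\<^sub>X i')"
      "\<gamma> \<in> Hom S\<^sub>X (tgt S\<^sub>X p) (tgt S\<^sub>X p')"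
    and comm: "\<beta> \<cdot>\<^bsub>S\<^sub>X\<^esub> i = i' \<cdot>\<^bsub>S\<^sub>X\<^esub> \<alpha>" "\<gamma> \<cdot>\<^bsub>S\<^sub>X\<^esub> p = p' \<cdot>\<^bsub>S\<^sub>X\<^esub> \<beta>"
  shows "(i', p') \<in> scw"
proof -
  obtain x z y a1 a2 b1 b2 \<rho>1 \<rho>2 s1 s2 c r where e: "i = Square x a1 a2 z" "p = Square z b1 b2 y"
    "x \<in> M" "y \<in> M" "z \<in> M" "scw_data x z y a1 a2 b1 b2 \<rho>1 \<rho>2 s1 s2 c r"
    by (rule scw_class_data[OF E])
  note ee = scw_dataD[OF e(6)]
  note d = biproduct_dataD(1-15)[OF ee(4)] biproduct_dataD(1-15)[OF ee(5)]
  obtain x' a1' a2' z' where i': "i' = Square x' a1' a2' z'" by (cases i')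
  obtain b1' b2' y' where p': "p' = Square z' b1' b2' y'" using arr(3) i' by (cases p') auto
  have M': "x' \<in> M" "z' \<in> M" "y' \<in> M" using arr i' p' by (auto simp: mono_category_arr_iff)
  have sq': "Square x' a1' a2' z' \<in> arr H" "Square z' b1' b2' y' \<in> arr H"
    using arr i' p' by (auto simp: mono_category_arr_iff)
  note s' = sq'[unfolded Square_arr Hom_C]
  \<comment> \<open>an isomorphism of arrows has invertible components, and the inverses form a square, too\<close>
  have inv: "\<exists>u1 u2 v1 v2. \<theta> = Square f u1 u2 g \<and> u1 \<in> Hom C (src C f) (src C g)
    \<and> u2 \<in> Hom C (tgt C f) (tgt C g) \<and>
      v1 \<in> Hom C (src C g) (src C f) \<and> v2 \<in> Hom C (tgt C g) (tgt C f) \<and>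
      v1 \<cdot> u1 = ident C (src C f) \<and> u1 \<cdot> v1 = ident C (src C g) \<and>
      v2 \<cdot> u2 = ident C (tgt C f) \<and> u2 \<cdot> v2 = ident C (tgt C g) \<and> g \<cdot> u1 = u2 \<cdot> f \<and> f \<cdot> v1 = v2 \<cdot> g"
    if \<theta>_iso: "iso_arr S\<^sub>X \<theta>" and \<theta>_hom: "\<theta> \<in> Hom S\<^sub>X f g" for \<theta> f g
  proof -
    obtain u1 u2 where \<theta>: "\<theta> = Square f u1 u2 g" using \<theta>_hom by (cases \<theta>) (auto simp: Hom_iff)
    obtain \<theta>' where \<theta>': "\<theta>' \<in> Hom S\<^sub>X g f" "\<theta>' \<cdot>\<^bsub>S\<^sub>X\<^esub> \<theta> = ident S\<^sub>X f" "\<theta> \<cdot>\<^bsub>S\<^sub>X\<^esub> \<theta>' = ident S\<^sub>X g"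
      using \<theta>_iso \<theta> by (auto simp: iso_arr_def)
    obtain v1 v2 where v: "\<theta>' = Square g v1 v2 f" using \<theta>'(1) by (cases \<theta>') (auto simp: Hom_iff)
    have "Square f u1 u2 g \<in> arr H" "Square g v1 v2 f \<in> arr H"
      using \<theta>_hom \<theta>'(1) \<theta> v by (auto simp: Hom_iff[of _ S\<^sub>X] mono_category_arr_iff)
    thus ?thesis using \<theta> v \<theta>'(2,3) by auto
  qed
  obtain \<alpha>1 \<alpha>2 \<alpha>1' \<alpha>2' where \<alpha>: "\<alpha> = Square x \<alpha>1 \<alpha>2 x'" "\<alpha>1 \<in> Hom C (src C x) (src C x')"
    "\<alpha>2 \<in> Hom C (tgt C x) (tgt C x')" "\<alpha>1' \<in> Hom C (src C x') (src C x)"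
    "\<alpha>2' \<in> Hom C (tgt C x') (tgt C x)" "\<alpha>1' \<cdot> \<alpha>1 = ident C (src C x)" "\<alpha>1 \<cdot> \<alpha>1'
      = ident C (src C x')"
    "\<alpha>2' \<cdot> \<alpha>2 = ident C (tgt C x)" "\<alpha>2 \<cdot> \<alpha>2' = ident C (tgt C x')" "x' \<cdot> \<alpha>1 = \<alpha>2 \<cdot> x"
    using inv[OF iso(1) hom(1)] e(1) i' by auto
  obtain \<beta>1 \<beta>2 \<beta>1' \<beta>2' where \<beta>: "\<beta> = Square z \<beta>1 \<beta>2 z'" "\<beta>1 \<in> Hom C (src C z) (src C z')"
    "\<beta>2 \<in> Hom C (tgt C z) (tgt C z')" "\<beta>1' \<in> Hom C (src C z') (src C z)"
    "\<beta>2' \<in> Hom C (tgt C z') (tgt C z)" "\<beta>1' \<cdot> \<beta>1 = ident C (src C z)" "\<beta>1 \<cdot> \<beta>1'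
      = ident C (src C z')"
    "\<beta>2' \<cdot> \<beta>2 = ident C (tgt C z)" "\<beta>2 \<cdot> \<beta>2' = ident C (tgt C z')" "z \<cdot> \<beta>1' = \<beta>2' \<cdot> z'"
    using inv[OF iso(2) hom(2)] e(1) i' by auto
  obtain \<gamma>1 \<gamma>2 \<gamma>1' \<gamma>2' where \<gamma>: "\<gamma> = Square y \<gamma>1 \<gamma>2 y'" "\<gamma>1 \<in> Hom C (src C y) (src C y')"
    "\<gamma>2 \<in> Hom C (tgt C y) (tgt C y')" "\<gamma>1' \<in> Hom C (src C y') (src C y)"
    "\<gamma>2' \<in> Hom C (tgt C y') (tgt C y)" "\<gamma>1' \<cdot> \<gamma>1 = ident C (src C y)" "\<gamma>1 \<cdot> \<gamma>1'
      = ident C (src C y')"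
    "\<gamma>2' \<cdot> \<gamma>2 = ident C (tgt C y)" "\<gamma>2 \<cdot> \<gamma>2' = ident C (tgt C y')"
    using inv[OF iso(3) hom(3)] e(2) p' by auto
  have comm': "\<beta>1 \<cdot> a1 = a1' \<cdot> \<alpha>1" "\<beta>2 \<cdot> a2 = a2' \<cdot> \<alpha>2" "\<gamma>1 \<cdot> b1 = b1' \<cdot> \<beta>1" "\<gamma>2 \<cdot> b2 = b2' \<cdot> \<beta>2"
    using comm \<alpha>(1) \<beta>(1) \<gamma>(1) e(1,2) i' p' by auto
  have bd1: "biproduct_data C (src C x') (src C z') (src C y') a1' b1' (\<alpha>1 \<cdot> (\<rho>1 \<cdot> \<beta>1')) (\<beta>1 \<cdot> (s1
    \<cdot> \<gamma>1'))"
    by (rule biproduct_data_transport[OF ee(4) \<alpha>(2,4,6,7) \<beta>(2,4,6,7) \<gamma>(2,4,6,7) _ comm'(1) _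
      comm'(3)])
      (use s' in \<open>auto simp: Hom_C\<close>)
  have bd2: "biproduct_data C (tgt C x') (tgt C z') (tgt C y') a2' b2' (\<alpha>2 \<cdot> (\<rho>2 \<cdot> \<beta>2')) (\<beta>2 \<cdot> (s2
    \<cdot> \<gamma>2'))"
    by (rule biproduct_data_transport[OF ee(5) \<alpha>(3,5,8,9) \<beta>(3,5,8,9) \<gamma>(3,5,8,9) _ comm'(2) _
      comm'(4)])
      (use s' in \<open>auto simp: Hom_C\<close>)
  obtain c' where c': "is_cokernel C x' c'" using M'(1) by (rule mono_objectsE)
  have "Square x \<alpha>1 \<alpha>2 x' \<in> arr H" using \<alpha>(2,3,10) s' ee(1) by (simp add: Hom_C)
  then obtain g where g: "g \<in> arr C" "src C g = tgt C c" "tgt C g = tgt C c'" "g \<cdot> c = c' \<cdot> \<alpha>2"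
    by (rule induced_on_cokernels[OF _ ee(8) c'])
  note k = cokernelD[OF c'] cokernelD[OF ee(8)]
  note t = \<alpha>(2-5)[unfolded Hom_C] \<beta>(2-5)[unfolded Hom_C]
  let ?r = "g \<cdot> (r \<cdot> \<beta>2')"
  have r: "?r \<in> arr C" "src C ?r = tgt C z'" "tgt C ?r = tgt C c'" using g t ee(9-11) by auto
  have "?r \<cdot> z' = g \<cdot> ((r \<cdot> z) \<cdot> \<beta>1')"
    using g(1-3) t ee(1-3,9-11) s' by (simp add: assoc \<beta>(10))
  hence rz: "?r \<cdot> z' = zero_arr C (src C z') (tgt C c')"
    using g t ee(12) k s' d src_obj[of z'] by simp
  have "a2' = (a2' \<cdot> \<alpha>2) \<cdot> \<alpha>2'" using s' t \<alpha>(9) k by (simp add: assoc)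
  also have "\<dots> = \<beta>2 \<cdot> (a2 \<cdot> \<alpha>2')" using t d by (simp add: assoc flip: comm'(2))
  finally have a2': "a2' = \<beta>2 \<cdot> (a2 \<cdot> \<alpha>2')" .
  have "?r \<cdot> a2' = (g \<cdot> c) \<cdot> \<alpha>2'"
    unfolding a2' using g(1-3) t ee(9-11) d k reduce[OF \<beta>(8)] reduce[OF ee(13)] by (simp add: assoc)
  also have "\<dots> = c'" using g(4) t k \<alpha>(9) by (simp add: assoc)
  finally have ra: "?r \<cdot> a2' = c'" .
  have "scw_data x' z' y' a1' a2' b1' b2' (\<alpha>1 \<cdot> (\<rho>1 \<cdot> \<beta>1')) (\<alpha>2 \<cdot> (\<rho>2 \<cdot> \<beta>2')) (\<beta>1 \<cdot> (s1 \<cdot> \<gamma>1'))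
    (\<beta>2 \<cdot> (s2 \<cdot> \<gamma>2')) c' ?r"
    unfolding scw_data_def using bd1 bd2 s' c' r rz ra by (simp add: Hom_C)
  thus ?thesis unfolding i' p' by (rule scw_classI) (use M' in auto)
qed

lemma biproduct_data_zero:
  assumes Z: "is_zero_object C Z" and A: "A \<in> obj C"
  shows "biproduct_data C A A Z (ident C A) (zero_arr C A Z) (ident C A) (zero_arr C Z A)"
proof -
  have o: "Z \<in> obj C" using Z by (simp add: is_zero_object_def)
  have u: "\<lbrakk>f \<in> Hom C Z B; g \<in> Hom C Z B\<rbrakk> \<Longrightarrow> f = g" for f g B
    using Z Hom_obj[of f Z B] unfolding is_zero_object_def by blast
  have zz: "zero_arr C Z Z = ident C Z" using u[OF zero_hom ident_hom] o by blast
  show ?thesis unfolding biproduct_data_def using A o zz by (simp add: Hom_C)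
qed

text \<open>
The sequences are \<open>x = x \<rightarrow> 0\<close>, with \<open>r = c\<close>, and \<open>0 \<rightarrow> x = x\<close>, with \<open>r = 0\<close>.
\<close>

lemma scw_ident:
  assumes x: "x \<in> M"
  shows "ident H x \<in> fst ` scw" "ident H x \<in> snd ` scw"
proof -
  obtain Z where Z: "is_zero_object C Z" using zero_object by blast
  have o: "Z \<in> obj C" using Z by (simp add: is_zero_object_def)
  have uZ: "\<lbrakk>f \<in> Hom C Z A; g \<in> Hom C Z A\<rbrakk> \<Longrightarrow> f = g" for f g A
    using Z Hom_obj[of f Z A] unfolding is_zero_object_def by blast
  note ZM = zero_mono_object[OF Z]
  have xa: "x \<in> arr C" using x by (rule mono_objects_arr)
  note ox = src_obj[OF xa] tgt_obj[OF xa]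
  obtain c where c: "is_cokernel C x c" using x by (rule mono_objectsE)
  note k = cokernelD[OF c]
  have "scw_data x x (ident C Z) (ident C (src C x)) (ident C (tgt C x)) (zero_arr C (src C x) Z)
      (zero_arr C (tgt C x) Z) (ident C (src C x)) (ident C (tgt C x)) (zero_arr C Z (src C x))
      (zero_arr C Z (tgt C x)) c c"
    unfolding scw_data_def using xa ox o k c biproduct_data_zero[OF Z ox(1)]
      biproduct_data_zero[OF Z ox(2)]
    by (simp add: Hom_C)
  from scw_classI[OF this x ZM(1) x] show "ident H x \<in> fst ` scw" by force
  have "zero_arr C (tgt C x) Z \<cdot> zero_arr C Z (tgt C x) = ident C Z"
    by (rule uZ[of _ Z]) (use o ox in \<open>auto simp: Hom_C\<close>)
  hence "scw_data (ident C Z) x x (zero_arr C Z (src C x)) (zero_arr C Z (tgt C x)) (ident C (src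
    C x))
      (ident C (tgt C x)) (zero_arr C (src C x) Z) (zero_arr C (tgt C x) Z) (ident C (src C x))
      (ident C (tgt C x)) (ident C Z) (zero_arr C (tgt C x) Z)"
    unfolding scw_data_def
    using xa ox o ZM(2) biproduct_data_swap[OF biproduct_data_zero[OF Z ox(1)]]
      biproduct_data_swap[OF biproduct_data_zero[OF Z ox(2)]]
    by (simp add: Hom_C)
  from scw_classI[OF this ZM(1) x x] show "ident H x \<in> snd ` scw" by force
qed

text \<open>
The pushout \<open>k\<close> of \<open>j\<close> along the cokernel \<open>p\<close> of \<open>i\<close> is the cokernel of \<open>j \<cdot> i\<close>, and it lies in
the subcategory. The retractions of cokernels compose: \<open>rw\<close> retracts to the cokernel of \<open>z\<close>, and
\<open>r\<close> factors through the latter by \<open>g\<close>, so \<open>g \<cdot> rw\<close> has the required properties.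
\<close>

lemma scw_comp_monic:
  assumes "i \<in> fst ` scw" "j \<in> fst ` scw" "sq_tgt i = sq_src j"
  shows "j \<cdot>\<^bsub>H\<^esub> i \<in> fst ` scw"
proof -
  obtain p q where E: "(i, p) \<in> scw" "(j, q) \<in> scw" using assms(1,2) by auto
  obtain x z y i1 i2 p1 p2 \<rho>1 \<rho>2 s1 s2 c r where i: "i = Square x i1 i2 z" "p = Square z p1 p2 y"
    "x \<in> M" "y \<in> M" "z \<in> M" "scw_data x z y i1 i2 p1 p2 \<rho>1 \<rho>2 s1 s2 c r"
    by (rule scw_class_data[OF E(1)])
  obtain w v j1 j2 q1 q2 \<sigma>1 \<sigma>2 t1 t2 cz rw where j: "j = Square z j1 j2 w" "q = Square w q1 q2 v"
    "v \<in> M" "w \<in> M" "scw_data z w v j1 j2 q1 q2 \<sigma>1 \<sigma>2 t1 t2 cz rw"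
    using scw_class_data[OF E(2)] assms(3) i(1) by (metis square.sel(1,4))
  note ei = scw_dataD[OF i(6)]
  note ej = scw_dataD[OF j(5)]
  have P: "Square z p1 p2 y \<in> arr H" by (rule scw_short_exact(2)[OF i(6)])
  obtain k j1' j2' q1' q2' \<sigma>1' \<sigma>2' t1' t2' cy rk
    where k: "scw_data y k v j1' j2' q1' q2' \<sigma>1' \<sigma>2' t1' t2' cy rk" "k \<in> M"
    and F: "Square w (j1' \<cdot> (p1 \<cdot> \<sigma>1) \<boxplus> t1' \<cdot> q1) (j2' \<cdot> (p2 \<cdot> \<sigma>2) \<boxplus> t2' \<cdot> q2) k \<in> arr H"
    by (rule scw_pushout[OF j(5) j(3) i(4) P])
  note ek = scw_dataD[OF k(1)]
  note bd = biproduct_data_compose[OF ei(4) ej(4) ek(4)] biproduct_data_compose[OF ei(5) ej(5)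
    ek(5)]
  note d = biproduct_dataD(1-15)[OF ei(4)] biproduct_dataD(1-15)[OF ei(5)]
    biproduct_dataD(1-15)[OF ej(4)] biproduct_dataD(1-15)[OF ej(5)]
  note kk = cokernelD[OF ei(8)] cokernelD[OF ej(8)]
  obtain g where "g \<in> Hom C (tgt C cz) (tgt C r)" and gc: "g \<cdot> cz = r"
    by (rule cokernel_lift[OF ej(8), of r]) (use ei in auto)
  hence g: "g \<in> arr C" "src C g = tgt C cz" "tgt C g = tgt C c" using ei(11) by (auto simp: Hom_C)
  have sq: "w \<cdot> (j1 \<cdot> i1) = (j2 \<cdot> i2) \<cdot> x"
    by (rule paste_squares[of x z w]) (use ei(1-3,6) ej(1-3,6) d in \<open>auto simp: Hom_C\<close>)
  have rz: "(g \<cdot> rw) \<cdot> w = zero_arr C (src C w) (tgt C c)"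
    using g ej(2,9-12) kk d by (simp add: assoc)
  have "(g \<cdot> rw) \<cdot> (j2 \<cdot> i2) = (g \<cdot> cz) \<cdot> i2"
    using g ej(9-11) kk d by (simp add: assoc reduce[OF ej(13)])
  hence ra: "(g \<cdot> rw) \<cdot> (j2 \<cdot> i2) = c" using gc ei(13) by simp
  have "scw_data x w k (j1 \<cdot> i1) (j2 \<cdot> i2) (j1' \<cdot> (p1 \<cdot> \<sigma>1) \<boxplus> t1' \<cdot> q1) (j2' \<cdot> (p2 \<cdot> \<sigma>2) \<boxplus> t2' \<cdot> q2)
      (\<rho>1 \<cdot> \<sigma>1) (\<rho>2 \<cdot> \<sigma>2) (j1 \<cdot> (s1 \<cdot> \<sigma>1') \<boxplus> t1 \<cdot> q1') (j2 \<cdot> (s2 \<cdot> \<sigma>2') \<boxplus> t2 \<cdot> q2') c (g \<cdot> rw)"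
    unfolding scw_data_def using bd F ei(1,8) ej(2) ek(2) sq rz ra g ej(9-11) by (auto simp: Hom_C)
  from scw_classI[OF this i(3) k(2) j(4)] show ?thesis using i(1) j(1) by force
qed

text \<open>
Dually, the pullback \<open>k\<close> of \<open>p\<close> along the kernel \<open>m\<close> of \<open>q\<close> is the kernel of \<open>q \<cdot> p\<close>. The
retraction now has values in a cokernel of \<open>k\<close>; by \<open>extension_cokernel\<close> this is \<open>T = Cok x \<oplus> Cok u\<close>,
and \<open>r\<close> together with \<open>ry \<cdot> p2\<close>, where \<open>ry\<close> belongs to \<open>q\<close>, gives an arrow into it.
\<close>

lemma scw_comp_epic:
  assumes "p \<in> snd ` scw" "q \<in> snd ` scw" "sq_tgt p = sq_src q"
  shows "q \<cdot>\<^bsub>H\<^esub> p \<in> snd ` scw"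
proof -
  obtain i m where E: "(i, p) \<in> scw" "(m, q) \<in> scw" using assms(1,2) by auto
  obtain x z y i1 i2 p1 p2 \<rho>1 \<rho>2 s1 s2 c r where i: "i = Square x i1 i2 z" "p = Square z p1 p2 y"
    "x \<in> M" "y \<in> M" "z \<in> M" "scw_data x z y i1 i2 p1 p2 \<rho>1 \<rho>2 s1 s2 c r" "tgt C c \<in> X"
    by (rule scw_class_data[OF E(1)])
  obtain u v m1 m2 q1 q2 \<mu>1 \<mu>2 t1 t2 cu ry where j: "m = Square u m1 m2 y" "q = Square y q1 q2 v"
    "u \<in> M" "v \<in> M" "scw_data u y v m1 m2 q1 q2 \<mu>1 \<mu>2 t1 t2 cu ry"
    using scw_class_data[OF E(2)] assms(3) i(2) by (metis square.sel(1,4))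
  note ei = scw_dataD[OF i(6)]
  note ej = scw_dataD[OF j(5)]
  have P: "Square u m1 m2 y \<in> arr H" by (rule scw_short_exact(1)[OF j(5)])
  obtain k i1' i2' p1' p2' \<rho>1' \<rho>2' s1' s2' rk
    where k: "scw_data x k u i1' i2' p1' p2' \<rho>1' \<rho>2' s1' s2' c rk" "k \<in> M"
    and F: "Square k (i1 \<cdot> \<rho>1' \<boxplus> s1 \<cdot> (m1 \<cdot> p1')) (i2 \<cdot> \<rho>2' \<boxplus> s2 \<cdot> (m2 \<cdot> p2')) z \<in> arr H"
    and rf: "r \<cdot> (i2 \<cdot> \<rho>2' \<boxplus> s2 \<cdot> (m2 \<cdot> p2')) = rk"
    by (rule scw_pullback[OF i(6) i(3) i(7) j(3) P])
  note ek = scw_dataD[OF k(1)]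
  note d = biproduct_dataD(1-15)[OF ei(4)] biproduct_dataD(1-15)[OF ei(5)]
    biproduct_dataD(1-15)[OF ej(4)] biproduct_dataD(1-15)[OF ej(5)]
    biproduct_dataD(1-15)[OF ek(4)] biproduct_dataD(1-15)[OF ek(5)]
  \<comment> \<open>the dual of \<open>biproduct_data_compose\<close>, obtained by exchanging the two summands throughout\<close>
  have bd1: "biproduct_data C (src C k) (src C z) (src C v) (i1 \<cdot> \<rho>1' \<boxplus> s1 \<cdot> (m1 \<cdot> p1')) (q1 \<cdot> p1)
      (s1' \<cdot> (\<mu>1 \<cdot> p1) \<boxplus> i1' \<cdot> \<rho>1) (s1 \<cdot> t1)"
    using biproduct_data_swap[OF biproduct_data_compose[OF biproduct_data_swap[OF ej(4)]
      biproduct_data_swap[OF ei(4)] biproduct_data_swap[OF ek(4)]]]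
      sum_comm[of "i1 \<cdot> \<rho>1'" "s1 \<cdot> (m1 \<cdot> p1')"] d by simp
  have bd2: "biproduct_data C (tgt C k) (tgt C z) (tgt C v) (i2 \<cdot> \<rho>2' \<boxplus> s2 \<cdot> (m2 \<cdot> p2')) (q2 \<cdot> p2)
      (s2' \<cdot> (\<mu>2 \<cdot> p2) \<boxplus> i2' \<cdot> \<rho>2) (s2 \<cdot> t2)"
    using biproduct_data_swap[OF biproduct_data_compose[OF biproduct_data_swap[OF ej(5)]
      biproduct_data_swap[OF ei(5)] biproduct_data_swap[OF ek(5)]]]
      sum_comm[of "i2 \<cdot> \<rho>2'" "s2 \<cdot> (m2 \<cdot> p2')"] d by simp
  note kk = cokernelD[OF ei(8)] cokernelD[OF ej(8)]
  obtain T \<iota>1 \<pi>2 \<pi>1 \<iota>2 where T: "biproduct_data C (tgt C c) T (tgt C cu) \<iota>1 \<pi>2 \<pi>1 \<iota>2"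
    using biproducts[OF kk(7,14)] unfolding is_biproduct_iff_data by blast
  note dT = biproduct_dataD(1-15)[OF T]
  note ck = extension_cokernel[OF k(1) ej(8) T]
  let ?f2 = "i2 \<cdot> \<rho>2' \<boxplus> s2 \<cdot> (m2 \<cdot> p2')"
  have f2: "?f2 \<in> arr C" "src C ?f2 = tgt C k" "tgt C ?f2 = tgt C z"
    using F by (auto simp: Hom_C)
  have pf: "p2 \<cdot> ?f2 = m2 \<cdot> p2'"
    using biproduct_calc[OF ei(5)] d by (simp add: distrib)
  let ?r = "\<iota>1 \<cdot> r \<boxplus> \<iota>2 \<cdot> (ry \<cdot> p2)"
  have rt: "?r \<in> Hom C (tgt C z) T" using d dT ei(9-11) ej(9-11) by (simp add: Hom_C)
  have "?r \<cdot> z = \<iota>1 \<cdot> (r \<cdot> z) \<boxplus> \<iota>2 \<cdot> ((ry \<cdot> y) \<cdot> p1)"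
    using d dT ei(1-3,9-11) ej(9-11) by (simp add: distrib assoc ei(7))
  hence rz: "?r \<cdot> z = zero_arr C (src C z) T" using d dT ei(12) ej(12) kk by simp
  have "?r \<cdot> ?f2 = \<iota>1 \<cdot> (r \<cdot> ?f2) \<boxplus> \<iota>2 \<cdot> (ry \<cdot> (p2 \<cdot> ?f2))"
    using d dT f2 ei(9-11) ej(9-11) by (simp add: distrib(2) assoc del: sum_arr)
  also have "\<dots> = \<iota>1 \<cdot> rk \<boxplus> \<iota>2 \<cdot> (cu \<cdot> p2')"
    unfolding rf pf using d dT ej(9-11) by (simp add: reduce[OF ej(13)])
  finally have ra: "?r \<cdot> ?f2 = \<iota>1 \<cdot> rk \<boxplus> \<iota>2 \<cdot> (cu \<cdot> p2')" .
  have sq: "v \<cdot> (q1 \<cdot> p1) = (q2 \<cdot> p2) \<cdot> z"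
    by (rule paste_squares[of z y v]) (use ei(1-3,7) ej(1-3,7) d in \<open>auto simp: Hom_C\<close>)
  have tT: "tgt C (\<iota>1 \<cdot> rk \<boxplus> \<iota>2 \<cdot> (cu \<cdot> p2')) = T" using d dT ek(9-11) kk by simp
  have "scw_data k z v (i1 \<cdot> \<rho>1' \<boxplus> s1 \<cdot> (m1 \<cdot> p1')) ?f2 (q1 \<cdot> p1) (q2 \<cdot> p2)
      (s1' \<cdot> (\<mu>1 \<cdot> p1) \<boxplus> i1' \<cdot> \<rho>1) (s2' \<cdot> (\<mu>2 \<cdot> p2) \<boxplus> i2' \<cdot> \<rho>2) (s1 \<cdot> t1) (s2 \<cdot> t2)
      (\<iota>1 \<cdot> rk \<boxplus> \<iota>2 \<cdot> (cu \<cdot> p2')) ?r"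
    unfolding scw_data_def tT using bd1 bd2 F ei(2) ej(3) ek(2) sq rz ra rt ck by simp
  from scw_classI[OF this k(2) j(4) i(5)] show ?thesis using i(2) j(2) by force
qed

lemma scw_pushout_monic:
  assumes "i \<in> fst ` scw" "f \<in> arr S\<^sub>X" "sq_src f = sq_src i"
  shows "\<exists>i' f'. is_pushout S\<^sub>X i f i' f' \<and> i' \<in> fst ` scw"
proof -
  obtain p where "(i, p) \<in> scw" using assms(1) by auto
  then obtain x z y a1 a2 b1 b2 \<rho>1 \<rho>2 s1 s2 c r where e: "i = Square x a1 a2 z" "x \<in> M" "y \<in> M"
    "z \<in> M"
    "scw_data x z y a1 a2 b1 b2 \<rho>1 \<rho>2 s1 s2 c r"
    by (rule scw_class_data)
  obtain f1 f2 x' where f: "f = Square x f1 f2 x'" using assms(3) e(1) by (cases f) auto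
  have f': "Square x f1 f2 x' \<in> arr H" "x' \<in> M" using assms(2) f
    by (auto simp: mono_category_arr_iff)
  show ?thesis
  proof (rule scw_pushout[OF e(5,3) f'(2,1)])
    fix z' a1' a2' b1' b2' \<rho>1' \<rho>2' s1' s2' c' r'
    let ?f' = "Square z (a1' \<cdot> (f1 \<cdot> \<rho>1) \<boxplus> s1' \<cdot> b1) (a2' \<cdot> (f2 \<cdot> \<rho>2) \<boxplus> s2' \<cdot> b2) z'"
    assume e': "scw_data x' z' y a1' a2' b1' b2' \<rho>1' \<rho>2' s1' s2' c' r'" and z': "z' \<in> M"
      and po: "is_pushout H (Square x a1 a2 z) (Square x f1 f2 x') (Square x' a1' a2' z') ?f'"
    have "is_pushout S\<^sub>X i f (Square x' a1' a2' z') ?f'"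
      unfolding mono_category_def e(1) f using po e(2-4) f'(2) z' by (auto intro!: full_pushout)
    moreover have "Square x' a1' a2' z' \<in> fst ` scw"
      using scw_classI[OF e' f'(2) e(3) z'] by force
    ultimately show ?thesis by blast
  qed
qed

lemma scw_pullback_epic:
  assumes "p \<in> snd ` scw" "f \<in> arr S\<^sub>X" "sq_tgt f = sq_tgt p"
  shows "\<exists>p' f'. is_pullback S\<^sub>X p f p' f' \<and> p' \<in> snd ` scw"
proof -
  obtain i where "(i, p) \<in> scw" using assms(1) by auto
  then obtain x z y a1 a2 b1 b2 \<rho>1 \<rho>2 s1 s2 c r where e: "p = Square z b1 b2 y" "x \<in> M" "y \<in> M"
    "z \<in> M"
    "scw_data x z y a1 a2 b1 b2 \<rho>1 \<rho>2 s1 s2 c r" "tgt C c \<in> X"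
    by (rule scw_class_data)
  obtain f1 f2 y' where f: "f = Square y' f1 f2 y" using assms(3) e(1) by (cases f) auto
  have f': "Square y' f1 f2 y \<in> arr H" "y' \<in> M" using assms(2) f
    by (auto simp: mono_category_arr_iff)
  show ?thesis
  proof (rule scw_pullback[OF e(5,2,6) f'(2,1)])
    fix z' a1' a2' b1' b2' \<rho>1' \<rho>2' s1' s2' r'
    let ?f' = "Square z' (a1 \<cdot> \<rho>1' \<boxplus> s1 \<cdot> (f1 \<cdot> b1')) (a2 \<cdot> \<rho>2' \<boxplus> s2 \<cdot> (f2 \<cdot> b2')) z"
    assume e': "scw_data x z' y' a1' a2' b1' b2' \<rho>1' \<rho>2' s1' s2' c r'" and z': "z' \<in> M"
      and po: "is_pullback H (Square z b1 b2 y) (Square y' f1 f2 y) (Square z' b1' b2' y') ?f'"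
    have "is_pullback S\<^sub>X p f (Square z' b1' b2' y') ?f'"
      unfolding mono_category_def e(1) f using po e(2-4) f'(2) z' by (auto intro!: full_pullback)
    moreover have "Square z' b1' b2' y' \<in> snd ` scw"
      using scw_classI[OF e' e(2) f'(2) z'] by force
    ultimately show ?thesis by blast
  qed
qed

theorem scw_exact_structure: "exact_structure S\<^sub>X scw"
proof (rule exact_structure.intro[OF mono_category_additive], rule exact_structure_axioms.intro)
  show "short_exact S\<^sub>X i p" if "(i, p) \<in> scw" for i p
    using that by (rule scw_kernel_cokernel)
  show "(i', p') \<in> scw"
    if "(i, p) \<in> scw" "i' \<in> arr S\<^sub>X" "p' \<in> arr S\<^sub>X" "tgt S\<^sub>X i' = src S\<^sub>X p'"
      "iso_arr S\<^sub>X a" "iso_arr S\<^sub>X b" "iso_arr S\<^sub>X c"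
      "a \<in> Hom S\<^sub>X (src S\<^sub>X i) (src S\<^sub>X i')" "b \<in> Hom S\<^sub>X (tgt S\<^sub>X i) (tgt S\<^sub>X i')"
      "c \<in> Hom S\<^sub>X (tgt S\<^sub>X p) (tgt S\<^sub>X p')"
      "b \<cdot>\<^bsub>S\<^sub>X\<^esub> i = i' \<cdot>\<^bsub>S\<^sub>X\<^esub> a" "c \<cdot>\<^bsub>S\<^sub>X\<^esub> p = p' \<cdot>\<^bsub>S\<^sub>X\<^esub> b" for i p i' p' a b c
    by (rule scw_iso_closed[OF that])
  show "ident S\<^sub>X x \<in> fst ` scw" "ident S\<^sub>X x \<in> snd ` scw" if "x \<in> obj S\<^sub>X" for x
    using scw_ident[of x] that by simp_all
  show "j \<cdot>\<^bsub>S\<^sub>X\<^esub> i \<in> fst ` scw" if "i \<in> fst ` scw" "j \<in> fst ` scw" "tgt S\<^sub>X i = src S\<^sub>X j" for i j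
    using scw_comp_monic[of i j] that by simp
  show "q \<cdot>\<^bsub>S\<^sub>X\<^esub> p \<in> snd ` scw" if "p \<in> snd ` scw" "q \<in> snd ` scw" "tgt S\<^sub>X p = src S\<^sub>X q" for p q
    using scw_comp_epic[of p q] that by simp
  show "\<exists>i' f'. is_pushout S\<^sub>X i f i' f' \<and> i' \<in> fst ` scw"
    if "i \<in> fst ` scw" "f \<in> arr S\<^sub>X" "src S\<^sub>X f = src S\<^sub>X i" for i f
    using scw_pushout_monic[of i f] that by simp
  show "\<exists>p' f'. is_pullback S\<^sub>X p f p' f' \<and> p' \<in> snd ` scw"
    if "p \<in> snd ` scw" "f \<in> arr S\<^sub>X" "tgt S\<^sub>X f = tgt S\<^sub>X p" for p f
    using scw_pullback_epic[of p f] that by simp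
qed

end

section \<open>Finitely generated modules\<close>

lemma mod_category_sel [simp]:
  "obj (mod_category \<Lambda>) = {M. right_module \<Lambda> M \<and> fin_gen \<Lambda> M}"
  "src (mod_category \<Lambda>) = rsrc"
  "tgt (mod_category \<Lambda>) = rtgt"
  "ident (mod_category \<Lambda>) M = RArrow M (\<lambda>x\<in>carrier M. x) M"
  "g \<cdot>\<^bsub>mod_category \<Lambda>\<^esub> f = RArrow (rsrc f) (compose (carrier (rsrc f)) (rfun g) (rfun f)) (rtgt g)"
  "zero_arr (mod_category \<Lambda>) M N = RArrow M (\<lambda>x\<in>carrier M. \<zero>\<^bsub>N\<^esub>) N"
  "add_arr (mod_category \<Lambda>) f g =
     RArrow (rsrc f) (\<lambda>x\<in>carrier (rsrc f). rfun f x \<oplus>\<^bsub>rtgt f\<^esub> rfun g x) (rtgt f)"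
  by (simp_all add: mod_category_def)

lemma mod_Hom_iff:
  "f \<in> Hom (mod_category \<Lambda>) M N \<longleftrightarrow> M \<in> obj (mod_category \<Lambda>) \<and> N \<in> obj (mod_category \<Lambda>) \<and>
     rsrc f = M \<and> rtgt f = N \<and> rfun f \<in> rmodule_hom \<Lambda> M N \<and> rfun f \<in> extensional (carrier M)"
  by (cases f) (auto simp: Hom_def mod_category_def)

lemma mod_arr_iff: "f \<in> arr (mod_category \<Lambda>) \<longleftrightarrow> f \<in> Hom (mod_category \<Lambda>) (rsrc f) (rtgt f)"
  by (simp add: Hom_def)

lemma mod_arr_eqI:
  assumes "f \<in> Hom (mod_category \<Lambda>) M N" "g \<in> Hom (mod_category \<Lambda>) M N"
    "\<And>x. x \<in> carrier M \<Longrightarrow> rfun f x = rfun g x"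
  shows "f = g"
proof -
  have "rfun f = rfun g" using assms by (auto simp: mod_Hom_iff intro: extensionalityI)
  thus ?thesis using assms by (cases f; cases g) (simp add: mod_Hom_iff)
qed

lemma rmodule_homD:
  assumes "f \<in> rmodule_hom \<Lambda> M N" "x \<in> carrier M"
  shows "f x \<in> carrier N" "y \<in> carrier M \<Longrightarrow> f (x \<oplus>\<^bsub>M\<^esub> y) = f x \<oplus>\<^bsub>N\<^esub> f y"
    "a \<in> carrier \<Lambda> \<Longrightarrow> f (x \<triangleleft>\<^bsub>M\<^esub> a) = f x \<triangleleft>\<^bsub>N\<^esub> a"
  using assms by (auto simp: rmodule_hom_def)

context right_module
begin

lemma zero_ract [simp]: "a \<in> carrier \<Lambda> \<Longrightarrow> \<zero>\<^bsub>M\<^esub> \<triangleleft>\<^bsub>M\<^esub> a = \<zero>\<^bsub>M\<^esub>"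
  using ract_add_left[of "\<zero>\<^bsub>M\<^esub>" "\<zero>\<^bsub>M\<^esub>" a] ract_closed[of "\<zero>\<^bsub>M\<^esub>" a] M.add.l_cancel_one'
  by fastforce

lemma ract_zero [simp]: "x \<in> carrier M \<Longrightarrow> x \<triangleleft>\<^bsub>M\<^esub> \<zero>\<^bsub>\<Lambda>\<^esub> = \<zero>\<^bsub>M\<^esub>"
  using ract_add_right[of x "\<zero>\<^bsub>\<Lambda>\<^esub>" "\<zero>\<^bsub>\<Lambda>\<^esub>"] ract_closed[of x "\<zero>\<^bsub>\<Lambda>\<^esub>"] M.add.l_cancel_one'
  by fastforce

lemma minus_ract:
  assumes "x \<in> carrier M" "a \<in> carrier \<Lambda>"
  shows "(\<ominus>\<^bsub>M\<^esub> x) \<triangleleft>\<^bsub>M\<^esub> a = \<ominus>\<^bsub>M\<^esub> (x \<triangleleft>\<^bsub>M\<^esub> a)"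
  using ract_add_left[of "\<ominus>\<^bsub>M\<^esub> x" x a] assms ract_closed
  by (intro M.minus_equality[symmetric]) (auto simp: M.l_neg)

end

lemma rmodule_hom_zero:
  assumes "right_module \<Lambda> M" "right_module \<Lambda> N" "f \<in> rmodule_hom \<Lambda> M N"
  shows "f \<zero>\<^bsub>M\<^esub> = \<zero>\<^bsub>N\<^esub>"
proof -
  interpret M: right_module \<Lambda> M by fact
  interpret N: right_module \<Lambda> N by fact
  have "f \<zero>\<^bsub>M\<^esub> \<oplus>\<^bsub>N\<^esub> f \<zero>\<^bsub>M\<^esub> = f \<zero>\<^bsub>M\<^esub>"
    using rmodule_homD(2)[OF assms(3), of "\<zero>\<^bsub>M\<^esub>" "\<zero>\<^bsub>M\<^esub>"] by simp
  thus ?thesis using rmodule_homD(1)[OF assms(3), of "\<zero>\<^bsub>M\<^esub>"] N.M.add.l_cancel_one' by fastforce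
qed

lemma rmodule_hom_finsum:
  assumes "right_module \<Lambda> M" "right_module \<Lambda> N" "h \<in> rmodule_hom \<Lambda> M N" "finite T"
    "f \<in> T \<rightarrow> carrier M"
  shows "h (\<Oplus>\<^bsub>M\<^esub>s\<in>T. f s) = (\<Oplus>\<^bsub>N\<^esub>s\<in>T. h (f s))"
proof -
  interpret M: right_module \<Lambda> M by fact
  interpret N: right_module \<Lambda> N by fact
  show ?thesis
    using assms(4,5)
  proof (induction T)
    case empty
    show ?case using rmodule_hom_zero[OF assms(1-3)] by simp
  next
    case (insert s T)
    have "(\<Oplus>\<^bsub>N\<^esub>t\<in>insert s T. h (f t)) = h (f s) \<oplus>\<^bsub>N\<^esub> (\<Oplus>\<^bsub>N\<^esub>t\<in>T. h (f t))"
      using insert rmodule_homD(1)[OF assms(3)] by (intro N.M.finsum_insert) auto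
    moreover have "(\<Oplus>\<^bsub>M\<^esub>t\<in>insert s T. f t) = f s \<oplus>\<^bsub>M\<^esub> (\<Oplus>\<^bsub>M\<^esub>t\<in>T. f t)"
      using insert by (intro M.M.finsum_insert) auto
    moreover have "(\<Oplus>\<^bsub>M\<^esub>t\<in>T. f t) \<in> carrier M"
      using insert by (intro M.M.finsum_closed) auto
    ultimately show ?case using insert rmodule_homD(2)[OF assms(3)] by simp
  qed
qed

text \<open>
Coefficients of a linear combination in \<open>N\<close> are carried along an injective homomorphism \<open>h\<close> and
extended by zero to a larger set \<open>T\<close>. In a direct sum this lets combinations from the two summands
be added coefficientwise over one common generating set.
\<close>

lemma (in right_module) generated_through_hom:
  assumes N: "right_module \<Lambda> N" and h: "h \<in> rmodule_hom \<Lambda> N M" "inj_on h (carrier N)"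
    and S: "finite S" "S \<subseteq> carrier N" and c: "c \<in> S \<rightarrow> carrier \<Lambda>"
    and T: "finite T" "h ` S \<subseteq> T" "T \<subseteq> carrier M"
  obtains d where "d \<in> T \<rightarrow> carrier \<Lambda>"
    "h (\<Oplus>\<^bsub>N\<^esub>s\<in>S. s \<triangleleft>\<^bsub>N\<^esub> c s) = (\<Oplus>\<^bsub>M\<^esub>t\<in>T. t \<triangleleft>\<^bsub>M\<^esub> d t)"
proof -
  interpret N: right_module \<Lambda> N by fact
  have inj: "inj_on h S" using h(2) S(2) inj_on_subset by blast
  define d where "d t = (if t \<in> h ` S then c (the_inv_into S h t) else \<zero>\<^bsub>\<Lambda>\<^esub>)" for t
  have dh: "d (h s) = c s" if "s \<in> S" for s
    using that the_inv_into_f_f[OF inj that] by (simp add: d_def)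
  have d: "d \<in> T \<rightarrow> carrier \<Lambda>"
  proof
    fix t show "d t \<in> carrier \<Lambda>"
    proof (cases "t \<in> h ` S")
      case True
      then obtain s where "s \<in> S" "t = h s" by auto
      thus ?thesis using dh c by auto
    qed (simp add: d_def)
  qed
  have hS: "h s \<in> carrier M" "s \<in> carrier N" if "s \<in> S" for s
    using that S(2) rmodule_homD(1)[OF h(1)] by auto
  have "h (\<Oplus>\<^bsub>N\<^esub>s\<in>S. s \<triangleleft>\<^bsub>N\<^esub> c s) = (\<Oplus>\<^bsub>M\<^esub>s\<in>S. h (s \<triangleleft>\<^bsub>N\<^esub> c s))"
    by (rule rmodule_hom_finsum[OF N right_module_axioms h(1) S(1)]) (use c hS in \<open>auto intro!:
      N.ract_closed\<close>)
  also have "\<dots> = (\<Oplus>\<^bsub>M\<^esub>s\<in>S. h s \<triangleleft>\<^bsub>M\<^esub> d (h s))"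
    using c hS rmodule_homD(3)[OF h(1)] dh
    by (intro M.finsum_cong') (auto intro!: ract_closed simp: Pi_iff)
  also have "\<dots> = (\<Oplus>\<^bsub>M\<^esub>t\<in>h ` S. t \<triangleleft>\<^bsub>M\<^esub> d t)"
    using d T by (intro M.finsum_reindex[symmetric] inj) (auto intro!: ract_closed simp: Pi_iff
      subset_iff)
  also have "\<dots> = (\<Oplus>\<^bsub>M\<^esub>t\<in>T. t \<triangleleft>\<^bsub>M\<^esub> d t)"
    using T d by (intro M.add.finprod_mono_neutral_cong_left) (auto intro!: ract_closed simp:
      d_def Pi_iff subset_iff)
  finally show thesis using that d by blast
qed

text \<open>
The elements of this module are pairs, hence not of the type to which the elements of the objects of
\<open>mod_category\<close> belong; the biproduct is an isomorphic copy.
\<close>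

definition direct_sum :: "('l, 'm) rmodule \<Rightarrow> ('l, 'n) rmodule \<Rightarrow> ('l, 'm \<times> 'n) rmodule" where
  "direct_sum M N = \<lparr>carrier = carrier M \<times> carrier N, monoid.mult = undefined, one = undefined,
     zero = (\<zero>\<^bsub>M\<^esub>, \<zero>\<^bsub>N\<^esub>),
     add = (\<lambda>u v. (fst u \<oplus>\<^bsub>M\<^esub> fst v, snd u \<oplus>\<^bsub>N\<^esub> snd v)),
     ract = (\<lambda>u a. (fst u \<triangleleft>\<^bsub>M\<^esub> a, snd u \<triangleleft>\<^bsub>N\<^esub> a))\<rparr>"

lemma direct_sum_sel [simp]:
  "carrier (direct_sum M N) = carrier M \<times> carrier N"
  "\<zero>\<^bsub>direct_sum M N\<^esub> = (\<zero>\<^bsub>M\<^esub>, \<zero>\<^bsub>N\<^esub>)"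
  "u \<oplus>\<^bsub>direct_sum M N\<^esub> v = (fst u \<oplus>\<^bsub>M\<^esub> fst v, snd u \<oplus>\<^bsub>N\<^esub> snd v)"
  "u \<triangleleft>\<^bsub>direct_sum M N\<^esub> a = (fst u \<triangleleft>\<^bsub>M\<^esub> a, snd u \<triangleleft>\<^bsub>N\<^esub> a)"
  by (simp_all add: direct_sum_def)

lemma direct_sum_right_module:
  assumes "right_module \<Lambda> M" "right_module \<Lambda> N"
  shows "right_module \<Lambda> (direct_sum M N)"
proof -
  interpret M: right_module \<Lambda> M by fact
  interpret N: right_module \<Lambda> N by fact
  have "abelian_group (direct_sum M N)"
  proof (rule abelian_groupI)
    fix u assume "u \<in> carrier (direct_sum M N)"
    thus "\<exists>v\<in>carrier (direct_sum M N). v \<oplus>\<^bsub>direct_sum M N\<^esub> u = \<zero>\<^bsub>direct_sum M N\<^esub>"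
      by (intro bexI[of _ "(\<ominus>\<^bsub>M\<^esub> fst u, \<ominus>\<^bsub>N\<^esub> snd u)"]) (auto simp: M.M.l_neg N.M.l_neg)
  qed (auto simp: M.M.a_ac N.M.a_ac)
  thus ?thesis
    by (intro right_module.intro right_module_axioms.intro M.ring_axioms)
      (auto simp: M.ract_closed N.ract_closed M.ract_add_left N.ract_add_left M.ract_add_right
        N.ract_add_right M.ract_assoc N.ract_assoc M.ract_one N.ract_one)
qed

lemma direct_sum_fin_gen:
  fixes \<Lambda> :: "('l, 'z) ring_scheme" and M :: "('l, 'm) rmodule" and N :: "('l, 'n) rmodule"
  assumes M: "right_module \<Lambda> M" "fin_gen \<Lambda> M" and N: "right_module \<Lambda> N" "fin_gen \<Lambda> N"
  shows "fin_gen \<Lambda> (direct_sum M N)"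
proof -
  interpret M: right_module \<Lambda> M by fact
  interpret N: right_module \<Lambda> N by fact
  let ?D = "direct_sum M N"
  interpret D: right_module \<Lambda> ?D by (rule direct_sum_right_module[OF M(1) N(1)])
  obtain S where S: "finite S" "S \<subseteq> carrier M"
    and genS: "\<forall>x\<in>carrier M. \<exists>c\<in>S \<rightarrow> carrier \<Lambda>. x = (\<Oplus>\<^bsub>M\<^esub>s\<in>S. s \<triangleleft>\<^bsub>M\<^esub> c s)"
    using M(2) unfolding fin_gen_def by blast
  obtain T where T: "finite T" "T \<subseteq> carrier N"
    and genT: "\<forall>x\<in>carrier N. \<exists>c\<in>T \<rightarrow> carrier \<Lambda>. x = (\<Oplus>\<^bsub>N\<^esub>s\<in>T. s \<triangleleft>\<^bsub>N\<^esub> c s)"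
    using N(2) unfolding fin_gen_def by blast
  define il where "il x = (x, \<zero>\<^bsub>N\<^esub>)" for x :: 'm
  define ir where "ir y = (\<zero>\<^bsub>M\<^esub>, y)" for y :: 'n
  have il: "il \<in> rmodule_hom \<Lambda> M ?D" "inj_on il (carrier M)"
    by (auto simp: il_def rmodule_hom_def inj_on_def)
  have ir: "ir \<in> rmodule_hom \<Lambda> N ?D" "inj_on ir (carrier N)"
    by (auto simp: ir_def rmodule_hom_def inj_on_def)
  let ?G = "il ` S \<union> ir ` T"
  have G: "finite ?G" "il ` S \<subseteq> ?G" "ir ` T \<subseteq> ?G" "?G \<subseteq> carrier ?D"
    using S T by (auto simp: il_def ir_def)
  show ?thesis
    unfolding fin_gen_def
  proof (intro exI[of _ ?G] conjI ballI G(1,4))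
    fix u assume u: "u \<in> carrier ?D"
    obtain c where c: "c \<in> S \<rightarrow> carrier \<Lambda>" "fst u = (\<Oplus>\<^bsub>M\<^esub>s\<in>S. s \<triangleleft>\<^bsub>M\<^esub> c s)"
      using genS u by force
    obtain c' where c': "c' \<in> T \<rightarrow> carrier \<Lambda>" "snd u = (\<Oplus>\<^bsub>N\<^esub>s\<in>T. s \<triangleleft>\<^bsub>N\<^esub> c' s)"
      using genT u by force
    obtain d where d: "d \<in> ?G \<rightarrow> carrier \<Lambda>" "il (fst u) = (\<Oplus>\<^bsub>?D\<^esub>t\<in>?G. t \<triangleleft>\<^bsub>?D\<^esub> d t)"
      using D.generated_through_hom[OF M(1) il S c(1) G(1,2,4)] c(2) by metis
    obtain d' where d': "d' \<in> ?G \<rightarrow> carrier \<Lambda>" "ir (snd u) = (\<Oplus>\<^bsub>?D\<^esub>t\<in>?G. t \<triangleleft>\<^bsub>?D\<^esub> d' t)"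
      using D.generated_through_hom[OF N(1) ir T c'(1) G(1,3,4)] c'(2) by metis
    have dG: "d t \<in> carrier \<Lambda>" "d' t \<in> carrier \<Lambda>" "t \<in> carrier ?D" if "t \<in> ?G" for t
      by (rule Pi_mem[OF d(1) that], rule Pi_mem[OF d'(1) that], rule subsetD[OF G(4) that])
    have cl: "t \<triangleleft>\<^bsub>?D\<^esub> k t \<in> carrier ?D" if "k \<in> ?G \<rightarrow> carrier \<Lambda>" "t \<in> ?G" for t k
      by (rule D.ract_closed[OF subsetD[OF G(4) that(2)] Pi_mem[OF that]])
    have "u = il (fst u) \<oplus>\<^bsub>?D\<^esub> ir (snd u)" using u by (auto simp: il_def ir_def)
    also have "\<dots> = (\<Oplus>\<^bsub>?D\<^esub>t\<in>?G. t \<triangleleft>\<^bsub>?D\<^esub> d t \<oplus>\<^bsub>?D\<^esub> t \<triangleleft>\<^bsub>?D\<^esub> d' t)"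
      unfolding d(2) d'(2) by (rule D.M.finsum_addf[symmetric]; rule Pi_I;
        erule cl[OF d(1)] cl[OF d'(1)])
    also have "\<dots> = (\<Oplus>\<^bsub>?D\<^esub>t\<in>?G. t \<triangleleft>\<^bsub>?D\<^esub> (d t \<oplus>\<^bsub>\<Lambda>\<^esub> d' t))"
    proof (rule D.M.finsum_cong'[OF refl])
      show "(\<lambda>t. t \<triangleleft>\<^bsub>?D\<^esub> (d t \<oplus>\<^bsub>\<Lambda>\<^esub> d' t)) \<in> ?G \<rightarrow> carrier ?D"
        by (rule Pi_I, rule D.ract_closed, erule dG(3), rule M.a_closed) (erule dG(1,2))+
      show "t \<triangleleft>\<^bsub>?D\<^esub> d t \<oplus>\<^bsub>?D\<^esub> t \<triangleleft>\<^bsub>?D\<^esub> d' t = t \<triangleleft>\<^bsub>?D\<^esub> (d t \<oplus>\<^bsub>\<Lambda>\<^esub> d' t)" if "t \<in> ?G" for t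
        by (rule D.ract_add_right[OF dG(3)[OF that] dG(1)[OF that] dG(2)[OF that], symmetric])
    qed
    finally show "\<exists>c\<in>?G \<rightarrow> carrier \<Lambda>. u = (\<Oplus>\<^bsub>?D\<^esub>t\<in>?G. t \<triangleleft>\<^bsub>?D\<^esub> c t)"
      by (rule bexI[of _ "\<lambda>t. d t \<oplus>\<^bsub>\<Lambda>\<^esub> d' t"]) (use dG in \<open>blast intro: Pi_I M.a_closed\<close>)
  qed
qed

lemma rmodule_hom_inverse:
  assumes "right_module \<Lambda> M" "h \<in> rmodule_hom \<Lambda> M N" "bij_betw h (carrier M) (carrier N)"
  shows "the_inv_into (carrier M) h \<in> rmodule_hom \<Lambda> N M"
proof -
  interpret M: right_module \<Lambda> M by fact
  have inj: "inj_on h (carrier M)" and im: "h ` carrier M = carrier N"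
    using assms(3) by (auto simp: bij_betw_def)
  note [simp] = the_inv_into_f_f[OF inj]
  have ex: "\<exists>x\<in>carrier M. u = h x" if "u \<in> carrier N" for u using that im by auto
  note hD = rmodule_homD(2,3)[OF assms(2), symmetric]
  show ?thesis
    unfolding rmodule_hom_def
    by (auto dest!: ex simp: hD M.ract_closed)
qed

text \<open>
The type of elements need not contain a distinguished element; \<open>undefined\<close> serves as the only one.
\<close>

definition zero_rmodule :: "('l, 'm) rmodule" where
  "zero_rmodule = \<lparr>carrier = {undefined}, monoid.mult = undefined, one = undefined,
     zero = undefined, add = (\<lambda>_ _. undefined), ract = (\<lambda>_ _. undefined)\<rparr>"

lemma zero_rmodule_object:
  assumes "ring \<Lambda>"
  shows "is_zero_object (mod_category \<Lambda>) (zero_rmodule :: ('l, 'm) rmodule)"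
proof -
  interpret ring \<Lambda> by fact
  let ?Z = "zero_rmodule :: ('l, 'm) rmodule"
  have Z [simp]: "carrier ?Z = {undefined}" "\<zero>\<^bsub>?Z\<^esub> = undefined" "u \<oplus>\<^bsub>?Z\<^esub> v = undefined"
    "u \<triangleleft>\<^bsub>?Z\<^esub> a = undefined" for u v a
    by (simp_all add: zero_rmodule_def)
  have "abelian_group ?Z" by (rule abelian_groupI) auto
  hence rm: "right_module \<Lambda> ?Z"
    by (intro right_module.intro right_module_axioms.intro ring_axioms) auto
  have fg: "fin_gen \<Lambda> ?Z"
    unfolding fin_gen_def by (intro exI[of _ "{}"]) (auto simp: finsum_def finprod_def)
  show ?thesis
    unfolding is_zero_object_def
  proof (intro conjI ballI)
    show "?Z \<in> obj (mod_category \<Lambda>)" using rm fg by simp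
    fix M :: "('l, 'm) rmodule" assume M: "M \<in> obj (mod_category \<Lambda>)"
    then interpret M: right_module \<Lambda> M by simp
    have "zero_arr (mod_category \<Lambda>) M ?Z \<in> Hom (mod_category \<Lambda>) M ?Z"
      using M rm fg by (auto simp: mod_Hom_iff rmodule_hom_def M.ract_closed)
    moreover have "f = g" if "f \<in> Hom (mod_category \<Lambda>) M ?Z" "g \<in> Hom (mod_category \<Lambda>) M ?Z" for f g
      using that by (rule mod_arr_eqI) (use that in \<open>auto simp: mod_Hom_iff rmodule_hom_def Pi_iff\<close>)
    ultimately show "\<exists>!f. f \<in> Hom (mod_category \<Lambda>) M ?Z" by blast
    have "zero_arr (mod_category \<Lambda>) ?Z M \<in> Hom (mod_category \<Lambda>) ?Z M"
      using M rm fg by (auto simp: mod_Hom_iff rmodule_hom_def)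
    moreover have "f = g" if "f \<in> Hom (mod_category \<Lambda>) ?Z M" "g \<in> Hom (mod_category \<Lambda>) ?Z M" for f g
      using that rmodule_hom_zero[OF rm M.right_module_axioms, of "rfun f"]
        rmodule_hom_zero[OF rm M.right_module_axioms, of "rfun g"]
      by (intro mod_arr_eqI[OF that]) (simp_all add: mod_Hom_iff)
    ultimately show "\<exists>!f. f \<in> Hom (mod_category \<Lambda>) ?Z M" by blast
  qed
qed

lemma mod_hom_group:
  assumes M: "M \<in> obj (mod_category \<Lambda>)" and N: "N \<in> obj (mod_category \<Lambda>)"
  shows "comm_group \<lparr>carrier = Hom (mod_category \<Lambda>) M N, monoid.mult = add_arr (mod_category \<Lambda>),
    one = zero_arr (mod_category \<Lambda>) M N\<rparr>"
proof -
  interpret M: right_module \<Lambda> M using M by simp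
  interpret N: right_module \<Lambda> N using N by simp
  let ?C = "mod_category \<Lambda>"
  have add: "add_arr ?C f g \<in> Hom ?C M N" if "f \<in> Hom ?C M N" "g \<in> Hom ?C M N" for f g
    using that by (auto simp: mod_Hom_iff rmodule_hom_def Pi_iff N.ract_add_left N.ract_closed
        M.ract_closed N.M.a_ac)
  have zero: "zero_arr ?C M N \<in> Hom ?C M N"
    using M N by (auto simp: mod_Hom_iff rmodule_hom_def M.ract_closed)
  show ?thesis
  proof (rule comm_groupI; (unfold monoid.simps partial_object.simps)?)
    fix f g h assume f: "f \<in> Hom ?C M N" and g: "g \<in> Hom ?C M N" and h: "h \<in> Hom ?C M N"
    show "add_arr ?C (add_arr ?C f g) h = add_arr ?C f (add_arr ?C g h)"
      using f g h
      by (intro mod_arr_eqI[OF add[OF add[OF f g] h] add[OF f add[OF g h]]])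
        (auto simp: mod_Hom_iff rmodule_hom_def Pi_iff N.M.a_assoc)
  next
    fix f g assume f: "f \<in> Hom ?C M N" and g: "g \<in> Hom ?C M N"
    show "add_arr ?C f g \<in> Hom ?C M N" by (rule add[OF f g])
    show "add_arr ?C f g = add_arr ?C g f"
      using f g
      by (intro mod_arr_eqI[OF add[OF f g] add[OF g f]])
        (auto simp: mod_Hom_iff rmodule_hom_def Pi_iff N.M.a_comm)
  next
    show "zero_arr ?C M N \<in> Hom ?C M N" by (rule zero)
  next
    fix f assume f: "f \<in> Hom ?C M N"
    show "add_arr ?C (zero_arr ?C M N) f = f"
      using f by (intro mod_arr_eqI[OF add[OF zero f] f]) (auto simp: mod_Hom_iff rmodule_hom_def
        Pi_iff)
    let ?n = "RArrow M (\<lambda>x\<in>carrier M. \<ominus>\<^bsub>N\<^esub> rfun f x) N"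
    have n: "?n \<in> Hom ?C M N"
      using f by (auto simp: mod_Hom_iff rmodule_hom_def Pi_iff N.minus_ract M.ract_closed
        N.M.minus_add)
    have "add_arr ?C ?n f = zero_arr ?C M N"
      using f by (intro mod_arr_eqI[OF add[OF n f] zero])
        (auto simp: mod_Hom_iff rmodule_hom_def Pi_iff N.M.l_neg)
    thus "\<exists>g\<in>Hom ?C M N. add_arr ?C g f = zero_arr ?C M N" using n by blast
  qed
qed

text \<open>
The injection \<open>e\<close> provides a copy \<open>P\<close> of the direct sum by \<open>fin_gen_module_representable\<close>, and the
structure maps are transported along the bijection \<open>h\<close> and its inverse \<open>g\<close>.
\<close>

lemma mod_biproduct:
  fixes \<Lambda> :: "('l, 'z) ring_scheme" and e :: "'l list \<Rightarrow> 'm" and M N :: "('l, 'm) rmodule"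
  assumes e: "inj_on e (lists (carrier \<Lambda>))"
    and M: "M \<in> obj (mod_category \<Lambda>)" and N: "N \<in> obj (mod_category \<Lambda>)"
  shows "\<exists>P. is_biproduct (mod_category \<Lambda>) M N P"
proof -
  interpret M: right_module \<Lambda> M using M by simp
  interpret N: right_module \<Lambda> N using N by simp
  let ?D = "direct_sum M N" and ?C = "mod_category \<Lambda> :: (('l, 'm) rmodule, ('l, 'm) rmod_arrow) cat"
  have D: "right_module \<Lambda> ?D" "fin_gen \<Lambda> ?D"
    using M N by (auto intro: direct_sum_right_module direct_sum_fin_gen)
  interpret D: right_module \<Lambda> ?D by (rule D(1))
  obtain P :: "('l, 'm) rmodule" and h where P: "right_module \<Lambda> P" "fin_gen \<Lambda> P"
    and h: "h \<in> rmodule_hom \<Lambda> ?D P" "bij_betw h (carrier ?D) (carrier P)"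
    using fin_gen_module_representable[OF D e] by blast
  interpret P: right_module \<Lambda> P by fact
  define g where "g = the_inv_into (carrier ?D) h"
  have g: "g \<in> rmodule_hom \<Lambda> P ?D" unfolding g_def by (rule rmodule_hom_inverse[OF D(1) h])
  have gh: "g (h u) = u" if "u \<in> carrier ?D" for u
    unfolding g_def using that h(2) by (simp add: bij_betw_def the_inv_into_f_f)
  have hg: "h (g u) = u" if "u \<in> carrier P" for u
    unfolding g_def using that h(2) by (simp add: f_the_inv_into_f_bij_betw)
  note hD = rmodule_homD[OF h(1)] and gD = rmodule_homD[OF g]
  have gc: "fst (g u) \<in> carrier M" "snd (g u) \<in> carrier N" if "u \<in> carrier P" for u
    using gD(1)[OF that] by auto
  let ?i = "RArrow M (\<lambda>x\<in>carrier M. h (x, \<zero>\<^bsub>N\<^esub>)) P" and ?s = "RArrow N (\<lambda>y\<in>carrier N. h (\<zero>\<^bsub>M\<^esub>,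
    y)) P"
    and ?\<rho> = "RArrow P (\<lambda>u\<in>carrier P. fst (g u)) M" and ?p = "RArrow P (\<lambda>u\<in>carrier P. snd (g u)) N"
  have hadd: "h (x, y) \<oplus>\<^bsub>P\<^esub> h (x', y') = h (x \<oplus>\<^bsub>M\<^esub> x', y \<oplus>\<^bsub>N\<^esub> y')"
    if "x \<in> carrier M" "x' \<in> carrier M" "y \<in> carrier N" "y' \<in> carrier N" for x x' y y'
    using hD(2)[of "(x, y)" "(x', y')"] that by simp
  have hract: "h (x, y) \<triangleleft>\<^bsub>P\<^esub> a = h (x \<triangleleft>\<^bsub>M\<^esub> a, y \<triangleleft>\<^bsub>N\<^esub> a)"
    if "x \<in> carrier M" "y \<in> carrier N" "a \<in> carrier \<Lambda>" for x y a
    using hD(3)[of "(x, y)" a] that by simp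
  have hom: "?i \<in> Hom ?C M P" "?s \<in> Hom ?C N P" "?\<rho> \<in> Hom ?C P M" "?p \<in> Hom ?C P N"
    using M N P gc
    by (auto simp: mod_Hom_iff rmodule_hom_def hD(1) hadd hract gD(2,3) M.ract_closed
      N.ract_closed P.ract_closed)
  have "compose (carrier M) (rfun ?\<rho>) (rfun ?i) = (\<lambda>x\<in>carrier M. x)"
    "compose (carrier N) (rfun ?p) (rfun ?s) = (\<lambda>x\<in>carrier N. x)"
    "compose (carrier M) (rfun ?p) (rfun ?i) = (\<lambda>x\<in>carrier M. \<zero>\<^bsub>N\<^esub>)"
    "compose (carrier N) (rfun ?\<rho>) (rfun ?s) = (\<lambda>x\<in>carrier N. \<zero>\<^bsub>M\<^esub>)"
    by (auto simp: compose_def fun_eq_iff hD(1) gh)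
  moreover have "(\<lambda>u\<in>carrier P. compose (carrier P) (rfun ?i) (rfun ?\<rho>) u \<oplus>\<^bsub>P\<^esub> compose (carrier P)
    (rfun ?s) (rfun ?p) u)
      = (\<lambda>u\<in>carrier P. u)"
    using gc hg by (auto simp: compose_def fun_eq_iff hadd)
  ultimately have "biproduct_data ?C M P N ?i ?p ?\<rho> ?s"
    unfolding biproduct_data_def using M N P hom by simp
  thus ?thesis unfolding is_biproduct_iff_data by blast
qed

lemma mod_category_additive:
  fixes \<Lambda> :: "('l, 'z) ring_scheme" and e :: "'l list \<Rightarrow> 'm"
  assumes "ring \<Lambda>" and e: "inj_on e (lists (carrier \<Lambda>))"
  shows "additive_category (mod_category \<Lambda> :: (('l, 'm) rmodule, ('l, 'm) rmod_arrow) cat)"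
proof -
  let ?C = "mod_category \<Lambda> :: (('l, 'm) rmodule, ('l, 'm) rmod_arrow) cat"
  have comp: "g \<cdot>\<^bsub>?C\<^esub> f \<in> Hom ?C M P" if "f \<in> Hom ?C M N" "g \<in> Hom ?C N P" for f g M N P
    using that by (auto simp: mod_Hom_iff rmodule_hom_def compose_def Pi_iff
        right_module.ract_closed abelian_monoid.a_closed[OF abelian_group.axioms(1)]
          right_module_def)
  have add: "add_arr ?C f g \<in> Hom ?C M N" if "f \<in> Hom ?C M N" "g \<in> Hom ?C M N" for f g M N
  proof -
    have "M \<in> obj ?C" "N \<in> obj ?C" using that by (simp_all add: mod_Hom_iff)
    then interpret G: comm_group "\<lparr>carrier = Hom ?C M N, monoid.mult = add_arr ?C, one
      = zero_arr ?C M N\<rparr>"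
      by (rule mod_hom_group)
    show ?thesis using G.m_closed that by simp
  qed
  have ident: "ident ?C M \<in> Hom ?C M M" if "M \<in> obj ?C" for M
    using that by (auto simp: mod_Hom_iff rmodule_hom_def right_module.ract_closed
        abelian_monoid.a_closed[OF abelian_group.axioms(1)] right_module_def)
  show ?thesis
  proof (rule additive_category.intro)
    fix f assume "f \<in> arr ?C"
    thus "src ?C f \<in> obj ?C" "tgt ?C f \<in> obj ?C" by (simp_all add: mod_arr_iff mod_Hom_iff)
  next
    show "ident ?C M \<in> Hom ?C M M" if "M \<in> obj ?C" for M by (rule ident[OF that])
    show "g \<cdot>\<^bsub>?C\<^esub> f \<in> Hom ?C M P" if "f \<in> Hom ?C M N" "g \<in> Hom ?C N P" for f g M N P
      by (rule comp[OF that])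
  next
    fix f g h M N P Q assume f: "f \<in> Hom ?C M N" and g: "g \<in> Hom ?C N P" and h: "h \<in> Hom ?C P Q"
    show "h \<cdot>\<^bsub>?C\<^esub> g \<cdot>\<^bsub>?C\<^esub> f = h \<cdot>\<^bsub>?C\<^esub> (g \<cdot>\<^bsub>?C\<^esub> f)"
      using f g h by (intro mod_arr_eqI[OF comp[OF f comp[OF g h]] comp[OF comp[OF f g] h]])
        (auto simp: mod_Hom_iff rmodule_hom_def compose_def Pi_iff)
  next
    fix f M N assume f: "f \<in> Hom ?C M N"
    have o: "M \<in> obj ?C" "N \<in> obj ?C" using f by (simp_all add: mod_Hom_iff)
    show "f \<cdot>\<^bsub>?C\<^esub> ident ?C M = f"
      using f by (intro mod_arr_eqI[OF comp[OF ident[OF o(1)] f] f]) (auto simp: mod_Hom_iff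
        compose_def)
    show "ident ?C N \<cdot>\<^bsub>?C\<^esub> f = f"
      using f by (intro mod_arr_eqI[OF comp[OF f ident[OF o(2)]] f])
        (auto simp: mod_Hom_iff compose_def rmodule_hom_def)
  next
    show "comm_group \<lparr>carrier = Hom ?C M N, monoid.mult = add_arr ?C, one = zero_arr ?C M N\<rparr>"
      if "M \<in> obj ?C" "N \<in> obj ?C" for M N
      by (rule mod_hom_group[OF that])
  next
    fix f g h M N P assume f: "f \<in> Hom ?C M N" and g: "g \<in> Hom ?C N P" and h: "h \<in> Hom ?C N P"
    show "add_arr ?C g h \<cdot>\<^bsub>?C\<^esub> f = add_arr ?C (g \<cdot>\<^bsub>?C\<^esub> f) (h \<cdot>\<^bsub>?C\<^esub> f)"
      using f g h by (intro mod_arr_eqI[OF comp[OF f add[OF g h]] add[OF comp[OF f g] comp[OF f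
        h]]])
        (auto simp: mod_Hom_iff rmodule_hom_def compose_def Pi_iff)
  next
    fix f g h M N P assume f: "f \<in> Hom ?C M N" and g: "g \<in> Hom ?C M N" and h: "h \<in> Hom ?C N P"
    show "h \<cdot>\<^bsub>?C\<^esub> add_arr ?C f g = add_arr ?C (h \<cdot>\<^bsub>?C\<^esub> f) (h \<cdot>\<^bsub>?C\<^esub> g)"
      using f g h by (intro mod_arr_eqI[OF comp[OF add[OF f g] h] add[OF comp[OF f h] comp[OF g
        h]]])
        (auto simp: mod_Hom_iff rmodule_hom_def compose_def Pi_iff)
  next
    show "\<exists>Z. is_zero_object ?C Z" using zero_rmodule_object[OF assms(1)] by blast
    show "\<exists>P. is_biproduct ?C M N P" if "M \<in> obj ?C" "N \<in> obj ?C" for M N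
      by (rule mod_biproduct[OF e that])
  qed
qed

theorem corollary3p11:
  fixes R :: "('r, 'y) ring_scheme"
    and \<Lambda> :: "('r, 'l, 'z) module_scheme"
    and e :: "'l list \<Rightarrow> 'm"
    and X :: "('l, 'm) rmodule set"
  assumes "artin_algebra R \<Lambda>"
    and "inj_on e (lists (carrier \<Lambda>))"
    and "resolving (mod_category \<Lambda>) X"
    and "contravariantly_finite (mod_category \<Lambda>) X"
  shows "exact_structure (mono_category (mod_category \<Lambda>) X) (scw_class (mod_category \<Lambda>) X)"
proof -
  interpret artin_algebra R \<Lambda> by fact
  interpret additive_category "mod_category \<Lambda> :: (('l, 'm) rmodule, ('l, 'm) rmod_arrow) cat"
    by (rule mod_category_additive[OF ring_axioms assms(2)])
  interpret resolving "mod_category \<Lambda>" X by fact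
  interpret sum_closed_subcategory "mod_category \<Lambda>" X
    by unfold_locales (fact zero_closed, fact sum_closed)
  show ?thesis by (rule scw_exact_structure)
qed

end
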